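(* Let $\tau_{k,\ell}^{(\alpha,\beta)}$ be the $\tau$-functions defined in the context. For all $\alpha,\beta\in\mathbb{Z}$ and $k,\ell\ge0$, $$\tau^{(\alpha,\beta)}_{k,\ell}=\sum_{\substack{n_c+n_d=k,\ n_d+n_e=\ell\\ n_c,n_d,n_e\ge0}}c^{(\alpha,\beta)}_{n_c,n_d,n_e},$$ where $$c^{(\alpha,\beta)}_{n_c,n_d,n_e}=\frac{(-1)^{\frac{n_d(n_d+1)}{2}}}{n_c!\,n_d!\,n_e!}\mathrm{Res}_{\mathbf x,\mathbf y,\mathbf z}\left(\prod_{i=1}^{n_c}C^{(\alpha-\beta)}(x_i)\prod_{i=1}^{n_d}D^{(\alpha)}(y_i)\prod_{i=1}^{n_e}E^{(\beta)}(z_i)\;p_{n_c,n_d,n_e}\right)$$ and $$p_{n_c,n_d,n_e}=\prod_{1\le i<j\le n_c}(x_i-x_j)^2\prod_{1\le i<j\le n_d}(y_i-y_j)^2\prod_{1\le i<j\le n_e}(z_i-z_j)^2\;\frac{\prod_{i=1}^{n_c}\prod_{j=1}^{n_d}(x_i-y_j)\prod_{i=1}^{n_d}\prod_{j=1}^{n_e}(y_i-z_j)}{\prod_{i=1}^{n_c}\prod_{j=1}^{n_e}(x_i-z_j)}.$$ Here $\frac1{x-z}$ is expanded in positive powers of the second variable, $\frac{1}{x-z}=\sum_{i\ge0}\frac{z^i}{x^{i+1}}$, and $\mathrm{Res}_{\mathbf x,\mathbf y,\mathbf z}$ is the residue (coefficient of the $-1$ power) in all of the variables $x_i$, $y_i$,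 $z_i$.
   Context: Three-component Fock space. Let $e_0,e_1,e_2$ be the standard basis of $\mathbb{C}^3$ and $e_az^k$ ($a=0,1,2$, $k\in\mathbb{Z}$) the corresponding basis of $\mathbb{C}^3\otimes\mathbb{C}[z,z^{-1}]$. Let $v_0=e_0\wedge e_1\wedge e_2\wedge e_0z\wedge e_1z\wedge e_2z\wedge e_0z^2\wedge\cdots$. Let $\psi^+_{a,(k)}$ be the wedging operator $\omega\mapsto e_az^k\wedge\omega$ and $\psi^-_{a,(k)}=i(e_az^{-k-1})$ the contraction operator, where $i(e_az^m)(e_az^m\wedge\beta)=\beta$ and $i(e_az^m)$ kills wedges of basis vectors not involving $e_az^m$. They satisfy $[\psi^+_{a,(k)},\psi^-_{b,(l)}]_+=\delta_{ab}\delta_{k+l,-1}$, all other anticommutators being $0$, and $\psi^\pm_{a,(k)}v_0=0$ for $k\ge0$. $F^{(3)}$ is the span of all vectors obtained from $v_0$ by finitely many such operators. A basis is given by the elementary wedges $M_2M_1M_0v_0$, $M_a=M_a^+M_a^-$, where $M_a^\pm=\psi^\pm_{a,(k_1)}\cdots\psi^\pm_{a,(k_s)}$ with $k_1<\cdots<k_s\le-1$ ($s\ge0$); $\langle\,,\rangle$ is the bilinear form for which the elementary wedges are orthonormal. Fields: $\psi_a^\pm(w)=\sum_{k\in\mathbb{Z}}\psi^\pm_{a,(k)}w^{-k-1}$. Fermionic translation operators: $Q_a$ ($a=0,1,2$) are the invertible operators on $F^{(3)}$ determined by $Q_av_0=\psi^+_{a,(-1)}v_0$, $\psi_a^\pm(w)Q_a=w^{\pm1}Q_a\psi_a^\pm(w)$,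 $\psi^\pm_a(w)Q_b=-Q_b\psi_a^\pm(w)$ and $Q_aQ_b=-Q_bQ_a$ for $a\neq b$. Put $T_1=Q_1Q_0^{-1}$, $T_2=Q_2Q_1^{-1}$. Series: $c_i,d_i,e_i$ ($i\in\mathbb{Z}$) are formal variables, $C(w)=\sum_{i\in\mathbb{Z}} c_iw^{-i-1}$, and similarly $D(w)$, $E(w)$ with $d_i$, $e_i$. For $X=C,D,E$ and $\alpha\in\mathbb{Z}$ put $X^{(\alpha)}(w)=(-1)^\alpha w^\alpha X(w)$. The ring $\mathbb{C}[[c_i,d_i,e_i]]_{i\in\mathbb Z}$ consists of all formal, possibly infinite, linear combinations of monomials. $\tau$-functions: with $E_{ab}(w)=\psi_a^+(w)\psi_b^-(w)$ for $a\ne b$, let $$g^{(\alpha,\beta)}=\exp\big(\mathrm{Res}_w C^{(\alpha-\beta)}(w)E_{10}(w)\big)\exp\big(\mathrm{Res}_w D^{(\alpha)}(w)E_{20}(w)\big)\exp\big(\mathrm{Res}_w E^{(\beta)}(w)E_{21}(w)\big)$$ acting on $F^{(3)}$ with values in formal series in the variables; it is the lift of the loop group element $\begin{bmatrix} 1 & 0 & 0 \\ C^{(\alpha-\beta)}(z) & 1 & 0 \\ D^{(\alpha)}(z) & E^{(\beta)}(z) & 1 \end{bmatrix}$. Then $$\tau_{k,\ell}^{(\alpha,\beta)}=\langle T_1^kT_2^\ell v_0,\,g^{(\alpha,\beta)}v_0\rangle\in\mathbb{C}[[c_i,d_i,e_i]]_{i\in\mathbb Z}.$$ *)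

theory Defs
  imports
    Complex_Main
    "HOL-Library.Poly_Mapping"
    "HOL-Library.Numeral_Type"
    "HOL-Library.Product_Plus"
    "HOL-Library.FuncSet"
begin

section \<open>The three-component Fock space\<close>

text \<open>
  The pair \<open>(a, k)\<close> stands for the basis vector \<open>e\<^sub>a z\<^sup>k\<close>; \<open>a\<close> ranges over the three-element type
  \<open>3\<close>, whose elements are \<open>0 < 1 < 2\<close>. The basis vectors are ordered as they occur in
  \<open>\<dots> \<and> e\<^sub>0 \<and> e\<^sub>1 \<and> e\<^sub>2 \<and> e\<^sub>0z \<and> e\<^sub>1z \<and> e\<^sub>2z \<and> \<dots>\<close>. A semi-infinite wedge of basis vectors, written in
  this order, is given by the set of its factors, which differs from that of the vacuum in finitely
  many places. That the span of these wedges is what arises from the vacuum by finitely many wedging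
  and contraction operators is \<open>fock_generated\<close> below.
\<close>

definition prec :: "3 \<times> int \<Rightarrow> 3 \<times> int \<Rightarrow> bool" (infix \<open>\<prec>\<close> 50) where
  "s \<prec> t \<longleftrightarrow> snd s < snd t \<or> snd s = snd t \<and> fst s < fst t"

definition vac_set :: "(3 \<times> int) set" where
  "vac_set = {(a, k). 0 \<le> k}"

typedef wedge = "{S :: (3 \<times> int) set. finite (sym_diff S vac_set)}"
  morphisms factors Abs_wedge
  by (rule exI[of _ vac_set]) simp

setup_lifting type_definition_wedge

lift_definition vac_wedge :: wedge is vac_set by simp

lift_definition add_factor :: "3 \<times> int \<Rightarrow> wedge \<Rightarrow> wedge" is insert
  by (rule finite_subset[rotated], rule finite.insertI, assumption, blast)

lift_definition remove_factor :: "3 \<times> int \<Rightarrow> wedge \<Rightarrow> wedge" is "\<lambda>n S. S - {n}"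
  by (rule finite_subset[rotated], rule finite.insertI, assumption, blast)

type_synonym fock = "wedge \<Rightarrow>\<^sub>0 complex"

definition scale :: "complex \<Rightarrow> fock \<Rightarrow> fock" where
  "scale c = Poly_Mapping.map ((*) c)"

definition wedge_vec :: "wedge \<Rightarrow> fock" where
  "wedge_vec S = Poly_Mapping.single S 1"

definition lin_ext :: "(wedge \<Rightarrow> fock) \<Rightarrow> fock \<Rightarrow> fock" where
  "lin_ext \<phi> v = (\<Sum>S\<in>Poly_Mapping.keys v. scale (Poly_Mapping.lookup v S) (\<phi> S))"

definition vac :: fock where
  "vac = wedge_vec vac_wedge"

definition wedge_sign :: "wedge \<Rightarrow> 3 \<times> int \<Rightarrow> complex" where
  "wedge_sign S n = (- 1) ^ card {s \<in> factors S. s \<prec> n}"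

definition wedging :: "3 \<times> int \<Rightarrow> fock \<Rightarrow> fock" where
  "wedging n = lin_ext (\<lambda>S. if n \<in> factors S then 0
     else scale (wedge_sign S n) (wedge_vec (add_factor n S)))"

definition contraction :: "3 \<times> int \<Rightarrow> fock \<Rightarrow> fock" where
  "contraction n = lin_ext (\<lambda>S. if n \<in> factors S
     then scale (wedge_sign S n) (wedge_vec (remove_factor n S)) else 0)"

definition psi_plus :: "3 \<Rightarrow> int \<Rightarrow> fock \<Rightarrow> fock" where
  "psi_plus a k = wedging (a, k)"

definition psi_minus :: "3 \<Rightarrow> int \<Rightarrow> fock \<Rightarrow> fock" where
  "psi_minus a k = contraction (a, - k - 1)"


subsection \<open>Elementary wedges and the bilinear form\<close>

definition M_component :: "3 \<Rightarrow> int set \<Rightarrow> int set \<Rightarrow> fock \<Rightarrow> fock" where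
  "M_component a P N v =
     foldr (psi_plus a) (sorted_list_of_set P) (foldr (psi_minus a) (sorted_list_of_set N) v)"

definition elementary_wedge :: "(3 \<Rightarrow> int set) \<Rightarrow> (3 \<Rightarrow> int set) \<Rightarrow> fock" where
  "elementary_wedge P N =
     M_component 2 (P 2) (N 2) (M_component 1 (P 1) (N 1) (M_component 0 (P 0) (N 0) vac))"

definition mode_sets :: "(3 \<Rightarrow> int set) \<Rightarrow> bool" where
  "mode_sets K \<longleftrightarrow> (\<forall>a. finite (K a) \<and> K a \<subseteq> {..-1})"

definition is_fock_form :: "(fock \<Rightarrow> fock \<Rightarrow> complex) \<Rightarrow> bool" where
  "is_fock_form B \<longleftrightarrow>
     (\<forall>u. module_hom scale (*) (B u)) \<and>
     (\<forall>v. module_hom scale (*) (\<lambda>u. B u v)) \<and>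
     (\<forall>P N P' N'. mode_sets P \<longrightarrow> mode_sets N \<longrightarrow> mode_sets P' \<longrightarrow> mode_sets N' \<longrightarrow>
        B (elementary_wedge P N) (elementary_wedge P' N') = (if P = P' \<and> N = N' then 1 else 0))"

text \<open>Existence and uniqueness are proved below as \<open>ex1_fock_form\<close>.\<close>

definition fock_form :: "fock \<Rightarrow> fock \<Rightarrow> complex" where
  "fock_form = (THE B. is_fock_form B)"


subsection \<open>Fields and fermionic translation operators\<close>

text \<open>
  A field, i.e. a formal series in \<open>w\<close> with operator coefficients, is given by its coefficients:
  its value at \<open>n\<close> is the coefficient of \<open>w\<^sup>n\<close>.
\<close>

definition psi_plus_field :: "3 \<Rightarrow> int \<Rightarrow> fock \<Rightarrow> fock" where
  "psi_plus_field a n = psi_plus a (- n - 1)"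

definition psi_minus_field :: "3 \<Rightarrow> int \<Rightarrow> fock \<Rightarrow> fock" where
  "psi_minus_field a n = psi_minus a (- n - 1)"

text \<open>Multiplication by \<open>w\<^sup>\<plusminus>\<^sup>1\<close> shifts coefficients: that of \<open>w\<^sup>n\<close> in \<open>w \<psi>(w)\<close> is that of \<open>w\<^sup>n\<^sup>-\<^sup>1\<close> in \<open>\<psi>(w)\<close>.\<close>

definition is_translation_ops :: "(3 \<Rightarrow> fock \<Rightarrow> fock) \<Rightarrow> bool" where
  "is_translation_ops Q \<longleftrightarrow>
     (\<forall>a. module_hom scale scale (Q a) \<and> bij (Q a)) \<and>
     (\<forall>a. Q a vac = psi_plus a (- 1) vac) \<and>
     (\<forall>a n. psi_plus_field a n \<circ> Q a = Q a \<circ> psi_plus_field a (n - 1)) \<and>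
     (\<forall>a n. psi_minus_field a n \<circ> Q a = Q a \<circ> psi_minus_field a (n + 1)) \<and>
     (\<forall>a b n. a \<noteq> b \<longrightarrow>
        psi_plus_field a n \<circ> Q b = (\<lambda>v. - Q b (psi_plus_field a n v)) \<and>
        psi_minus_field a n \<circ> Q b = (\<lambda>v. - Q b (psi_minus_field a n v)) \<and>
        Q a \<circ> Q b = (\<lambda>v. - Q b (Q a v)))"

text \<open>Existence and uniqueness are proved below as \<open>ex1_translation_ops\<close>.\<close>

definition Q_op :: "3 \<Rightarrow> fock \<Rightarrow> fock" where
  "Q_op = (THE Q. is_translation_ops Q)"

definition T1 :: "fock \<Rightarrow> fock" where
  "T1 = Q_op 1 \<circ> inv (Q_op 0)"

definition T2 :: "fock \<Rightarrow> fock" where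
  "T2 = Q_op 2 \<circ> inv (Q_op 1)"

text \<open>\<open>\<psi>\<^sub>a\<^sup>+(w) \<psi>\<^sub>b\<^sup>-(w)\<close> for \<open>a \<noteq> b\<close>; on each vector only finitely many summands do not vanish.\<close>

definition E_field :: "3 \<Rightarrow> 3 \<Rightarrow> int \<Rightarrow> fock \<Rightarrow> fock" where
  "E_field a b n v =
     (\<Sum>p | psi_plus_field a p (psi_minus_field b (n - p) v) \<noteq> 0.
        psi_plus_field a p (psi_minus_field b (n - p) v))"


section \<open>Formal series\<close>

text \<open>
  A formal series is the function that maps an exponent vector to the coefficient of that monomial;
  exponent vectors form a commutative monoid. Products of bilateral series are partial: a
  coefficient of the product is the sum over all ways to write the exponent as a sum of exponents of
  the factors, and it is meaningful if only finitely many of these contribute. This is the case for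
  all products formed below.
\<close>

definition series_times ::
    "('e :: comm_monoid_add \<Rightarrow> complex) \<Rightarrow> ('e \<Rightarrow> complex) \<Rightarrow> 'e \<Rightarrow> complex" (infixl \<open>\<star>\<close> 70) where
  "(f \<star> g) e = (\<Sum>(a, b) \<in> {(a, b). a + b = e \<and> f a \<noteq> 0 \<and> g b \<noteq> 0}. f a * g b)"

definition series_prod ::
    "'i set \<Rightarrow> ('i \<Rightarrow> 'e :: comm_monoid_add \<Rightarrow> complex) \<Rightarrow> 'e \<Rightarrow> complex" where
  "series_prod I f e =
     (\<Sum>\<phi> \<in> {\<phi> \<in> Pi\<^sub>E I (\<lambda>i. {a. f i a \<noteq> 0}). (\<Sum>i\<in>I. \<phi> i) = e}. \<Prod>i\<in>I. f i (\<phi> i))"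

datatype coeff_var = c_var int | d_var int | e_var int

type_synonym coeff_mono = "coeff_var \<Rightarrow>\<^sub>0 nat"

text \<open>An element of \<open>\<complex>[[c\<^sub>i, d\<^sub>i, e\<^sub>i]]\<close> for \<open>i \<in> \<int>\<close>.\<close>

type_synonym coeff_series = "coeff_mono \<Rightarrow> complex"

text \<open>
  A formal series in \<open>w\<close> over that ring is again given by its coefficients: \<open>gen_series v\<close> is
  \<open>\<Sum>i. v\<^sub>i w\<^sup>-\<^sup>i\<^sup>-\<^sup>1\<close>, whose coefficient of \<open>w\<^sup>n\<close> is \<open>v\<^sub>i\<close> for \<open>i = - n - 1\<close>.
\<close>

definition gen_series :: "(int \<Rightarrow> coeff_var) \<Rightarrow> int \<Rightarrow> coeff_series" where
  "gen_series v n m = (if m = Poly_Mapping.single (v (- n - 1)) 1 then 1 else 0)"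

definition C_series :: "int \<Rightarrow> coeff_series" where
  "C_series = gen_series c_var"

definition D_series :: "int \<Rightarrow> coeff_series" where
  "D_series = gen_series d_var"

definition E_series :: "int \<Rightarrow> coeff_series" where
  "E_series = gen_series e_var"

text \<open>\<open>X\<^sup>(\<^sup>\<alpha>\<^sup>)(w) = (-1)\<^sup>\<alpha> w\<^sup>\<alpha> X(w)\<close>\<close>

definition twist :: "int \<Rightarrow> (int \<Rightarrow> coeff_series) \<Rightarrow> int \<Rightarrow> coeff_series" where
  "twist \<alpha> X n m = (- 1) powi \<alpha> * X (n - \<alpha>) m"


section \<open>The tau-functions\<close>

type_synonym fock_series = "coeff_mono \<Rightarrow> fock"

definition const_series :: "fock \<Rightarrow> fock_series" where
  "const_series v m = (if m = 0 then v else 0)"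

text \<open>
  \<open>Res\<^sub>w X(w) A(w)\<close> as an operator on formal series with coefficients in the Fock space: the terms with
  \<open>w\<^sup>p\<close> from \<open>X(w)\<close> and \<open>w\<^sup>-\<^sup>1\<^sup>-\<^sup>p\<close> from \<open>A(w)\<close>.
\<close>

definition res_op ::
    "(int \<Rightarrow> coeff_series) \<Rightarrow> (int \<Rightarrow> fock \<Rightarrow> fock) \<Rightarrow> fock_series \<Rightarrow> fock_series" where
  "res_op X A f m =
     (\<Sum>(p, m1, m2) \<in> {(p, m1, m2). m1 + m2 = m \<and> X p m1 \<noteq> 0}.
        scale (X p m1) (A (- 1 - p) (f m2)))"

text \<open>
  \<open>res_op (twist \<alpha> X) A\<close> for \<open>X = C, D, E\<close> is of degree one in the variables \<open>c\<^sub>i, d\<^sub>i, e\<^sub>i\<close>, so that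
  the exponential series is a finite sum in each coefficient.
\<close>

definition exp_op :: "(fock_series \<Rightarrow> fock_series) \<Rightarrow> fock_series \<Rightarrow> fock_series" where
  "exp_op A f m = (\<Sum>n | (A ^^ n) f m \<noteq> 0. scale (1 / fact n) ((A ^^ n) f m))"

definition g_op :: "int \<Rightarrow> int \<Rightarrow> fock_series \<Rightarrow> fock_series" where
  "g_op \<alpha> \<beta> =
     exp_op (res_op (twist (\<alpha> - \<beta>) C_series) (E_field 1 0)) \<circ>
     exp_op (res_op (twist \<alpha> D_series) (E_field 2 0)) \<circ>
     exp_op (res_op (twist \<beta> E_series) (E_field 2 1))"

definition tau :: "int \<Rightarrow> int \<Rightarrow> nat \<Rightarrow> nat \<Rightarrow> coeff_series" where
  "tau \<alpha> \<beta> k l m = fock_form ((T1 ^^ k) ((T2 ^^ l) vac)) (g_op \<alpha> \<beta> (const_series vac) m)"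


section \<open>The residue formula\<close>

datatype res_var = x_var nat | y_var nat | z_var nat

type_synonym res_mono = "res_var \<Rightarrow>\<^sub>0 int"

definition diff_series :: "res_var \<Rightarrow> res_var \<Rightarrow> res_mono \<Rightarrow> complex" where
  "diff_series u v e =
     (if e = Poly_Mapping.single u 1 then 1 else 0) - (if e = Poly_Mapping.single v 1 then 1 else 0)"

text \<open>\<open>1/(u - v) = \<Sum>i\<ge>0. v\<^sup>i / u\<^sup>i\<^sup>+\<^sup>1\<close>\<close>

definition inv_diff_series :: "res_var \<Rightarrow> res_var \<Rightarrow> res_mono \<Rightarrow> complex" where
  "inv_diff_series u v e =
     (if \<exists>i::nat. e = Poly_Mapping.single u (- int i - 1) + Poly_Mapping.single v (int i)
      then 1 else 0)"

definition discriminant :: "(nat \<Rightarrow> res_var) \<Rightarrow> nat \<Rightarrow> res_mono \<Rightarrow> complex" where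
  "discriminant v n = series_prod {(i, j). 1 \<le> i \<and> i < j \<and> j \<le> n}
     (\<lambda>(i, j). diff_series (v i) (v j) \<star> diff_series (v i) (v j))"

definition p_series :: "nat \<Rightarrow> nat \<Rightarrow> nat \<Rightarrow> res_mono \<Rightarrow> complex" where
  "p_series nc nd ne =
     discriminant x_var nc \<star> discriminant y_var nd \<star> discriminant z_var ne \<star>
     (series_prod ({1..nc} \<times> {1..nd}) (\<lambda>(i, j). diff_series (x_var i) (y_var j)) \<star>
      series_prod ({1..nd} \<times> {1..ne}) (\<lambda>(i, j). diff_series (y_var i) (z_var j)) \<star>
      series_prod ({1..nc} \<times> {1..ne}) (\<lambda>(i, j). inv_diff_series (x_var i) (z_var j)))"

text \<open>
  Series in the \<open>x\<^sub>i, y\<^sub>i, z\<^sub>i\<close> over \<open>\<complex>[[c\<^sub>i, d\<^sub>i, e\<^sub>i]]\<close>: the exponent vector is the pair of the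
  exponents of both kinds of variables.
\<close>

type_synonym dist = "res_mono \<times> coeff_mono \<Rightarrow> complex"

definition at_var :: "(int \<Rightarrow> coeff_series) \<Rightarrow> res_var \<Rightarrow> dist" where
  "at_var X v = (\<lambda>(e, m). if e = Poly_Mapping.single v (Poly_Mapping.lookup e v)
     then X (Poly_Mapping.lookup e v) m else 0)"

definition const_dist :: "(res_mono \<Rightarrow> complex) \<Rightarrow> dist" where
  "const_dist f = (\<lambda>(e, m). if m = 0 then f e else 0)"

definition Res :: "res_var set \<Rightarrow> dist \<Rightarrow> coeff_series" where
  "Res V f m = f (\<Sum>v\<in>V. Poly_Mapping.single v (- 1), m)"

definition c_term :: "int \<Rightarrow> int \<Rightarrow> nat \<Rightarrow> nat \<Rightarrow> nat \<Rightarrow> coeff_series" where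
  "c_term \<alpha> \<beta> nc nd ne m =
     (- 1) ^ (nd * (nd + 1) div 2) / (fact nc * fact nd * fact ne) *
     Res (x_var ` {1..nc} \<union> y_var ` {1..nd} \<union> z_var ` {1..ne})
       (series_prod {1..nc} (\<lambda>i. at_var (twist (\<alpha> - \<beta>) C_series) (x_var i)) \<star>
        series_prod {1..nd} (\<lambda>i. at_var (twist \<alpha> D_series) (y_var i)) \<star>
        series_prod {1..ne} (\<lambda>i. at_var (twist \<beta> E_series) (z_var i)) \<star>
        const_dist (p_series nc nd ne)) m"

section \<open>Well-definedness of the bilinear form and of the translation operators\<close>

lemma lookup_scale [simp]: "Poly_Mapping.lookup (scale c v) S = c * Poly_Mapping.lookup v S"
  unfolding scale_def by transfer (simp add: when_def)

interpretation fock: vector_space scale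
  by unfold_locales (auto intro!: poly_mapping_eqI simp: lookup_add algebra_simps)

lemma scale_minus_one: "scale (- 1) v = - v"
  by (simp add: fock.scale_minus_left)

abbreviation "lin \<equiv> module_hom scale scale"

lemma linI: "(\<And>u v. f (u + v) = f u + f v) \<Longrightarrow> (\<And>c v. f (scale c v) = scale c (f v)) \<Longrightarrow> lin f"
  by (simp add: module_hom_def module_hom_axioms_def fock.module_axioms)

lemma lin_add: "lin f \<Longrightarrow> f (u + v) = f u + f v"
  and lin_scale: "lin f \<Longrightarrow> f (scale c v) = scale c (f v)"
  and lin_zero: "lin f \<Longrightarrow> f 0 = 0"
  and lin_minus: "lin f \<Longrightarrow> f (- v) = - f v"
  by (simp_all add: module_hom.add module_hom.scale module_hom.zero module_hom.neg)

lemma lin_comp: "lin f \<Longrightarrow> lin g \<Longrightarrow> lin (\<lambda>v. f (g v))"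
  by (intro linI) (simp_all add: lin_add lin_scale)

lemma lin_id: "lin (\<lambda>v. v)"
  by (intro linI) simp_all

lemma lin_uminus: "lin f \<Longrightarrow> lin (\<lambda>v. - f v)"
  by (intro linI) (simp_all add: lin_add lin_scale)

lemma lin_ext_superset:
  assumes "finite A" "Poly_Mapping.keys v \<subseteq> A"
  shows "lin_ext \<phi> v = (\<Sum>S\<in>A. scale (Poly_Mapping.lookup v S) (\<phi> S))"
  unfolding lin_ext_def using assms
  by (intro sum.mono_neutral_left) (auto simp: in_keys_iff)

lemma lin_lin_ext: "lin (lin_ext \<phi>)"
proof (rule linI)
  fix u v :: fock
  let ?A = "Poly_Mapping.keys u \<union> Poly_Mapping.keys v"
  have "Poly_Mapping.keys (u + v) \<subseteq> ?A" by (rule keys_add)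
  then show "lin_ext \<phi> (u + v) = lin_ext \<phi> u + lin_ext \<phi> v"
    by (simp add: lin_ext_superset[of ?A] lookup_add fock.scale_left_distrib sum.distrib)
next
  fix c and v :: fock
  have "Poly_Mapping.keys (scale c v) \<subseteq> Poly_Mapping.keys v" by (auto simp: in_keys_iff)
  then show "lin_ext \<phi> (scale c v) = scale c (lin_ext \<phi> v)"
    by (simp add: lin_ext_superset[of "Poly_Mapping.keys v"] fock.scale_sum_right)
qed

lemma lin_ext_wedge_vec [simp]: "lin_ext \<phi> (wedge_vec S) = \<phi> S"
  by (simp add: lin_ext_def wedge_vec_def)

lemma lin_wedging: "lin (wedging n)" and lin_contraction: "lin (contraction n)"
  by (simp_all add: wedging_def contraction_def lin_lin_ext)

lemma fock_expand: "v = (\<Sum>S\<in>Poly_Mapping.keys v. scale (Poly_Mapping.lookup v S) (wedge_vec S))"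
proof (rule poly_mapping_eqI)
  fix T
  have "Poly_Mapping.lookup (\<Sum>S\<in>Poly_Mapping.keys v. scale (Poly_Mapping.lookup v S) (wedge_vec S)) T
     = (\<Sum>S\<in>Poly_Mapping.keys v. if S = T then Poly_Mapping.lookup v S else 0)"
    unfolding lookup_sum by (rule sum.cong) (auto simp: wedge_vec_def lookup_single when_def)
  then show "Poly_Mapping.lookup v T = Poly_Mapping.lookup
      (\<Sum>S\<in>Poly_Mapping.keys v. scale (Poly_Mapping.lookup v S) (wedge_vec S)) T"
    by (simp add: in_keys_iff)
qed

lemma fock_induct [case_names add scale wedge]:
  assumes "\<And>u v. P u \<Longrightarrow> P v \<Longrightarrow> P (u + v)" "\<And>c v. P v \<Longrightarrow> P (scale c v)"
    and "\<And>S. P (wedge_vec S)"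
  shows "P v"
proof -
  have 0: "P 0" using assms(2)[of "wedge_vec S" 0 for S] assms(3) by simp
  have "P (\<Sum>S\<in>A. scale (c S) (wedge_vec S))" if "finite A" for A c
    using that by (induction A) (auto simp: 0 assms)
  then show ?thesis using fock_expand[of v] by (metis finite_keys)
qed

lemma lin_eqI:
  assumes "lin f" "lin g" "\<And>S. f (wedge_vec S) = g (wedge_vec S)"
  shows "f v = g v"
  by (induction v rule: fock_induct) (simp_all add: assms lin_add lin_scale)

lemma wedge_eqI: "factors S = factors T \<Longrightarrow> S = T"
  by (simp add: factors_inject)

lemma finite_factors_diff: "finite (factors S - vac_set)" "finite (vac_set - factors S)"
  using factors[of S] by auto

lemmas factors_simps [simp] = vac_wedge.rep_eq add_factor.rep_eq remove_factor.rep_eq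

lemma prec_irrefl [simp]: "\<not> n \<prec> n"
  by (simp add: prec_def)

lemma finite_below: "finite {s \<in> factors S. s \<prec> n}"
proof (rule finite_subset)
  show "{s \<in> factors S. s \<prec> n} \<subseteq> (factors S - vac_set) \<union> UNIV \<times> {0..snd n}"
    by (auto simp: prec_def vac_set_def)
qed (use finite_factors_diff in auto)

lemma wedge_sign_add [simp]: "wedge_sign (add_factor n S) n = wedge_sign S n"
  unfolding wedge_sign_def by (rule arg_cong[where f = "\<lambda>A. (- 1) ^ card A"]) auto

lemma wedge_sign_remove [simp]: "wedge_sign (remove_factor n S) n = wedge_sign S n"
  unfolding wedge_sign_def by (rule arg_cong[where f = "\<lambda>A. (- 1) ^ card A"]) auto

lemma wedge_sign_cases: "wedge_sign S n = 1 \<or> wedge_sign S n = - 1"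
  unfolding wedge_sign_def by (cases "even (card {s \<in> factors S. s \<prec> n})") auto

lemma wedge_sign_square [simp]: "wedge_sign S n * wedge_sign S n = 1"
  using wedge_sign_cases[of S n] by auto

lemma wedging_wedge_vec: "wedging n (wedge_vec S) =
    (if n \<in> factors S then 0 else scale (wedge_sign S n) (wedge_vec (add_factor n S)))"
  by (simp add: wedging_def)

lemma contraction_wedge_vec: "contraction n (wedge_vec S) =
    (if n \<in> factors S then scale (wedge_sign S n) (wedge_vec (remove_factor n S)) else 0)"
  by (simp add: contraction_def)

lemma add_remove: "n \<in> factors S \<Longrightarrow> add_factor n (remove_factor n S) = S"
  by (rule wedge_eqI) auto

lemma remove_add: "n \<notin> factors S \<Longrightarrow> remove_factor n (add_factor n S) = S"
  by (rule wedge_eqI) auto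

text \<open>The Fock space is spanned by the vectors obtained from the vacuum by wedging and contraction.\<close>

lemma wedge_vec_generated:
  assumes "P vac" "\<And>n v. P v \<Longrightarrow> P (wedging n v)" "\<And>n v. P v \<Longrightarrow> P (contraction n v)"
    and "\<And>c v. P v \<Longrightarrow> P (scale c v)"
  shows "P (wedge_vec S)"
proof (induction "card (sym_diff (factors S) vac_set)" arbitrary: S rule: less_induct)
  case less
  let ?D = "\<lambda>S. sym_diff (factors S) vac_set"
  have fin: "finite (?D S)" for S using factors[of S] by simp
  show ?case
  proof (cases "?D S = {}")
    case True
    then have "S = vac_wedge" by (intro wedge_eqI) auto
    then show ?thesis using assms(1) by (simp add: vac_def)
  next
    case False
    then obtain n where n: "n \<in> ?D S" by blast
    show ?thesis
    proof (cases "n \<in> factors S")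
      case True
      then have "?D (remove_factor n S) = ?D S - {n}" using n by auto
      then have "card (?D (remove_factor n S)) < card (?D S)"
        using fin n by (metis card_Diff1_less)
      then have "P (wedging n (wedge_vec (remove_factor n S)))" using less assms(2) by blast
      then have "P (scale (wedge_sign S n) (wedging n (wedge_vec (remove_factor n S))))"
        by (rule assms(4))
      then show ?thesis using True by (simp add: wedging_wedge_vec add_remove)
    next
      case False
      then have "?D (add_factor n S) = ?D S - {n}" using n by auto
      then have "card (?D (add_factor n S)) < card (?D S)"
        using fin n by (metis card_Diff1_less)
      then have "P (contraction n (wedge_vec (add_factor n S)))" using less assms(3) by blast
      then have "P (scale (wedge_sign S n) (contraction n (wedge_vec (add_factor n S))))"
        by (rule assms(4))
      then show ?thesis using False by (simp add: contraction_wedge_vec remove_add)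
    qed
  qed
qed

lemma fock_generated [case_names add scale vac wedging contraction]:
  assumes "\<And>u v. P u \<Longrightarrow> P v \<Longrightarrow> P (u + v)" "\<And>c v. P v \<Longrightarrow> P (scale c v)"
    and "P vac" "\<And>n v. P v \<Longrightarrow> P (wedging n v)" "\<And>n v. P v \<Longrightarrow> P (contraction n v)"
  shows "P v"
  by (rule fock_induct) (blast intro: assms wedge_vec_generated[of P])+


subsection \<open>The bilinear form\<close>

definition std_form :: "fock \<Rightarrow> fock \<Rightarrow> complex" where
  "std_form u v = (\<Sum>S\<in>Poly_Mapping.keys u. Poly_Mapping.lookup u S * Poly_Mapping.lookup v S)"

lemma std_form_superset:
  assumes "finite A" "Poly_Mapping.keys u \<subseteq> A"
  shows "std_form u v = (\<Sum>S\<in>A. Poly_Mapping.lookup u S * Poly_Mapping.lookup v S)"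
  unfolding std_form_def using assms
  by (intro sum.mono_neutral_left) (auto simp: in_keys_iff)

lemma std_form_wedge_vec: "std_form (wedge_vec S) (wedge_vec T) = (if S = T then 1 else 0)"
  by (auto simp: std_form_def wedge_vec_def lookup_single when_def)

lemma module_complex: "module ((*) :: complex \<Rightarrow> _)"
  by unfold_locales (auto simp: algebra_simps)

lemma functionalI: "(\<And>u v. f (u + v) = f u + f v) \<Longrightarrow> (\<And>c v. f (scale c v) = c * f v) \<Longrightarrow>
    module_hom scale ((*) :: complex \<Rightarrow> _) f"
  by (simp add: module_hom_def module_hom_axioms_def fock.module_axioms module_complex)

lemma std_form_right: "module_hom scale (*) (std_form u)"
  by (rule functionalI)
    (auto simp: std_form_def lookup_add algebra_simps sum.distrib sum_distrib_left)

lemma std_form_left: "module_hom scale (*) (\<lambda>u. std_form u v)"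
proof (rule functionalI)
  fix u u' :: fock
  let ?A = "Poly_Mapping.keys u \<union> Poly_Mapping.keys u'"
  have "Poly_Mapping.keys (u + u') \<subseteq> ?A" by (rule keys_add)
  then show "std_form (u + u') v = std_form u v + std_form u' v"
    by (simp add: std_form_superset[of ?A] lookup_add algebra_simps sum.distrib)
next
  fix c and u :: fock
  have "Poly_Mapping.keys (scale c u) \<subseteq> Poly_Mapping.keys u" by (auto simp: in_keys_iff)
  then show "std_form (scale c u) v = c * std_form u v"
    by (simp add: std_form_superset[of "Poly_Mapping.keys u"] sum_distrib_left algebra_simps)
qed

definition signed_wedge :: "fock \<Rightarrow> wedge \<Rightarrow> bool" where
  "signed_wedge v S \<longleftrightarrow> v = wedge_vec S \<or> v = - wedge_vec S"

lemma signed_wedge_wedging: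
  "signed_wedge v S \<Longrightarrow> n \<notin> factors S \<Longrightarrow> signed_wedge (wedging n v) (add_factor n S)"
  using wedge_sign_cases[of S n]
  by (auto simp: signed_wedge_def lin_minus[OF lin_wedging] wedging_wedge_vec)

lemma signed_wedge_contraction:
  "signed_wedge v S \<Longrightarrow> n \<in> factors S \<Longrightarrow> signed_wedge (contraction n v) (remove_factor n S)"
  using wedge_sign_cases[of S n]
  by (auto simp: signed_wedge_def lin_minus[OF lin_contraction] contraction_wedge_vec)

lemma signed_wedge_foldr_plus:
  assumes "signed_wedge v S" "distinct ks" "\<forall>k\<in>set ks. (a, k) \<notin> factors S"
  shows "\<exists>T. signed_wedge (foldr (psi_plus a) ks v) T \<and> factors T = factors S \<union> Pair a ` set ks"
  using assms(2,3)
proof (induction ks)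
  case Nil
  then show ?case using assms(1) by auto
next
  case (Cons k ks)
  then obtain T where T: "signed_wedge (foldr (psi_plus a) ks v) T"
      "factors T = factors S \<union> Pair a ` set ks" by auto
  have "(a, k) \<notin> factors T" using T Cons.prems by auto
  from signed_wedge_wedging[OF T(1) this] T(2) show ?case
    by (auto simp flip: psi_plus_def intro!: exI[of _ "add_factor (a, k) T"])
qed

lemma signed_wedge_foldr_minus:
  assumes "signed_wedge v S" "distinct ks" "\<forall>k\<in>set ks. (a, - k - 1) \<in> factors S"
  shows "\<exists>T. signed_wedge (foldr (psi_minus a) ks v) T \<and>
    factors T = factors S - (\<lambda>k. (a, - k - 1)) ` set ks"
  using assms(2,3)
proof (induction ks)
  case Nil
  then show ?case using assms(1) by auto
next
  case (Cons k ks)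
  then obtain T where T: "signed_wedge (foldr (psi_minus a) ks v) T"
      "factors T = factors S - (\<lambda>k. (a, - k - 1)) ` set ks" by auto
  have "(a, - k - 1) \<in> factors T" using T Cons.prems by auto
  from signed_wedge_contraction[OF T(1) this] T(2) show ?case
    by (auto simp flip: psi_minus_def intro!: exI[of _ "remove_factor (a, - k - 1) T"])
qed

lemma signed_wedge_M_component:
  assumes "signed_wedge v S" "finite P" "finite N" "P \<subseteq> {..-1}" "N \<subseteq> {..-1}"
    and S: "\<And>k. (a, k) \<in> factors S \<longleftrightarrow> 0 \<le> k"
  shows "\<exists>T. signed_wedge (M_component a P N v) T \<and>
    factors T = (factors S - (\<lambda>k. (a, - k - 1)) ` N) \<union> Pair a ` P"
proof -
  have "\<forall>k\<in>set (sorted_list_of_set N). (a, - k - 1) \<in> factors S"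
    using assms by force
  from signed_wedge_foldr_minus[OF assms(1) _ this] obtain T where
    T: "signed_wedge (foldr (psi_minus a) (sorted_list_of_set N) v) T"
      "factors T = factors S - (\<lambda>k. (a, - k - 1)) ` N"
    using assms(3) by auto
  have "\<forall>k\<in>set (sorted_list_of_set P). (a, k) \<notin> factors T"
    using assms T(2) by force
  from signed_wedge_foldr_plus[OF T(1) _ this] show ?thesis
    using assms(2) T(2) by (auto simp: M_component_def)
qed

lemma exhaust3: "a = 0 \<or> a = 1 \<or> a = (2 :: 3)"
proof (induct a)
  case (of_int z)
  then have "z = 0 \<or> z = 1 \<or> z = 2" by auto
  then show ?case by auto
qed

lemma signed_wedge_elementary:
  assumes "mode_sets P" "mode_sets N"
  shows "\<exists>T. signed_wedge (elementary_wedge P N) T \<and>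
    factors T = {(a, k). if 0 \<le> k then - k - 1 \<notin> N a else k \<in> P a}"
proof -
  have fin: "finite (P a)" "finite (N a)" "P a \<subseteq> {..-1}" "N a \<subseteq> {..-1}" for a
    using assms by (auto simp: mode_sets_def)
  let ?step = "\<lambda>a A. (A - (\<lambda>k. (a, - k - 1)) ` N a) \<union> Pair a ` P a"
  have "signed_wedge vac vac_wedge" by (simp add: signed_wedge_def vac_def)
  moreover have "(0, k) \<in> factors vac_wedge \<longleftrightarrow> 0 \<le> k" for k by (simp add: vac_set_def)
  ultimately obtain T0 where
    T0: "signed_wedge (M_component 0 (P 0) (N 0) vac) T0" "factors T0 = ?step 0 vac_set"
    using signed_wedge_M_component[OF _ fin[of 0], of vac vac_wedge 0] by auto
  have "(1, k) \<in> factors T0 \<longleftrightarrow> 0 \<le> k" for k using T0(2) by (auto simp: vac_set_def)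
  from signed_wedge_M_component[OF T0(1) fin[of 1] this] obtain T1 where
    T1: "signed_wedge (M_component 1 (P 1) (N 1) (M_component 0 (P 0) (N 0) vac)) T1"
      "factors T1 = ?step 1 (?step 0 vac_set)"
    using T0(2) by metis
  have "(2, k) \<in> factors T1 \<longleftrightarrow> 0 \<le> k" for k using T1(2) by (auto simp: vac_set_def)
  from signed_wedge_M_component[OF T1(1) fin[of 2] this] obtain T2 where
    T2: "signed_wedge (elementary_wedge P N) T2"
      "factors T2 = ?step 2 (?step 1 (?step 0 vac_set))"
    using T1(2) unfolding elementary_wedge_def by metis
  have "(a, k) \<in> factors T2 \<longleftrightarrow> (if 0 \<le> k then - k - 1 \<notin> N a else k \<in> P a)" for a k
  proof -
    have img: "(a, k) \<in> (\<lambda>k. (b, - k - 1)) ` N b \<longleftrightarrow> a = b \<and> - k - 1 \<in> N a" for b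
      by (auto simp: image_iff intro!: bexI[of _ "- k - 1"])
    have neg: "j < 0" if "j \<in> P a \<or> j \<in> N a" for j using fin[of a] that by force
    show ?thesis
      using exhaust3[of a] neg[of k] neg[of "- k - 1"] unfolding T2(2) Un_iff Diff_iff img
      by (auto simp: vac_set_def)
  qed
  then show ?thesis using T2(1) by (intro exI[of _ T2]) auto
qed

lemma elementary_wedge_surj:
  "\<exists>P N. mode_sets P \<and> mode_sets N \<and> signed_wedge (elementary_wedge P N) S"
proof -
  define P N where "P a = {k. k < 0 \<and> (a, k) \<in> factors S}"
    and "N a = (\<lambda>k. - k - 1) ` {k. 0 \<le> k \<and> (a, k) \<notin> factors S}" for a
  have "P a \<subseteq> snd ` (factors S - vac_set)" for a
    by (force simp: P_def vac_set_def)
  then have P: "mode_sets P"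
    by (auto simp: mode_sets_def P_def intro: finite_subset[OF _ finite_imageI[OF finite_factors_diff(1)]])
  have "{k. 0 \<le> k \<and> (a, k) \<notin> factors S} \<subseteq> snd ` (vac_set - factors S)" for a
    by (force simp: vac_set_def)
  then have "finite {k. 0 \<le> k \<and> (a, k) \<notin> factors S}" for a
    by (rule finite_subset) (simp add: finite_factors_diff)
  then have N: "mode_sets N"
    by (auto simp: mode_sets_def N_def)
  obtain T where T: "signed_wedge (elementary_wedge P N) T"
      "factors T = {(a, k). if 0 \<le> k then - k - 1 \<notin> N a else k \<in> P a}"
    using signed_wedge_elementary[OF P N] by blast
  have "T = S" by (rule wedge_eqI) (auto simp: T(2) P_def N_def image_iff split: if_splits)
  then show ?thesis using P N T(1) by blast
qed

lemma factors_determine_modes: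
  assumes "mode_sets P" "mode_sets N" "mode_sets P'" "mode_sets N'"
    and eq: "{(a, k). if 0 \<le> k then - k - 1 \<notin> N a else k \<in> P a} =
         {(a, k). if (0::int) \<le> k then - k - 1 \<notin> N' a else k \<in> P' a}"
  shows "P = P' \<and> N = N'"
proof -
  have iff: "(if 0 \<le> k then - k - 1 \<notin> N a else k \<in> P a) \<longleftrightarrow>
      (if 0 \<le> k then - k - 1 \<notin> N' a else k \<in> P' a)" for a :: 3 and k :: int
    using eq by (auto simp: set_eq_iff)
  have neg: "k < 0" if "k \<in> P a \<or> k \<in> P' a \<or> k \<in> N a \<or> k \<in> N' a" for a k
    using that assms(1-4) unfolding mode_sets_def by (force simp: subset_iff)
  have "k \<in> P a \<longleftrightarrow> k \<in> P' a" for a k using iff[of k a] neg[of k a] by auto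
  moreover have "k \<in> N a \<longleftrightarrow> k \<in> N' a" for a k
    using iff[of "- k - 1" a] neg[of k a] by (auto split: if_splits)
  ultimately show ?thesis by (intro conjI ext set_eqI) auto
qed

lemma functional_minus: "module_hom scale ((*) :: complex \<Rightarrow> _) f \<Longrightarrow> f (- v) = - f v"
  by (simp add: module_hom.neg)

lemma std_form_minus [simp]: "std_form (- u) v = - std_form u v" "std_form u (- v) = - std_form u v"
  using functional_minus[OF std_form_left] functional_minus[OF std_form_right] by blast+

lemma is_fock_form_std_form: "is_fock_form std_form"
  unfolding is_fock_form_def
proof (intro conjI allI impI std_form_left std_form_right)
  fix P N P' N'
  assume *: "mode_sets P" "mode_sets N" "mode_sets P'" "mode_sets N'"
  from signed_wedge_elementary[OF *(1,2)] obtain T where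
    T: "signed_wedge (elementary_wedge P N) T"
      "factors T = {(a, k). if 0 \<le> k then - k - 1 \<notin> N a else k \<in> P a}" by blast
  from signed_wedge_elementary[OF *(3,4)] obtain T' where
    T': "signed_wedge (elementary_wedge P' N') T'"
      "factors T' = {(a, k). if 0 \<le> k then - k - 1 \<notin> N' a else k \<in> P' a}" by blast
  show "std_form (elementary_wedge P N) (elementary_wedge P' N') =
      (if P = P' \<and> N = N' then 1 else 0)"
  proof (cases "P = P' \<and> N = N'")
    case True
    then show ?thesis using T(1) by (auto simp: signed_wedge_def std_form_wedge_vec)
  next
    case False
    then have "T \<noteq> T'" using factors_determine_modes[OF *] T(2) T'(2) by metis
    then show ?thesis using T(1) T'(1) False by (auto simp: signed_wedge_def std_form_wedge_vec)
  qed
qed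

lemma is_fock_form_unique:
  assumes "is_fock_form B"
  shows "B = std_form"
proof (intro ext)
  fix u v
  have R: "module_hom scale (*) (B u)" and L: "module_hom scale (*) (\<lambda>u. B u v)" for u v
    using assms by (auto simp: is_fock_form_def)
  have minus: "B (- u) v = - B u v" "B u (- v) = - B u v" for u v
    using functional_minus[OF R] functional_minus[OF L] by blast+
  have basis: "B (wedge_vec S) (wedge_vec T) = std_form (wedge_vec S) (wedge_vec T)" for S T
  proof -
    obtain P N where S: "mode_sets P" "mode_sets N" "signed_wedge (elementary_wedge P N) S"
      using elementary_wedge_surj by blast
    obtain P' N' where T: "mode_sets P'" "mode_sets N'" "signed_wedge (elementary_wedge P' N') T"
      using elementary_wedge_surj by blast
    have "B (elementary_wedge P N) (elementary_wedge P' N') =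
        std_form (elementary_wedge P N) (elementary_wedge P' N')"
      using assms is_fock_form_std_form S(1,2) T(1,2) unfolding is_fock_form_def by metis
    then show ?thesis using S(3) T(3) by (auto simp: signed_wedge_def minus)
  qed
  have "B (wedge_vec S) v = std_form (wedge_vec S) v" for S
    by (induction v rule: fock_induct)
      (simp_all add: basis module_hom.add[OF R] module_hom.scale[OF R]
        module_hom.add[OF std_form_right] module_hom.scale[OF std_form_right])
  then show "B u v = std_form u v"
    by (induction u rule: fock_induct)
      (simp_all add: module_hom.add[OF L] module_hom.scale[OF L]
        module_hom.add[OF std_form_left] module_hom.scale[OF std_form_left])
qed

theorem ex1_fock_form: "\<exists>!B. is_fock_form B"
  using is_fock_form_std_form is_fock_form_unique by blast

lemma fock_form_eq: "fock_form = std_form"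
  unfolding fock_form_def using is_fock_form_std_form is_fock_form_unique by blast


subsection \<open>The translation operators\<close>

text \<open>
  Explicitly, \<open>Q\<^sub>a\<close> shifts the factors \<open>e\<^sub>a z\<^sup>k\<close> to \<open>e\<^sub>a z\<^sup>k\<^sup>-\<^sup>1\<close>. A factor of another component is
  passed by exactly one \<open>e\<^sub>a z\<^sup>k\<close>, its partner, and contributes a sign if the partner does not occur.
\<close>

definition shift :: "3 \<Rightarrow> 3 \<times> int \<Rightarrow> 3 \<times> int" where
  "shift a n = (if fst n = a then (a, snd n - 1) else n)"

definition unshift :: "3 \<Rightarrow> 3 \<times> int \<Rightarrow> 3 \<times> int" where
  "unshift a n = (if fst n = a then (a, snd n + 1) else n)"

definition partner :: "3 \<Rightarrow> 3 \<times> int \<Rightarrow> 3 \<times> int" where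
  "partner a n = (a, if a < fst n then snd n + 1 else snd n)"

lemma shift_unshift [simp]: "shift a (unshift a n) = n" "unshift a (shift a n) = n"
  by (cases n; simp add: shift_def unshift_def)+

lemma inj_shift: "inj (shift a)"
  by (metis injI shift_unshift(2))

lemma inj_unshift: "inj (unshift a)"
  by (metis injI shift_unshift(1))

lemma mem_shift_image: "n \<in> shift a ` A \<longleftrightarrow> unshift a n \<in> A"
  by (metis image_iff shift_unshift)

lemma mem_unshift_image: "n \<in> unshift a ` A \<longleftrightarrow> shift a n \<in> A"
  by (metis image_iff shift_unshift)

lemma shift_vac: "sym_diff (shift a ` vac_set) vac_set = {(a, - 1)}"
proof (rule set_eqI)
  fix n show "n \<in> sym_diff (shift a ` vac_set) vac_set \<longleftrightarrow> n \<in> {(a, - 1)}"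
    unfolding Un_iff Diff_iff mem_shift_image by (cases n) (auto simp: vac_set_def unshift_def)
qed

lemma unshift_vac: "sym_diff (unshift a ` vac_set) vac_set = {(a, 0)}"
proof (rule set_eqI)
  fix n show "n \<in> sym_diff (unshift a ` vac_set) vac_set \<longleftrightarrow> n \<in> {(a, 0)}"
    unfolding Un_iff Diff_iff mem_unshift_image by (cases n) (auto simp: vac_set_def shift_def)
qed

lemma finite_image_sym_diff:
  assumes "finite (sym_diff S V)" "finite (sym_diff (f ` V) V)"
  shows "finite (sym_diff (f ` S) V)"
  by (rule finite_subset[of _ "f ` sym_diff S V \<union> sym_diff (f ` V) V"]) (use assms in auto)

lift_definition shift_wedge :: "3 \<Rightarrow> wedge \<Rightarrow> wedge" is "\<lambda>a S. shift a ` S"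
  by (rule finite_image_sym_diff) (simp_all only: shift_vac, auto)

lift_definition unshift_wedge :: "3 \<Rightarrow> wedge \<Rightarrow> wedge" is "\<lambda>a S. unshift a ` S"
  by (rule finite_image_sym_diff) (simp_all only: unshift_vac, auto)

lemmas shift_wedge_simps [simp] = shift_wedge.rep_eq unshift_wedge.rep_eq

lemma shift_unshift_wedge [simp]:
  "shift_wedge a (unshift_wedge a S) = S" "unshift_wedge a (shift_wedge a S) = S"
  by (rule wedge_eqI, simp add: image_image)+

lemma mem_shift_wedge [simp]: "shift a n \<in> shift a ` A \<longleftrightarrow> n \<in> A"
  by (rule inj_image_mem_iff[OF inj_shift])

lemma shift_wedge_add: "shift_wedge a (add_factor n S) = add_factor (shift a n) (shift_wedge a S)"
  by (rule wedge_eqI) simp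

lemma shift_wedge_remove:
  "shift_wedge a (remove_factor n S) = remove_factor (shift a n) (shift_wedge a S)"
  by (rule wedge_eqI) (simp add: image_set_diff[OF inj_shift])

definition unpaired :: "3 \<Rightarrow> wedge \<Rightarrow> (3 \<times> int) set" where
  "unpaired a S = {s \<in> factors S. fst s \<noteq> a \<and> partner a s \<notin> factors S}"

definition shift_sign :: "3 \<Rightarrow> wedge \<Rightarrow> complex" where
  "shift_sign a S = (- 1) ^ card (unpaired a S)"

lemma finite_unpaired: "finite (unpaired a S)"
proof (rule finite_subset)
  show "unpaired a S \<subseteq> (factors S - vac_set) \<union> UNIV \<times> (snd ` (vac_set - factors S) \<union>
      (\<lambda>k. k - 1) ` snd ` (vac_set - factors S))"
  proof
    fix s assume s: "s \<in> unpaired a S"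
    show "s \<in> (factors S - vac_set) \<union> UNIV \<times> (snd ` (vac_set - factors S) \<union>
      (\<lambda>k. k - 1) ` snd ` (vac_set - factors S))"
    proof (cases "s \<in> vac_set")
      case True
      then have *: "partner a s \<in> vac_set - factors S"
        using s by (auto simp: unpaired_def partner_def vac_set_def split: if_splits)
      have "snd s = snd (partner a s) \<or> snd s = snd (partner a s) - 1"
        by (auto simp: partner_def)
      with * show ?thesis by (cases s) (auto simp: image_iff)
    qed (use s in \<open>auto simp: unpaired_def\<close>)
  qed
qed (use finite_factors_diff in auto)

lemma shift_sign_cases: "shift_sign a S = 1 \<or> shift_sign a S = - 1"
  unfolding shift_sign_def by (cases "even (card (unpaired a S))") auto

lemma shift_sign_square [simp]: "shift_sign a S * shift_sign a S = 1"
  using shift_sign_cases[of a S] by auto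

lemma wedge_sign_shift: "wedge_sign (shift_wedge a S) (shift a n) =
    (- 1) ^ card {s \<in> factors S. shift a s \<prec> shift a n}"
proof -
  have "{s \<in> factors (shift_wedge a S). s \<prec> shift a n} =
      shift a ` {s \<in> factors S. shift a s \<prec> shift a n}" by auto
  then show ?thesis
    unfolding wedge_sign_def by (simp only: card_image[OF inj_on_subset[OF inj_shift subset_UNIV]])
qed

lemma minus_one_power_diff: "k \<le> n \<Longrightarrow> (- 1) ^ (n - k) = (- 1 :: complex) ^ n * (- 1) ^ k"
  by (auto simp: le_iff_add power_add minus_one_power_iff)

lemma shift_sign_add:
  assumes n: "n \<notin> factors S"
  shows "wedge_sign (shift_wedge a S) (shift a n) * shift_sign a S =
    (if fst n = a then 1 else - 1) * (shift_sign a (add_factor n S) * wedge_sign S n)"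
proof (cases "fst n = a")
  case True
  define R where "R = {s \<in> factors S. fst s \<noteq> a \<and> partner a s = n}"
  have un: "unpaired a (add_factor n S) = unpaired a S - R"
    using n True by (auto simp: unpaired_def R_def)
  have RU: "R \<subseteq> unpaired a S" using n by (auto simp: R_def unpaired_def)
  have RB: "R \<subseteq> {s \<in> factors S. s \<prec> n}"
    by (auto simp: R_def partner_def prec_def split: if_splits)
  have be: "{s \<in> factors S. shift a s \<prec> shift a n} = {s \<in> factors S. s \<prec> n} - R"
  proof -
    have "shift a s \<prec> shift a n \<longleftrightarrow> s \<prec> n \<and> \<not> (fst s \<noteq> a \<and> partner a s = n)" for s
      using True by (cases s; cases n) (auto simp: shift_def partner_def prec_def)
    then show ?thesis by (auto simp: R_def)
  qed
  have fin: "finite R" using RU finite_unpaired finite_subset by blast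
  have c: "card R \<le> card (unpaired a S)" "card R \<le> card {s \<in> factors S. s \<prec> n}"
    using RU RB finite_unpaired finite_below by (meson card_mono)+
  show ?thesis
    unfolding wedge_sign_shift be shift_sign_def un unfolding wedge_sign_def
      card_Diff_subset[OF fin RU] card_Diff_subset[OF fin RB]
      minus_one_power_diff[OF c(1)] minus_one_power_diff[OF c(2)]
    by (simp only: if_P[OF True] mult_1_left mult.assoc mult.commute mult.left_commute)
next
  case False
  have sn: "shift a n = n" using False by (simp add: shift_def)
  have un: "unpaired a (add_factor n S) =
      (if partner a n \<in> factors S then unpaired a S else insert n (unpaired a S))"
    using n False by (auto simp: unpaired_def partner_def)
  have nu: "n \<notin> unpaired a S" using n by (simp add: unpaired_def)
  have be: "{s \<in> factors S. shift a s \<prec> shift a n} = (if partner a n \<in> factors S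
      then insert (partner a n) {s \<in> factors S. s \<prec> n} else {s \<in> factors S. s \<prec> n})"
  proof -
    have "shift a s \<prec> n \<longleftrightarrow> s \<prec> n \<or> s = partner a n" for s
      using False by (cases s; cases n) (auto simp: shift_def partner_def prec_def)
    then show ?thesis using sn by auto
  qed
  have np: "partner a n \<notin> {s \<in> factors S. s \<prec> n}"
    by (auto simp: partner_def prec_def split: if_splits)
  show ?thesis
  proof (cases "partner a n \<in> factors S")
    case True
    show ?thesis
      unfolding wedge_sign_shift be shift_sign_def un unfolding wedge_sign_def if_P[OF True] if_not_P[OF False]
        card_insert_disjoint[OF finite_below np] power_Suc
      by (simp only: mult.assoc mult.commute mult.left_commute)
  next
    case F: False
    show ?thesis
      unfolding wedge_sign_shift be shift_sign_def un unfolding wedge_sign_def if_not_P[OF F] if_not_P[OF False]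
        card_insert_disjoint[OF finite_unpaired nu] power_Suc
      by (simp only: mult.assoc mult.commute mult.left_commute mult_minus1 mult_minus1_right
          mult_minus_left mult_minus_right minus_minus mult_1_left)
  qed
qed

definition std_Q :: "3 \<Rightarrow> fock \<Rightarrow> fock" where
  "std_Q a = lin_ext (\<lambda>S. scale (shift_sign a S) (wedge_vec (shift_wedge a S)))"

definition std_Q_inv :: "3 \<Rightarrow> fock \<Rightarrow> fock" where
  "std_Q_inv a =
     lin_ext (\<lambda>S. scale (shift_sign a (unshift_wedge a S)) (wedge_vec (unshift_wedge a S)))"

lemma std_Q_wedge_vec:
  "std_Q a (wedge_vec S) = scale (shift_sign a S) (wedge_vec (shift_wedge a S))"
  by (simp add: std_Q_def)

lemma lin_std_Q: "lin (std_Q a)" and lin_std_Q_inv: "lin (std_Q_inv a)"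
  by (simp_all add: std_Q_def std_Q_inv_def lin_lin_ext)

lemma bij_std_Q: "bij (std_Q a)"
proof (rule o_bij)
  have "std_Q_inv a (std_Q a v) = v" for v
    by (rule lin_eqI[OF lin_comp[OF lin_std_Q_inv lin_std_Q] lin_id])
      (simp add: std_Q_wedge_vec lin_scale[OF lin_std_Q_inv], simp add: std_Q_inv_def)
  then show "std_Q_inv a \<circ> std_Q a = id" by auto
  have "std_Q a (std_Q_inv a v) = v" for v
    by (rule lin_eqI[OF lin_comp[OF lin_std_Q lin_std_Q_inv] lin_id])
      (simp add: std_Q_inv_def lin_scale[OF lin_std_Q] std_Q_wedge_vec)
  then show "std_Q a \<circ> std_Q_inv a = id" by auto
qed

lemma std_Q_vac: "std_Q a vac = psi_plus a (- 1) vac"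
proof -
  have "unpaired a vac_wedge = {}" by (auto simp: unpaired_def partner_def vac_set_def)
  then have 1: "shift_sign a vac_wedge = 1" by (simp add: shift_sign_def)
  have "{s \<in> factors vac_wedge. s \<prec> (a, - 1)} = {}" by (auto simp: prec_def vac_set_def)
  then have 2: "wedge_sign vac_wedge (a, - 1) = 1" unfolding wedge_sign_def by (metis card.empty power_0)
  have 3: "(a, - 1) \<notin> vac_set" by (simp add: vac_set_def)
  have "shift a ` vac_set = insert (a, - 1) vac_set"
  proof (rule set_eqI)
    fix n show "n \<in> shift a ` vac_set \<longleftrightarrow> n \<in> insert (a, - 1) vac_set"
      unfolding mem_shift_image by (cases n) (auto simp: vac_set_def unshift_def)
  qed
  then have "shift_wedge a vac_wedge = add_factor (a, - 1) vac_wedge"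
    by (intro wedge_eqI) simp
  then show ?thesis
    by (simp add: vac_def std_Q_wedge_vec psi_plus_def wedging_wedge_vec 1 2 3)
qed

definition twist_sign :: "3 \<Rightarrow> 3 \<times> int \<Rightarrow> complex" where
  "twist_sign a n = (if fst n = a then 1 else - 1)"

lemma wedging_std_Q:
  "wedging (shift a n) (std_Q a v) = scale (twist_sign a n) (std_Q a (wedging n v))"
proof (rule lin_eqI[where f = "\<lambda>v. wedging (shift a n) (std_Q a v)"])
  show "lin (\<lambda>v. wedging (shift a n) (std_Q a v))"
    by (rule lin_comp[OF lin_wedging lin_std_Q])
  show "lin (\<lambda>v. scale (twist_sign a n) (std_Q a (wedging n v)))"
    by (intro linI) (simp_all add: lin_add[OF lin_wedging] lin_add[OF lin_std_Q]
        lin_scale[OF lin_wedging] lin_scale[OF lin_std_Q] fock.scale_right_distrib mult.commute)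
  fix S
  show "wedging (shift a n) (std_Q a (wedge_vec S)) =
      scale (twist_sign a n) (std_Q a (wedging n (wedge_vec S)))"
  proof (cases "n \<in> factors S")
    case True
    then show ?thesis
      by (simp add: std_Q_wedge_vec lin_scale[OF lin_wedging] wedging_wedge_vec lin_zero[OF lin_std_Q])
  next
    case False
    let ?w = "wedge_vec (add_factor (shift a n) (shift_wedge a S))"
    have "wedging (shift a n) (std_Q a (wedge_vec S)) =
        scale (wedge_sign (shift_wedge a S) (shift a n) * shift_sign a S) ?w"
      using False
      by (simp add: std_Q_wedge_vec lin_scale[OF lin_wedging] wedging_wedge_vec mult.commute)
    also have "\<dots> = scale (twist_sign a n * (shift_sign a (add_factor n S) * wedge_sign S n)) ?w"
      unfolding shift_sign_add[OF False] twist_sign_def ..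
    also have "\<dots> = scale (twist_sign a n) (std_Q a (wedging n (wedge_vec S)))"
      using False
      by (simp add: std_Q_wedge_vec wedging_wedge_vec lin_scale[OF lin_std_Q] shift_wedge_add
          mult.commute)
    finally show ?thesis .
  qed
qed

lemma contraction_std_Q:
  "contraction (shift a n) (std_Q a v) = scale (twist_sign a n) (std_Q a (contraction n v))"
proof (rule lin_eqI[where f = "\<lambda>v. contraction (shift a n) (std_Q a v)"])
  show "lin (\<lambda>v. contraction (shift a n) (std_Q a v))"
    by (rule lin_comp[OF lin_contraction lin_std_Q])
  show "lin (\<lambda>v. scale (twist_sign a n) (std_Q a (contraction n v)))"
    by (intro linI) (simp_all add: lin_add[OF lin_contraction] lin_add[OF lin_std_Q]
        lin_scale[OF lin_contraction] lin_scale[OF lin_std_Q] fock.scale_right_distrib mult.commute)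
  fix S
  show "contraction (shift a n) (std_Q a (wedge_vec S)) =
      scale (twist_sign a n) (std_Q a (contraction n (wedge_vec S)))"
  proof (cases "n \<in> factors S")
    case False
    then show ?thesis
      by (simp add: std_Q_wedge_vec lin_scale[OF lin_contraction] contraction_wedge_vec
          lin_zero[OF lin_std_Q])
  next
    case True
    define S' where "S' = remove_factor n S"
    have S: "S = add_factor n S'" and S': "n \<notin> factors S'"
      using True by (simp_all add: S'_def add_remove)
    let ?A = "wedge_sign (shift_wedge a S') (shift a n)"
    let ?w = "wedge_vec (shift_wedge a S')"
    have "?A * shift_sign a S' = twist_sign a n * (shift_sign a S * wedge_sign S' n)"
      unfolding S twist_sign_def by (rule shift_sign_add[OF S'])
    then have eq: "?A * shift_sign a S = twist_sign a n * (shift_sign a S' * wedge_sign S' n)"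
      using shift_sign_square[of a S] shift_sign_square[of a S'] by algebra
    have "shift a n \<notin> factors (shift_wedge a S')" using S' by simp
    then have "contraction (shift a n) (std_Q a (wedge_vec S)) = scale (?A * shift_sign a S) ?w"
      by (simp add: S std_Q_wedge_vec lin_scale[OF lin_contraction] contraction_wedge_vec
          shift_wedge_add remove_add mult.commute)
    also have "\<dots> = scale (twist_sign a n * (shift_sign a S' * wedge_sign S' n)) ?w"
      unfolding eq ..
    also have "\<dots> = scale (twist_sign a n) (std_Q a (contraction n (wedge_vec S)))"
      using S' by (simp add: S std_Q_wedge_vec contraction_wedge_vec lin_scale[OF lin_std_Q]
          remove_add mult.commute)
    finally show ?thesis .
  qed
qed

lemma std_Q_wedging: "std_Q a (wedging n v) = scale (twist_sign a n) (wedging (shift a n) (std_Q a v))"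
  and std_Q_contraction:
    "std_Q a (contraction n v) = scale (twist_sign a n) (contraction (shift a n) (std_Q a v))"
  by (simp_all add: wedging_std_Q contraction_std_Q twist_sign_def)

lemma wedging_anticommute: "wedging m (wedging n v) = - wedging n (wedging m v)"
proof (cases "m = n")
  case True
  have "wedging n (wedging n v) = 0" 
    by (rule lin_eqI[OF lin_comp[OF lin_wedging lin_wedging]])
      (auto intro: linI simp: wedging_wedge_vec lin_scale[OF lin_wedging] lin_zero[OF lin_wedging])
  then show ?thesis using True by simp
next
  case False
  have sgn: "wedge_sign (add_factor n S) m = (if n \<prec> m then - 1 else 1) * wedge_sign S m"
    if "n \<notin> factors S" for n m S
  proof -
    have "{s \<in> factors (add_factor n S). s \<prec> m} =
        (if n \<prec> m then insert n {s \<in> factors S. s \<prec> m} else {s \<in> factors S. s \<prec> m})" by auto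
    then show ?thesis using that by (simp add: wedge_sign_def finite_below)
  qed
  have tot: "m \<prec> n \<longleftrightarrow> \<not> n \<prec> m"
    using False by (cases m; cases n) (auto simp: prec_def)
  have comm: "add_factor m (add_factor n S) = add_factor n (add_factor m S)" for S
    by (rule wedge_eqI) auto
  show ?thesis
    by (rule lin_eqI[OF lin_comp[OF lin_wedging lin_wedging]
          lin_uminus[OF lin_comp[OF lin_wedging lin_wedging]]])
      (use False tot in \<open>auto simp: wedging_wedge_vec lin_scale[OF lin_wedging]
        lin_zero[OF lin_wedging] sgn comm mult.commute\<close>)
qed

lemma std_Q_anticommute:
  assumes "a \<noteq> b"
  shows "std_Q a (std_Q b v) = - std_Q b (std_Q a v)"
proof (induction v rule: fock_generated)
  have shift_vac': "shift a (b, - 1) = (b, - 1)" "shift b (a, - 1) = (a, - 1)"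
    using assms by (auto simp: shift_def)
  have sg: "twist_sign a (b, - 1) = - 1" "twist_sign b (a, - 1) = - 1"
    using assms by (auto simp: twist_sign_def)
  case vac
  show ?case
    by (simp add: std_Q_vac psi_plus_def std_Q_wedging shift_vac' sg
        wedging_anticommute[of "(b, - 1)"] scale_minus_one)
next
  have com: "shift a (shift b n) = shift b (shift a n)"
    "twist_sign a (shift b n) = twist_sign a n" "twist_sign b (shift a n) = twist_sign b n" for n
    using assms by (auto simp: shift_def twist_sign_def)
  {
    case (wedging n v)
    then show ?case
      by (simp add: std_Q_wedging lin_scale[OF lin_std_Q] lin_scale[OF lin_wedging] com mult.commute
          lin_minus[OF lin_wedging])
  next
    case (contraction n v)
    then show ?case
      by (simp add: std_Q_contraction lin_scale[OF lin_std_Q] lin_scale[OF lin_contraction] com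
          mult.commute lin_minus[OF lin_contraction])
  }
qed (simp_all add: lin_add[OF lin_std_Q] lin_scale[OF lin_std_Q])

lemma is_translation_ops_std_Q: "is_translation_ops std_Q"
  unfolding is_translation_ops_def
proof (intro conjI allI impI ext)
  fix a b :: 3 and n :: int and v
  show "lin (std_Q a)" by (rule lin_std_Q)
  show "bij (std_Q a)" by (rule bij_std_Q)
  show "std_Q a vac = psi_plus a (- 1) vac" by (rule std_Q_vac)
  show "(psi_plus_field a n \<circ> std_Q a) v = (std_Q a \<circ> psi_plus_field a (n - 1)) v"
    using wedging_std_Q[of a "(a, - n)" v]
    by (simp add: psi_plus_field_def psi_plus_def shift_def twist_sign_def)
  show "(psi_minus_field a n \<circ> std_Q a) v = (std_Q a \<circ> psi_minus_field a (n + 1)) v"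
    using contraction_std_Q[of a "(a, 1 + n)" v]
    by (simp add: psi_minus_field_def psi_minus_def shift_def twist_sign_def add.commute)
  assume ab: "a \<noteq> b"
  show "(psi_plus_field a n \<circ> std_Q b) v = - std_Q b (psi_plus_field a n v)"
    using wedging_std_Q[of b "(a, - n - 1)" v] ab
    by (simp add: psi_plus_field_def psi_plus_def shift_def twist_sign_def)
  show "(psi_minus_field a n \<circ> std_Q b) v = - std_Q b (psi_minus_field a n v)"
    using contraction_std_Q[of b "(a, n)" v] ab
    by (simp add: psi_minus_field_def psi_minus_def shift_def twist_sign_def add.commute)
  show "(std_Q a \<circ> std_Q b) v = - std_Q b (std_Q a v)"
    using std_Q_anticommute[OF ab] by simp
qed

lemma translation_ops_wedging:
  assumes "is_translation_ops Q"
  shows "Q a (wedging n v) = scale (twist_sign a n) (wedging (shift a n) (Q a v))"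
    and "Q a (contraction n v) = scale (twist_sign a n) (contraction (shift a n) (Q a v))"
proof -
  obtain b k where n: "n = (b, k)" by fastforce
  have *: "psi_plus_field a j \<circ> Q a = Q a \<circ> psi_plus_field a (j - 1)"
    "psi_minus_field a j \<circ> Q a = Q a \<circ> psi_minus_field a (j + 1)"
    "b \<noteq> a \<Longrightarrow> psi_plus_field b j \<circ> Q a = (\<lambda>v. - Q a (psi_plus_field b j v))"
    "b \<noteq> a \<Longrightarrow> psi_minus_field b j \<circ> Q a = (\<lambda>v. - Q a (psi_minus_field b j v))" for j
    using assms unfolding is_translation_ops_def by blast+
  show "Q a (wedging n v) = scale (twist_sign a n) (wedging (shift a n) (Q a v))"
    using fun_cong[OF *(1)[of "- k"], of v] fun_cong[OF *(3)[of "- k - 1"], of v]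
    by (cases "b = a")
      (simp_all add: n psi_plus_field_def psi_plus_def shift_def twist_sign_def)
  show "Q a (contraction n v) = scale (twist_sign a n) (contraction (shift a n) (Q a v))"
    using fun_cong[OF *(2)[of "k - 1"], of v] fun_cong[OF *(4)[of k], of v]
    by (cases "b = a")
      (simp_all add: n psi_minus_field_def psi_minus_def shift_def twist_sign_def)
qed

lemma translation_ops_unique:
  assumes "is_translation_ops Q"
  shows "Q = std_Q"
proof (intro ext)
  fix a v
  have lin: "lin (Q a)" and vac: "Q a vac = psi_plus a (- 1) vac"
    using assms by (auto simp: is_translation_ops_def)
  show "Q a v = std_Q a v"
    by (induction v rule: fock_generated)
      (simp_all add: lin_add[OF lin] lin_scale[OF lin] lin_add[OF lin_std_Q] lin_scale[OF lin_std_Q]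
        vac std_Q_vac translation_ops_wedging[OF assms] std_Q_wedging std_Q_contraction)
qed

theorem ex1_translation_ops: "\<exists>!Q. is_translation_ops Q"
  using is_translation_ops_std_Q translation_ops_unique by blast

lemma Q_op_eq: "Q_op = std_Q"
  unfolding Q_op_def using is_translation_ops_std_Q translation_ops_unique by blast

end

theory Submission
  imports Defs "HOL-Library.Multiset" "HOL-Combinatorics.Transposition"
begin

text \<open>
  The exponentials contribute \<open>1 / (n\<^sub>c! n\<^sub>d! n\<^sub>e!)\<close> and one residue for each bilinear field, so that
  the coefficients of the tau-function are made of those of the correlators
  \<open>\<langle>T\<^sub>1\<^sup>k T\<^sub>2\<^sup>l v\<^sub>0, \<Prod> E\<^sub>1\<^sub>0(x\<^sub>i) \<Prod> E\<^sub>2\<^sub>0(y\<^sub>i) \<Prod> E\<^sub>2\<^sub>1(z\<^sub>i) v\<^sub>0\<rangle>\<close> (\<open>g_op_expansion\<close>, \<open>foldr_op_of\<close>). The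
  theorem says that such a correlator vanishes unless \<open>n\<^sub>c + n\<^sub>d = k\<close> and \<open>n\<^sub>d + n\<^sub>e = l\<close>, which is
  conservation of charge (\<open>E_word_other_charge\<close>), and that otherwise it is the rational function \<open>p\<close>
  up to the stated sign (\<open>E_word_correlator\<close>).

  Split every \<open>E\<^sub>a\<^sub>b\<close> into \<open>\<psi>\<^sub>a\<^sup>+ \<psi>\<^sub>b\<^sup>-\<close> and collect the operators of each component. Then the correlator is
  the product of three one-component correlators: \<open>\<psi>\<^sup>+\<close> at the \<open>y\<close> and \<open>z\<close> for component 2, \<open>\<psi>\<^sup>+\<close> at the
  \<open>x\<close> and \<open>\<psi>\<^sup>-\<close> at the \<open>z\<close> for component 1, and \<open>\<psi>\<^sup>-\<close> at the \<open>x\<close> and \<open>y\<close> for component 0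
  (\<open>three_component_correlator\<close>). A one-component correlator of \<open>\<psi>\<^sup>+(u\<^sub>1) \<dots> \<psi>\<^sup>+(u\<^sub>n) \<psi>\<^sup>-(v\<^sub>1) \<dots> \<psi>\<^sup>-(v\<^sub>m)\<close> is a
  constant times \<open>\<Prod> (u\<^sub>i - u\<^sub>j) \<Prod> (v\<^sub>i - v\<^sub>j) / \<Prod> (u\<^sub>i - v\<^sub>j)\<close>, and the product of the three is \<open>p\<close>.

  The one-component formula (\<open>one_component_correlator\<close>) holds because the factor \<open>u - v\<close> kills the
  anticommutator \<open>\<delta>(u - v)\<close>. After multiplication by \<open>\<Prod> (u\<^sub>i - v\<^sub>j)\<close> the operators \<open>\<psi>\<^sup>+\<close> may stand on
  either side of the operators \<open>\<psi>\<^sup>-\<close>; the two orders bound all exponents from above and from below,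
  by \<open>0, \<dots>, n - 1\<close> for the \<open>u\<^sub>i\<close> and \<open>0, \<dots>, m - 1\<close> for the \<open>v\<^sub>j\<close>. An alternating series with these
  exponents is a multiple of the Vandermonde products (\<open>alternating_zero\<close>). The division by
  \<open>\<Prod> (u\<^sub>i - v\<^sub>j)\<close> takes place in a commutative ring of Laurent series, the type \<open>tame_series\<close>, in which
  \<open>1 / (x - z)\<close> has the prescribed expansion.

  What remains are signs. The constants of the three components multiply to the matrix element of
  the vector obtained from \<open>v\<^sub>0\<close> by the modes with the extremal exponents. These act as the translation
  operators (\<open>extremal_vector\<close>), so that this vector is \<open>T\<^sub>1\<^sup>k T\<^sub>2\<^sup>l v\<^sub>0\<close> up to a sign (\<open>translated_vacuum\<close>). This
  sign and the one from collecting the components give \<open>(-1)\<close> to the power \<open>n\<^sub>d (n\<^sub>d + 1) / 2\<close> (\<open>sign_eq\<close>).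
\<close>


abbreviation lookup where "lookup \<equiv> Poly_Mapping.lookup"
abbreviation keys where "keys \<equiv> Poly_Mapping.keys"
abbreviation single where "single \<equiv> Poly_Mapping.single"

section \<open>Difference operators and alternating series\<close>

text \<open>
  Multiplication by \<open>u - v\<close>, for arbitrary functions of the exponent vector: the same correlator with
  its operators in another order is expanded in another direction, outside the ring in which the
  division takes place.
\<close>

definition diff_mult :: "res_var \<Rightarrow> res_var \<Rightarrow> (res_mono \<Rightarrow> 'b :: ab_group_add) \<Rightarrow> res_mono \<Rightarrow> 'b" where
  "diff_mult u v f e = f (e - single u 1) - f (e - single v 1)"

definition diff_mults ::
    "(res_var \<times> res_var) list \<Rightarrow> (res_mono \<Rightarrow> 'b :: ab_group_add) \<Rightarrow> res_mono \<Rightarrow> 'b" where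
  "diff_mults ps f = foldr (\<lambda>(u, v). diff_mult u v) ps f"

lemma diff_mults_simps [simp]:
  "diff_mults [] f = f"
  "diff_mults ((u, v) # ps) f = diff_mult u v (diff_mults ps f)"
  "diff_mults (ps @ qs) f = diff_mults ps (diff_mults qs f)"
  by (simp_all add: diff_mults_def)

lemma diff_mult_commute: "diff_mult u v (diff_mult u' v' f) = diff_mult u' v' (diff_mult u v f)"
  by (rule ext) (simp add: diff_mult_def algebra_simps)

lemma diff_mults_commute1: "diff_mults ps (diff_mult u v f) = diff_mult u v (diff_mults ps f)"
  by (induction ps) (auto simp: diff_mult_commute)

lemma diff_mults_commute: "diff_mults ps (diff_mults qs f) = diff_mults qs (diff_mults ps f)"
  by (induction ps) (auto simp: diff_mults_commute1)

lemma diff_mults_mset: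
  assumes "mset ps = mset qs"
  shows "diff_mults ps f = diff_mults qs f"
  using assms
proof (induction ps arbitrary: qs)
  case (Cons p ps)
  have "p \<in> set qs" using Cons.prems by (metis list.set_intros(1) mset_eq_setD)
  then obtain as bs where qs: "qs = as @ p # bs" by (meson split_list)
  have "mset ps = mset (as @ bs)" using Cons.prems by (simp add: qs)
  from Cons.IH[OF this] show ?case
    by (cases p) (simp add: qs diff_mults_commute1)
qed simp

lemma diff_mults_hom:
  assumes "h 0 = 0" "\<And>x y. h (x - y) = h x - h y"
  shows "diff_mults ps (\<lambda>e. h (f e)) = (\<lambda>e. h (diff_mults ps f e))"
  by (induction ps) (auto simp: diff_mult_def assms)

lemma diff_mults_minus: "diff_mults ps (\<lambda>e. - f e) = (\<lambda>e. - diff_mults ps f e)"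
  by (rule diff_mults_hom) simp_all

text \<open>
  A product of modes is a function of all exponent vectors, and it ignores the variables at which no
  mode is taken. This restricts a comparison to exponents in the variables in use.
\<close>

lemma diff_mults_cong_keys:
  assumes "\<And>e. keys e \<subseteq> V \<Longrightarrow> f e = g e" "\<And>u v. (u, v) \<in> set ps \<Longrightarrow> u \<in> V \<and> v \<in> V" "keys e \<subseteq> V"
  shows "diff_mults ps f e = diff_mults ps g e"
  using assms(2,3)
proof (induction ps arbitrary: e)
  case (Cons p ps)
  obtain u v where p: "p = (u, v)" by fastforce
  have "keys (e - single w 1) \<subseteq> V" if "w \<in> V" for w
    using keys_diff[of e "single w 1"] Cons.prems(2) that by (auto split: if_splits)
  then show ?case using Cons.prems(1) by (auto simp: p diff_mult_def intro!: Cons.IH arg_cong2[where f = minus])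
qed (simp add: assms)

lemma diff_mults_shift:
  "diff_mults ps f (t + r) = diff_mults ps (\<lambda>r. f (t + r)) r"
proof (induction ps arbitrary: r)
  case (Cons p ps)
  show ?case
  proof (cases p)
    case (Pair u v)
    have "t + r - s = t + (r - s)" for s :: res_mono by simp
    then show ?thesis by (simp only: Pair diff_mults_simps diff_mult_def Cons.IH)
  qed
qed simp

abbreviation "cross_mults us vs \<equiv> diff_mults (List.product us vs)"

subsection \<open>Degree bounds\<close>

definition occurrences :: "res_var \<Rightarrow> (res_var \<times> res_var) list \<Rightarrow> nat" where
  "occurrences w ps = length (filter (\<lambda>(u, v). u = w \<or> v = w) ps)"

lemma occurrences_simps [simp]:
  "occurrences w [] = 0"
  "occurrences w (p # ps) = (if fst p = w \<or> snd p = w then 1 else 0) + occurrences w ps"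
  "occurrences w (ps @ qs) = occurrences w ps + occurrences w qs"
  by (auto simp: occurrences_def)

lemma diff_mults_upper:
  assumes "\<And>e. f e \<noteq> 0 \<Longrightarrow> lookup e w \<le> d" "diff_mults ps f e \<noteq> 0"
  shows "lookup e w \<le> d + int (occurrences w ps)"
  using assms(2)
proof (induction ps arbitrary: e)
  case (Cons p ps)
  obtain u v where p: "p = (u, v)" by fastforce
  from Cons.prems have "diff_mults ps f (e - single u 1) \<noteq> 0 \<or> diff_mults ps f (e - single v 1) \<noteq> 0"
    by (auto simp: p diff_mult_def)
  then show ?case
    by (elim disjE; drule_tac Cons.IH)
      (auto simp: p lookup_minus lookup_single when_def split: if_splits)
qed (use assms in simp)

lemma diff_mults_lower:
  assumes "\<And>e. f e \<noteq> 0 \<Longrightarrow> d \<le> lookup e w" "diff_mults ps f e \<noteq> 0"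
  shows "d \<le> lookup e w"
  using assms(2)
proof (induction ps arbitrary: e)
  case (Cons p ps)
  obtain u v where p: "p = (u, v)" by fastforce
  from Cons.prems have "diff_mults ps f (e - single u 1) \<noteq> 0 \<or> diff_mults ps f (e - single v 1) \<noteq> 0"
    by (auto simp: p diff_mult_def)
  then show ?case
    by (elim disjE; drule_tac Cons.IH)
      (auto simp: p lookup_minus lookup_single when_def split: if_splits)
qed (use assms in simp)

lemma diff_mults_keys:
  assumes "\<And>e. f e \<noteq> 0 \<Longrightarrow> keys e \<subseteq> V" "\<And>u v. (u, v) \<in> set ps \<Longrightarrow> u \<in> V \<and> v \<in> V"
    and "diff_mults ps f e \<noteq> 0"
  shows "keys e \<subseteq> V"
  using assms(2,3)
proof (induction ps arbitrary: e)
  case (Cons p ps)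
  obtain u v where p: "p = (u, v)" by fastforce
  have "u \<in> V" "v \<in> V" using Cons.prems(1) by (auto simp: p)
  moreover have "diff_mults ps f (e - single u 1) \<noteq> 0 \<or> diff_mults ps f (e - single v 1) \<noteq> 0"
    using Cons.prems(2) by (auto simp: p diff_mult_def)
  ultimately obtain w where w: "w \<in> V" "diff_mults ps f (e - single w 1) \<noteq> 0" by blast
  then have "keys (e - single w 1) \<subseteq> V" using Cons by (meson list.set_intros(2))
  moreover have "keys e \<subseteq> keys (e - single w 1) \<union> keys (single w (1::int))"
    using keys_add[of "e - single w 1" "single w 1"] by simp
  ultimately show ?case using w by auto
qed (use assms in simp)

text \<open>
  The highest power of \<open>u\<close> arises only by choosing \<open>u\<close> in each factor. Leading coefficients are
  computed by splitting off one variable after the other in this way.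
\<close>

lemma diff_mults_top:
  assumes "\<And>e. f e \<noteq> 0 \<Longrightarrow> lookup e u \<le> d" "u \<notin> set vs"
  shows "lookup e u = d + int (length vs) \<Longrightarrow>
    diff_mults (map (Pair u) vs) f e = f (e - single u (int (length vs)))"
  using assms(2)
proof (induction vs arbitrary: e)
  case (Cons v vs)
  have "occurrences u (map (Pair u) vs) = length vs" by (induction vs) auto
  then have "diff_mults (map (Pair u) vs) f (e - single v 1) = 0"
    using diff_mults_upper[where f = f and w = u and d = d and e = "e - single v 1" and ps = "map (Pair u) vs", OF assms(1)] Cons.prems
    by (fastforce simp: lookup_minus lookup_single)
  moreover have "diff_mults (map (Pair u) vs) f (e - single u 1) = f (e - single u 1 - single u (int (length vs)))"
    using Cons.prems by (intro Cons.IH) (auto simp: lookup_minus lookup_single)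
  moreover have "e - single u 1 - single u (int (length vs)) = e - single u (int (length (v # vs)))"
    by (rule poly_mapping_eqI) (auto simp: lookup_minus lookup_single when_def)
  ultimately show ?case by (simp add: diff_mult_def)
qed simp


subsection \<open>Alternating series are determined by one coefficient\<close>

definition swap_mono :: "res_var \<Rightarrow> res_var \<Rightarrow> res_mono \<Rightarrow> res_mono" where
  "swap_mono u v e = Poly_Mapping.map_key (transpose u v) e"

lemma lookup_swap_mono [simp]: "lookup (swap_mono u v e) w = lookup e (transpose u v w)"
  by (simp add: swap_mono_def map_key.rep_eq)

lemma keys_swap_mono: "keys (swap_mono u v e) = transpose u v ` keys e"
proof (rule set_eqI)
  fix w
  have "w \<in> keys (swap_mono u v e) \<longleftrightarrow> transpose u v w \<in> keys e"
    by (simp add: in_keys_iff)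
  also have "\<dots> \<longleftrightarrow> w \<in> transpose u v ` keys e"
    by (metis image_iff transpose_involutory)
  finally show "w \<in> keys (swap_mono u v e) \<longleftrightarrow> w \<in> transpose u v ` keys e" .
qed

lemma diff_mults_swap:
  "diff_mults ps f (swap_mono a b e) =
    diff_mults (map (map_prod (transpose a b) (transpose a b)) ps) (\<lambda>e. f (swap_mono a b e)) e"
proof (induction ps arbitrary: e)
  case (Cons p ps)
  obtain u v where p: "p = (u, v)" by fastforce
  have "swap_mono a b e - single w 1 = swap_mono a b (e - single (transpose a b w) 1)" for w
    by (rule poly_mapping_eqI)
      (auto simp: lookup_minus lookup_single when_def transpose_eq_iff)
  then show ?case by (simp only: p diff_mults_simps diff_mult_def Cons.IH list.map map_prod_simp)
qed simp

lemma map_transpose_id: "u \<notin> set as \<Longrightarrow> v \<notin> set as \<Longrightarrow> map (transpose u v) as = as"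
  by (induction as) (auto simp: transpose_def)

text \<open>
  A transposition is a product of an odd number of neighbouring exchanges. For Vandermonde products
  and for products of fermionic operators the effect of the latter can be read off directly.
\<close>

lemma alternating_transpose:
  fixes \<phi> :: "'a list \<Rightarrow> complex"
  assumes adj: "\<And>as u v bs. set (as @ u # v # bs) = S \<Longrightarrow> distinct (as @ u # v # bs) \<Longrightarrow>
      \<phi> (as @ v # u # bs) = - \<phi> (as @ u # v # bs)"
    and "distinct us" "set us = S" "u \<in> S" "v \<in> S" "u \<noteq> v"
  shows "\<phi> (map (transpose u v) us) = - \<phi> us"
proof -
  have ex: "\<phi> (as @ v # bs @ u # cs) = - \<phi> (as @ u # bs @ v # cs)"
    if "distinct (as @ u # bs @ v # cs)" "set (as @ u # bs @ v # cs) = S" for as bs cs u v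
    using that
  proof (induction bs arbitrary: as)
    case Nil
    then show ?case using adj[of as u v cs] by simp
  next
    case (Cons b bs)
    have "\<phi> (as @ v # (b # bs) @ u # cs) = - \<phi> ((as @ [b]) @ v # bs @ u # cs)"
      using adj[of as b v "bs @ u # cs"] Cons.prems by auto
    also have "\<dots> = \<phi> ((as @ [b]) @ u # bs @ v # cs)"
      by (subst Cons.IH) (use Cons.prems in auto)
    also have "\<dots> = - \<phi> (as @ u # (b # bs) @ v # cs)"
      using adj[of as u b "bs @ v # cs"] Cons.prems by auto
    finally show ?case .
  qed
  have split: "(\<exists>as bs cs. us = as @ u # bs @ v # cs) \<or> (\<exists>as bs cs. us = as @ v # bs @ u # cs)"
  proof -
    obtain as ds where 1: "us = as @ u # ds" using assms by (metis split_list)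
    then have "v \<in> set as \<or> v \<in> set ds" using assms by auto
    then show ?thesis using 1 by (metis append.assoc append_Cons split_list)
  qed
  have *: "\<phi> (map (transpose u v) us) = - \<phi> us" if "us = as @ u # bs @ v # cs" for as bs cs u v
    using ex[of as u bs v cs] assms(2,3) that by (simp add: map_transpose_id)
  from split show ?thesis
    using *[of _ u _ v] *[of _ v _ u] by (auto simp: transpose_commute)
qed

text \<open>The leading exponents \<open>n - 1, \<dots>, 0\<close> of a Vandermonde product.\<close>

primrec top_mono :: "res_var list \<Rightarrow> res_mono" where
  "top_mono [] = 0"
| "top_mono (u # us) = single u (int (length us)) + top_mono us"

lemma lookup_top_mono_notin: "w \<notin> set us \<Longrightarrow> lookup (top_mono us) w = 0"
  by (induction us) (auto simp: lookup_add lookup_single)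

lemma keys_top_mono: "keys (top_mono us) \<subseteq> set us"
  using lookup_top_mono_notin by (auto simp: in_keys_iff)

lemma bij_top_mono: "distinct us \<Longrightarrow> bij_betw (lookup (top_mono us)) (set us) {0..<int (length us)}"
proof (induction us)
  case (Cons u us)
  have u: "lookup (top_mono (u # us)) u = int (length us)"
    using Cons.prems by (simp add: lookup_add lookup_top_mono_notin)
  have "bij_betw (lookup (top_mono (u # us))) (set us) {0..<int (length us)}"
    using Cons by (subst bij_betw_cong[of _ _ "lookup (top_mono us)"])
      (auto simp: lookup_add lookup_single when_def)
  moreover have "bij_betw (lookup (top_mono (u # us))) {u} {int (length us)}"
    using u by (simp add: bij_betw_def)
  ultimately have "bij_betw (lookup (top_mono (u # us))) (set us \<union> {u})
      ({0..<int (length us)} \<union> {int (length us)})"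
    by (rule bij_betw_combine) auto
  moreover have "{0..<int (length us)} \<union> {int (length us)} = {0..<int (length (u # us))}" by auto
  ultimately show ?case by simp
qed (simp add: bij_betw_def)

definition alternating_in :: "res_var list \<Rightarrow> (res_mono \<Rightarrow> complex) \<Rightarrow> bool" where
  "alternating_in us f \<longleftrightarrow>
     (\<forall>u\<in>set us. \<forall>v\<in>set us. u \<noteq> v \<longrightarrow> (\<forall>e. f (swap_mono u v e) = - f e)) \<and>
     (\<forall>e. f e \<noteq> 0 \<longrightarrow> (\<forall>u\<in>set us. 0 \<le> lookup e u \<and> lookup e u < int (length us)))"

lemma alternating_bij:
  assumes "alternating_in us f" "f e \<noteq> 0" "distinct us"
  shows "bij_betw (lookup e) (set us) {0..<int (length us)}"
proof -
  have inj: "inj_on (lookup e) (set us)"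
  proof (rule inj_onI, rule ccontr)
    fix u v assume *: "u \<in> set us" "v \<in> set us" "lookup e u = lookup e v" "u \<noteq> v"
    have "swap_mono u v e = e"
      using *(3) by (intro poly_mapping_eqI) (auto simp: transpose_def)
    then have "f e = - f e" using * assms(1) by (metis alternating_in_def)
    then show False using assms(2) by simp
  qed
  have sub: "lookup e ` set us \<subseteq> {0..<int (length us)}"
    using assms by (auto simp: alternating_in_def)
  have "card (lookup e ` set us) = card {0..<int (length us)}"
    using inj assms(3) by (simp add: card_image distinct_card)
  then have "lookup e ` set us = {0..<int (length us)}"
    using sub by (simp add: card_subset_eq)
  then show ?thesis using inj by (simp add: bij_betw_def)
qed

text \<open>
  The exponents of a nonzero coefficient are permutations of \<open>0, \<dots>, n - 1\<close>; transpositions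
  bring them to the given order one variable at a time.
\<close>

lemma alternating_zero:
  assumes f: "alternating_in us f" "alternating_in vs f" and d: "distinct (us @ vs)"
    and top: "f (top_mono us + top_mono vs) = 0" and "keys e \<subseteq> set us \<union> set vs"
  shows "f e = 0"
proof (rule ccontr)
  let ?t = "top_mono us + top_mono vs"
  have t: "lookup ?t u = lookup (top_mono us) u" if "u \<in> set us" for u
  proof -
    have "u \<notin> set vs" using that d by auto
    then show ?thesis by (simp add: lookup_add lookup_top_mono_notin)
  qed
  have t': "lookup ?t u = lookup (top_mono vs) u" if "u \<in> set vs" for u
  proof -
    have "u \<notin> set us" using that d by auto
    then show ?thesis by (simp add: lookup_add lookup_top_mono_notin)
  qed
  have bt: "bij_betw (lookup ?t) (set us) {0..<int (length us)}"
  proof -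
    have "distinct us" using d by simp
    then have "bij_betw (lookup (top_mono us)) (set us) {0..<int (length us)}" by (rule bij_top_mono)
    moreover have "bij_betw (lookup ?t) (set us) {0..<int (length us)} =
        bij_betw (lookup (top_mono us)) (set us) {0..<int (length us)}"
      by (rule bij_betw_cong) (rule t)
    ultimately show ?thesis by simp
  qed
  have bt': "bij_betw (lookup ?t) (set vs) {0..<int (length vs)}"
  proof -
    have "distinct vs" using d by simp
    then have "bij_betw (lookup (top_mono vs)) (set vs) {0..<int (length vs)}" by (rule bij_top_mono)
    moreover have "bij_betw (lookup ?t) (set vs) {0..<int (length vs)} =
        bij_betw (lookup (top_mono vs)) (set vs) {0..<int (length vs)}"
      by (rule bij_betw_cong) (rule t')
    ultimately show ?thesis by simp
  qed
  assume "f e \<noteq> 0"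
  then show False using assms(5)
  proof (induction "card {w \<in> set us \<union> set vs. lookup e w \<noteq> lookup ?t w}" arbitrary: e
      rule: less_induct)
    case less
    let ?W = "\<lambda>e. {w \<in> set us \<union> set vs. lookup e w \<noteq> lookup ?t w}"
    show ?case
    proof (cases "?W e = {}")
      case True
      have "e = ?t"
      proof (rule poly_mapping_eqI)
        fix w
        show "lookup e w = lookup ?t w"
        proof (cases "w \<in> set us \<union> set vs")
          case False
          then have "lookup e w = 0" using less.prems(2) by (auto simp: in_keys_iff)
          then show ?thesis using False by (simp add: lookup_add lookup_top_mono_notin)
        qed (use True in blast)
      qed
      then show False using less.prems top by simp
    next
      case False
      then obtain w where w: "w \<in> ?W e" by blast
      have "\<exists>ws. w \<in> set ws \<and> set ws \<subseteq> set us \<union> set vs \<and> alternating_in ws f \<and> distinct ws \<and>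
          bij_betw (lookup ?t) (set ws) {0..<int (length ws)}"
      proof (cases "w \<in> set us")
        case True
        then show ?thesis using f(1) bt d by (intro exI[of _ us] conjI) auto
      next
        case False
        then show ?thesis using w f(2) bt' d by (intro exI[of _ vs] conjI) auto
      qed
      then obtain ws where ws: "w \<in> set ws" "set ws \<subseteq> set us \<union> set vs" "alternating_in ws f"
          "distinct ws" "bij_betw (lookup ?t) (set ws) {0..<int (length ws)}" by blast
      have be: "bij_betw (lookup e) (set ws) {0..<int (length ws)}"
        by (rule alternating_bij[OF ws(3) less.prems(1) ws(4)])
      have "lookup ?t w \<in> lookup e ` set ws"
        using be ws(1,5) by (metis bij_betw_def image_eqI)
      then obtain w' where w': "w' \<in> set ws" "lookup e w' = lookup ?t w" by auto
      have ne: "w \<noteq> w'" using w w' by auto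
      have w'W: "w' \<in> ?W e"
      proof -
        have "lookup ?t w' \<noteq> lookup ?t w"
          using ws(1,5) w'(1) ne by (metis bij_betw_def inj_onD)
        then show ?thesis using w' ws(2) by auto
      qed
      \<comment> \<open>this transposition corrects the exponent of \<open>w\<close>; that of \<open>w'\<close> was wrong before\<close>
      let ?e = "swap_mono w w' e"
      have sub: "?W ?e \<subseteq> ?W e - {w}"
      proof
        fix x assume x: "x \<in> ?W ?e"
        show "x \<in> ?W e - {w}"
          using x w' w'W by (cases "x = w"; cases "x = w'") (auto simp: transpose_def)
      qed
      have "card (?W ?e) < card (?W e)"
        using w by (intro psubset_card_mono) (use sub in \<open>auto\<close>)
      moreover have "f ?e \<noteq> 0" using ws(1,3) w'(1) ne less.prems(1) by (auto simp: alternating_in_def)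
      moreover have "keys ?e \<subseteq> set us \<union> set vs"
        using less.prems(2) ws(1,2) w'(1) unfolding keys_swap_mono by (auto simp: transpose_def)
      ultimately show False using less.hyps by blast
    qed
  qed
qed


subsection \<open>Vandermonde products\<close>

primrec pairs :: "'a list \<Rightarrow> ('a \<times> 'a) list" where
  "pairs [] = []"
| "pairs (u # us) = map (Pair u) us @ pairs us"

lemma pairs_map: "pairs (map f us) = map (map_prod f f) (pairs us)"
  by (induction us) auto

lemma product_append_left: "List.product (as @ bs) cs = List.product as cs @ List.product bs cs"
  by (induction as) auto

lemma product_append_right:
  "mset (List.product as (bs @ cs)) = mset (List.product as bs) + mset (List.product as cs)"
  by (induction as) auto

lemma product_map: "List.product (map f as) (map f bs) = map (map_prod f f) (List.product as bs)"
  by (induction as) auto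

lemma pairs_append: "mset (pairs (as @ bs)) = mset (pairs as) + mset (List.product as bs) + mset (pairs bs)"
  by (induction as) auto

lemma set_pairs: "set (pairs us) \<subseteq> set us \<times> set us"
  by (induction us) auto

lemma occurrences_notin: "w \<notin> fst ` set ps \<Longrightarrow> w \<notin> snd ` set ps \<Longrightarrow> occurrences w ps = 0"
  by (induction ps) auto

lemma occurrences_map_Pair: "distinct us \<Longrightarrow> w \<noteq> u \<Longrightarrow>
    occurrences w (map (Pair u) us) = (if w \<in> set us then 1 else 0)"
  by (induction us) auto

lemma occurrences_map_Pair_same: "occurrences u (map (Pair u) us) = length us"
  by (induction us) auto

lemma occurrences_pairs:
  assumes "distinct us" "w \<in> set us"
  shows "occurrences w (pairs us) = length us - 1"
  using assms
proof (induction us)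
  case (Cons u us)
  show ?case
  proof (cases "w = u")
    case True
    have "u \<notin> fst ` set (pairs us)" "u \<notin> snd ` set (pairs us)"
      using set_pairs[of us] Cons.prems(1) by auto
    then show ?thesis using True by (simp add: occurrences_map_Pair_same occurrences_notin)
  next
    case False
    then show ?thesis using Cons by (cases us) (auto simp: occurrences_map_Pair)
  qed
qed simp

lemma occurrences_product_left:
  assumes "distinct us" "w \<in> set us" "w \<notin> set vs"
  shows "occurrences w (List.product us vs) = length vs"
  using assms
proof (induction us)
  case (Cons u us)
  show ?case
  proof (cases "w = u")
    case True
    have "occurrences w (List.product us vs) = 0"
      using Cons.prems True by (intro occurrences_notin) auto
    then show ?thesis using True by (simp add: occurrences_map_Pair_same)
  next
    case False
    have "occurrences w (map (Pair u) vs) = 0"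
      using Cons.prems False by (intro occurrences_notin) auto
    then show ?thesis using Cons False by simp
  qed
qed simp

lemma occurrences_product_right:
  assumes "distinct vs" "w \<in> set vs" "w \<notin> set us"
  shows "occurrences w (List.product us vs) = length us"
  using assms by (induction us) (auto simp: occurrences_map_Pair)

definition one_series :: "res_mono \<Rightarrow> complex" where
  "one_series e = (if e = 0 then 1 else 0)"

lemma one_series_nonzero: "one_series e \<noteq> 0 \<Longrightarrow> lookup e u = 0"
  by (simp add: one_series_def split: if_splits)

definition vandermonde :: "res_var list \<Rightarrow> res_var list \<Rightarrow> res_mono \<Rightarrow> complex" where
  "vandermonde us vs = diff_mults (pairs us @ pairs vs) one_series"

lemma vandermonde_commute: "vandermonde us vs = vandermonde vs us"
  by (simp add: vandermonde_def diff_mults_commute)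

text \<open>Only the factor \<open>u - v\<close> changes its sign.\<close>

lemma diff_mults_pairs_exchange:
  "diff_mults (pairs (as @ v # u # bs) @ qs) f e = - diff_mults (pairs (as @ u # v # bs) @ qs) f e"
proof -
  define R where "R = (\<lambda>u v. pairs as @ List.product as [u] @ List.product as [v] @
    List.product as bs @ map (Pair u) bs @ map (Pair v) bs @ pairs bs @ qs)"
  have "mset (List.product as (u # v # bs)) =
      mset (List.product as [u]) + mset (List.product as [v]) + mset (List.product as bs)" for u v
    using product_append_right[of as "[u]" "v # bs"] product_append_right[of as "[v]" bs] by simp
  then have m: "mset (pairs (as @ u # v # bs) @ qs) = mset ((u, v) # R u v)" for u v
    by (simp add: pairs_append R_def)
  have "diff_mults (R u v) f = diff_mults (R v u) f"
    by (rule diff_mults_mset) (simp add: R_def)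
  then show ?thesis
    unfolding diff_mults_mset[OF m] by (simp add: diff_mult_def)
qed

lemma alternating_vandermonde:
  assumes "distinct (us @ vs)"
  shows "alternating_in us (vandermonde us vs)"
  unfolding alternating_in_def
proof (intro conjI ballI impI allI)
  fix u v e assume uv: "u \<in> set us" "v \<in> set us" "u \<noteq> v"
  have "(\<lambda>e. one_series (swap_mono u v e)) = one_series"
  proof
    fix e
    have "swap_mono u v e = 0 \<longleftrightarrow> e = 0"
      by (metis image_is_empty keys_eq_empty keys_swap_mono)
    then show "one_series (swap_mono u v e) = one_series e" by (simp add: one_series_def)
  qed
  then have "vandermonde us vs (swap_mono u v e) = diff_mults (pairs (map (transpose u v) us) @
      pairs (map (transpose u v) vs)) one_series e"
    by (simp add: vandermonde_def diff_mults_swap pairs_map del: diff_mults_simps)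
  also have "map (transpose u v) vs = vs"
    using uv assms by (intro map_transpose_id) auto
  also have "diff_mults (pairs (map (transpose u v) us) @ pairs vs) one_series e =
      - diff_mults (pairs us @ pairs vs) one_series e"
    by (rule alternating_transpose[where S = "set us" and
          \<phi> = "\<lambda>us. diff_mults (pairs us @ pairs vs) one_series e"])
      (rule diff_mults_pairs_exchange, use uv assms in auto)
  finally show "vandermonde us vs (swap_mono u v e) = - vandermonde us vs e"
    unfolding vandermonde_def .
next
  fix e u assume e: "vandermonde us vs e \<noteq> 0" and u: "u \<in> set us"
  have "u \<notin> set vs" using u assms by auto
  then have "u \<notin> fst ` set (pairs vs)" "u \<notin> snd ` set (pairs vs)"
    using set_pairs[of vs] by auto
  then have "occurrences u (pairs us @ pairs vs) = length us - 1"
    using u assms by (simp add: occurrences_notin occurrences_pairs)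
  moreover have "lookup e u \<le> 0 + int (occurrences u (pairs us @ pairs vs))"
    by (rule diff_mults_upper[OF _ e[unfolded vandermonde_def]]) (simp add: one_series_nonzero)
  ultimately show "lookup e u < int (length us)" using u by (cases us) auto
  show "0 \<le> lookup e u"
    by (rule diff_mults_lower[OF _ e[unfolded vandermonde_def]]) (simp add: one_series_nonzero)
qed

lemma vandermonde_keys: "vandermonde us vs e \<noteq> 0 \<Longrightarrow> keys e \<subseteq> set us \<union> set vs"
  unfolding vandermonde_def
proof (rule diff_mults_keys[of one_series])
  fix u v assume "(u, v) \<in> set (pairs us @ pairs vs)"
  then show "u \<in> set us \<union> set vs \<and> v \<in> set us \<union> set vs"
    using set_pairs[of us] set_pairs[of vs] by auto
qed (auto simp: one_series_def split: if_splits)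

lemma diff_mults_pairs_top:
  assumes "\<And>e w. f e \<noteq> 0 \<Longrightarrow> w \<in> set us \<Longrightarrow> lookup e w \<le> 0" "distinct us"
    and "\<And>w. w \<in> set us \<Longrightarrow> lookup r w = 0"
  shows "diff_mults (pairs us) f (top_mono us + r) = f r"
  using assms
proof (induction us)
  case (Cons u us)
  have "u \<notin> set us" using Cons.prems(2) by simp
  then have "u \<notin> fst ` set (pairs us)" "u \<notin> snd ` set (pairs us)"
    using set_pairs[of us] by auto
  then have occ: "occurrences u (pairs us) = 0" by (rule occurrences_notin)
  have low: "lookup e u \<le> 0" if "diff_mults (pairs us) f e \<noteq> 0" for e
  proof -
    have "f e' \<noteq> 0 \<Longrightarrow> lookup e' u \<le> 0" for e' by (rule Cons.prems(1)) auto
    then show ?thesis using diff_mults_upper[of f u 0 "pairs us" e] that occ by simp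
  qed
  have "lookup (top_mono us) u = 0" using Cons.prems(2) by (intro lookup_top_mono_notin) simp
  then have deg: "lookup (top_mono (u # us) + r) u = 0 + int (length us)"
    using Cons.prems(3)[of u] by (simp add: lookup_add)
  have "diff_mults (map (Pair u) us) (diff_mults (pairs us) f) (top_mono (u # us) + r) =
      diff_mults (pairs us) f (top_mono (u # us) + r - single u (int (length us)))"
    by (rule diff_mults_top[OF low _ deg]) (use Cons.prems(2) in auto)
  also have "top_mono (u # us) + r - single u (int (length us)) = top_mono us + r" by simp
  also have "diff_mults (pairs us) f (top_mono us + r) = f r"
  proof (rule Cons.IH)
    show "lookup e w \<le> 0" if "f e \<noteq> 0" "w \<in> set us" for e w
      using Cons.prems(1)[OF that(1)] that(2) by simp
  qed (use Cons.prems(2,3) in auto)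
  finally show ?case by simp
qed simp

lemma vandermonde_top:
  assumes "distinct (us @ vs)"
  shows "vandermonde us vs (top_mono us + top_mono vs) = 1"
proof -
  have d: "distinct us" "distinct vs" "set us \<inter> set vs = {}" using assms by auto
  have "vandermonde us vs (top_mono us + top_mono vs) =
      diff_mults (pairs us) (vandermonde [] vs) (top_mono us + top_mono vs)"
    by (simp add: vandermonde_def)
  also have "\<dots> = vandermonde [] vs (top_mono vs)"
  proof (rule diff_mults_pairs_top[OF _ d(1)])
    fix e w assume *: "vandermonde [] vs e \<noteq> 0" "w \<in> set us"
    have "w \<notin> keys e" using vandermonde_keys[OF *(1)] *(2) d(3) by auto
    then show "lookup e w \<le> 0" by (simp add: in_keys_iff)
  next
    fix w assume "w \<in> set us"
    then show "lookup (top_mono vs) w = 0" using d(3) by (intro lookup_top_mono_notin) auto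
  qed
  also have "\<dots> = diff_mults (pairs vs) one_series (top_mono vs + 0)"
    by (simp add: vandermonde_def)
  also have "\<dots> = one_series 0"
  proof (rule diff_mults_pairs_top[OF _ d(2)])
    fix e w assume "one_series e \<noteq> 0"
    then have "e = 0" by (simp add: one_series_def split: if_splits)
    then show "lookup e w \<le> 0" by simp
  qed simp
  finally show ?thesis by (simp add: one_series_def)
qed


section \<open>Fermionic correlators of one component\<close>

subsection \<open>Canonical anticommutation relations\<close>

lemma lookup_wedging:
  "lookup (wedging n v) S =
    (if n \<in> factors S then wedge_sign S n * lookup v (remove_factor n S) else 0)"
proof (induction v rule: fock_induct)
  case (wedge T)
  show ?case
    unfolding wedging_wedge_vec by (auto simp: wedge_vec_def lookup_single when_def remove_add add_remove)
qed (auto simp: lin_add[OF lin_wedging] lin_scale[OF lin_wedging] lookup_add algebra_simps)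

lemma lookup_contraction:
  "lookup (contraction n v) S =
    (if n \<in> factors S then 0 else wedge_sign S n * lookup v (add_factor n S))"
proof (induction v rule: fock_induct)
  case (wedge T)
  show ?case
    unfolding contraction_wedge_vec by (auto simp: wedge_vec_def lookup_single when_def remove_add add_remove)
qed (auto simp: lin_add[OF lin_contraction] lin_scale[OF lin_contraction] lookup_add algebra_simps)

lemma wedge_sign_add_other:
  assumes "n \<notin> factors S"
  shows "wedge_sign (add_factor n S) m = (if n \<prec> m then - 1 else 1) * wedge_sign S m"
proof -
  have "{s \<in> factors (add_factor n S). s \<prec> m} =
      (if n \<prec> m then insert n {s \<in> factors S. s \<prec> m} else {s \<in> factors S. s \<prec> m})" by auto
  then show ?thesis using assms by (simp add: wedge_sign_def finite_below)
qed

lemma prec_total: "m \<noteq> n \<Longrightarrow> m \<prec> n \<longleftrightarrow> \<not> n \<prec> m"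
  by (cases m; cases n) (auto simp: prec_def)

lemma contraction_anticommute: "contraction m (contraction n v) = - contraction n (contraction m v)"
proof (rule poly_mapping_eqI)
  fix S
  have "add_factor n (add_factor m S) = add_factor m (add_factor n S)" for m n
    by (rule wedge_eqI) auto
  then show "lookup (contraction m (contraction n v)) S = lookup (- contraction n (contraction m v)) S"
    by (cases "m = n") (auto simp: lookup_contraction wedge_sign_add_other prec_total[of m n] algebra_simps)
qed

lemma wedging_contraction:
  "wedging m (contraction n v) = (if m = n then v else 0) - contraction n (wedging m v)"
proof (rule poly_mapping_eqI)
  fix S
  show "lookup (wedging m (contraction n v)) S =
      lookup ((if m = n then v else 0) - contraction n (wedging m v)) S"
  proof (cases "m = n")
    case True
    then show ?thesis
      by (simp add: lookup_contraction lookup_wedging lookup_minus add_remove remove_add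
          mult.assoc[symmetric])
  next
    case False
    have 1: "remove_factor m (add_factor n S) = add_factor n (remove_factor m S)"
      using False by (intro wedge_eqI) auto
    have 2: "wedge_sign (remove_factor m S) n = (if m \<prec> n then - 1 else 1) * wedge_sign S n"
      if "m \<in> factors S"
      using wedge_sign_add_other[of m "remove_factor m S" n] add_remove[OF that] by auto
    show ?thesis
      using False prec_total[OF False]
      by (auto simp: lookup_contraction lookup_wedging lookup_minus 1 2 wedge_sign_add_other)
  qed
qed

text \<open>
  The modes are indexed by the exponent of \<open>w\<close> in the fields. With this convention both kinds
  annihilate the vacuum exactly for negative index, and the index of a pair with nonzero
  anticommutator adds up to \<open>- 1\<close>.
\<close>

abbreviation "P \<equiv> psi_plus_field"
abbreviation "M \<equiv> psi_minus_field"

text \<open>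
  As functions of \<open>e\<close> these are the coefficients of a product of fields, one for each variable.
\<close>

abbreviation "Ps a us e \<equiv> foldr (P a) (map (lookup e) us)"
abbreviation "Ms a us e \<equiv> foldr (M a) (map (lookup e) us)"

lemma P_P: "P a p (P b q v) = - P b q (P a p v)"
  by (simp add: psi_plus_field_def psi_plus_def wedging_anticommute[of "(a, - (- p - 1) - 1)"]
      wedging_anticommute[of "(a, p)"] wedging_anticommute[of _ "(b, _)"])

lemma M_M: "M a p (M b q v) = - M b q (M a p v)"
  by (simp add: psi_minus_field_def psi_minus_def contraction_anticommute[of "(a, p)"])

lemma P_M: "P a p (M b q v) = (if a = b \<and> p + q = - 1 then v else 0) - M b q (P a p v)"
  by (auto simp: psi_plus_field_def psi_plus_def psi_minus_field_def psi_minus_def wedging_contraction)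

lemma M_P: "M b q (P a p v) = (if a = b \<and> p + q = - 1 then v else 0) - P a p (M b q v)"
  by (simp add: P_M)

lemma lin_P: "lin (P a p)" and lin_M: "lin (M a p)"
  by (simp_all add: psi_plus_field_def psi_plus_def psi_minus_field_def psi_minus_def
      lin_wedging lin_contraction)

lemma lin_diff: "lin f \<Longrightarrow> f (u - v) = f u - f v"
  by (simp add: module_hom.diff)

lemma lin_foldr: "(\<And>x. lin (f x)) \<Longrightarrow> lin (foldr f xs)"
proof (induction xs)
  case (Cons x xs)
  then show ?case using lin_comp[of "f x" "foldr f xs"] by (simp add: comp_def)
qed (use lin_id in \<open>simp add: id_def\<close>)

lemmas fermion_lin = lin_add[OF lin_P] lin_add[OF lin_M] lin_scale[OF lin_P] lin_scale[OF lin_M]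
  lin_zero[OF lin_P] lin_zero[OF lin_M] lin_minus[OF lin_P] lin_minus[OF lin_M]
  lin_diff[OF lin_P] lin_diff[OF lin_M]

lemma foldr_anticommute:
  assumes "\<And>x. lin (f x)" "\<And>x v. f x (g v) = - g (f x v)" "lin g"
  shows "foldr f xs (g v) = scale ((- 1) ^ length xs) (g (foldr f xs v))"
  by (induction xs) (auto simp: assms lin_scale lin_minus)


subsection \<open>Exchanging creation and annihilation operators\<close>

text \<open>
  Multiplication by \<open>u - v\<close> annihilates the anticommutator \<open>\<delta>(u - v)\<close> of \<open>\<psi>\<^sup>+(u)\<close> and
  \<open>\<psi>\<^sup>-(v)\<close>.
\<close>

lemma diff_mult_exchange:
  assumes "u \<noteq> v" "\<And>e. h (e - single u 1) = h e" "\<And>e. h (e - single v 1) = h e"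
  shows "diff_mult u v (\<lambda>e. P a (lookup e u) (M a (lookup e v) (h e))) =
    (\<lambda>e. - diff_mult u v (\<lambda>e. M a (lookup e v) (P a (lookup e u) (h e))) e)"
  using assms(1)
  by (intro ext) (simp add: diff_mult_def P_M lookup_minus lookup_single when_def assms(2,3) algebra_simps)

lemma diff_mults_pull:
  assumes "\<And>x. lin (f x)" "u \<notin> fst ` set ps" "u \<notin> snd ` set ps"
  shows "diff_mults ps (\<lambda>e. f (lookup e u) (g e)) = (\<lambda>e. f (lookup e u) (diff_mults ps g e))"
  using assms(2,3)
  by (induction ps) (auto simp: diff_mult_def lin_diff[OF assms(1)] lookup_minus lookup_single)

lemma foldr_shift_notin:
  assumes "u \<notin> set vs"
  shows "foldr f (map (lookup (e - single u 1)) vs) w = foldr f (map (lookup e) vs) w"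
proof -
  have "map (lookup (e - single u 1)) vs = map (lookup e) vs"
    using assms by (auto simp: lookup_minus lookup_single when_def)
  then show ?thesis by (simp only:)
qed

lemma diff_mults_exchange1:
  assumes "distinct (u # vs)" "\<And>w e. w \<in> set (u # vs) \<Longrightarrow> h (e - single w 1) = h e"
  shows "diff_mults (map (Pair u) vs) (\<lambda>e. P a (lookup e u) (Ms a vs e (h e))) =
    (\<lambda>e. scale ((- 1) ^ length vs) (diff_mults (map (Pair u) vs)
      (\<lambda>e. Ms a vs e (P a (lookup e u) (h e))) e))"
  using assms
proof (induction vs)
  case (Cons v vs)
  let ?D = "diff_mults (map (Pair u) vs)"
  define h' where "h' = (\<lambda>e. Ms a vs e (h e))"
  have h': "h' (e - single u 1) = h' e" "h' (e - single v 1) = h' e" for e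
    using Cons.prems by (simp_all add: h'_def foldr_shift_notin)
  have "diff_mults (map (Pair u) (v # vs))
      (\<lambda>e. P a (lookup e u) (Ms a (v # vs) e (h e))) =
    ?D (diff_mult u v (\<lambda>e. P a (lookup e u) (M a (lookup e v) (h' e))))"
    by (simp add: diff_mults_commute1 h'_def)
  also have "\<dots> = (\<lambda>e. - ?D (diff_mult u v (\<lambda>e. M a (lookup e v) (P a (lookup e u) (h' e)))) e)"
    using Cons.prems(1) h' by (subst diff_mult_exchange) (auto intro!: diff_mults_hom)
  also have "?D (diff_mult u v (\<lambda>e. M a (lookup e v) (P a (lookup e u) (h' e)))) =
      diff_mult u v (\<lambda>e. M a (lookup e v) (?D (\<lambda>e. P a (lookup e u) (h' e)) e))"
    using Cons.prems(1) by (subst diff_mults_commute1, subst diff_mults_pull) (auto intro: lin_M)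
  also have "?D (\<lambda>e. P a (lookup e u) (h' e)) = (\<lambda>e. scale ((- 1) ^ length vs) (?D
      (\<lambda>e. Ms a vs e (P a (lookup e u) (h e))) e))"
    unfolding h'_def by (rule Cons.IH) (use Cons.prems in auto)
  also have "diff_mult u v (\<lambda>e. M a (lookup e v) (scale ((- 1) ^ length vs) (?D
      (\<lambda>e. Ms a vs e (P a (lookup e u) (h e))) e))) =
     (\<lambda>e. scale ((- 1) ^ length vs) (diff_mult u v (\<lambda>e. M a (lookup e v) (?D
      (\<lambda>e. Ms a vs e (P a (lookup e u) (h e))) e)) e))"
    by (intro ext) (simp add: diff_mult_def fermion_lin fock.scale_right_diff_distrib)
  also have "(\<lambda>e. M a (lookup e v) (?D
      (\<lambda>e. Ms a vs e (P a (lookup e u) (h e))) e)) =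
      ?D (\<lambda>e. Ms a (v # vs) e (P a (lookup e u) (h e)))"
    using Cons.prems(1) by (subst diff_mults_pull[symmetric]) (auto intro: lin_M)
  finally show ?case by simp
qed simp

text \<open>
  No anticommutator survives the factors \<open>u - v\<close>, so that all \<open>\<psi>\<^sup>+(u)\<close> may be moved to the right of
  all \<open>\<psi>\<^sup>-(v)\<close>.
\<close>

lemma diff_mults_exchange:
  assumes "distinct (us @ vs)"
  shows "cross_mults us vs
      (\<lambda>e. Ps a us e (Ms a vs e \<kappa>)) =
    (\<lambda>e. scale ((- 1) ^ (length us * length vs)) (cross_mults us vs
      (\<lambda>e. Ms a vs e (Ps a us e \<kappa>)) e))"
  using assms
proof (induction us)
  case (Cons u us)
  let ?D = "diff_mults (map (Pair u) vs)" and ?D' = "cross_mults us vs"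
  let ?s = "(- 1) ^ (length us * length vs) :: complex"
  have u: "u \<notin> fst ` set (List.product us vs)" "u \<notin> snd ` set (List.product us vs)"
    using Cons.prems by auto
  have "diff_mults (List.product (u # us) vs)
      (\<lambda>e. Ps a (u # us) e (Ms a vs e \<kappa>)) =
    ?D (\<lambda>e. P a (lookup e u) (?D' (\<lambda>e. Ps a us e
      (Ms a vs e \<kappa>)) e))"
    using u by (subst diff_mults_pull[symmetric]) (auto intro: lin_P)
  also have "\<dots> = ?D (\<lambda>e. scale ?s (P a (lookup e u) (?D' (\<lambda>e. Ms a vs e
      (Ps a us e \<kappa>)) e)))"
    using Cons by (simp add: fermion_lin)
  also have "\<dots> = (\<lambda>e. scale ?s (?D (\<lambda>e. P a (lookup e u) (?D' (\<lambda>e. Ms a vs e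
      (Ps a us e \<kappa>)) e)) e))"
    by (rule diff_mults_hom) (simp_all add: fock.scale_right_diff_distrib)
  also have "?D (\<lambda>e. P a (lookup e u) (?D' (\<lambda>e. Ms a vs e
      (Ps a us e \<kappa>)) e)) =
     ?D' (?D (\<lambda>e. P a (lookup e u) (Ms a vs e
      (Ps a us e \<kappa>))))"
    using u by (subst diff_mults_commute, subst diff_mults_pull) (auto intro: lin_P)
  also have "\<dots> = ?D' (\<lambda>e. scale ((- 1) ^ length vs) (?D (\<lambda>e. Ms a vs e
      (P a (lookup e u) (Ps a us e \<kappa>))) e))"
    by (subst diff_mults_exchange1) (use Cons.prems in \<open>auto intro!: foldr_shift_notin\<close>)
  also have "\<dots> = (\<lambda>e. scale ((- 1) ^ length vs) (?D' (?D (\<lambda>e. Ms a vs e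
      (P a (lookup e u) (Ps a us e \<kappa>)))) e))"
    by (rule diff_mults_hom) (simp_all add: fock.scale_right_diff_distrib)
  finally show ?case
    by (simp add: diff_mults_commute[of "map (Pair u) vs"] power_add mult.commute)
qed simp


subsection \<open>The correlator as a product\<close>

fun desc :: "int \<Rightarrow> nat \<Rightarrow> int list" where
  "desc c 0 = []"
| "desc c (Suc n) = (c - 1) # desc (c - 1) n"

lemma map_top_mono: "distinct us \<Longrightarrow> map (lookup (top_mono us)) us = desc (int (length us)) (length us)"
proof (induction us)
  case (Cons u us)
  have "map (lookup (top_mono (u # us))) us = map (lookup (top_mono us)) us"
    using Cons.prems by (auto simp: lookup_add lookup_single when_def)
  then have tail: "map (lookup (top_mono (u # us))) us = desc (int (length us)) (length us)"
    using Cons by (simp only:) simp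
  have "lookup (top_mono us) u = 0" using Cons.prems by (intro lookup_top_mono_notin) simp
  then have "lookup (top_mono (u # us)) u = int (length us)" by (simp add: lookup_add)
  then show ?case using tail by (simp del: top_mono.simps)
qed simp

lemma foldr_exchange:
  assumes "\<And>x y v. f x (f y v) = - f y (f x v)" "\<And>x. lin (f x)"
  shows "foldr f (as @ y # x # bs) v = - foldr f (as @ x # y # bs) v"
proof -
  have "foldr f as (- w) = - foldr f as w" for w by (rule lin_minus[OF lin_foldr[OF assms(2)]])
  then show ?thesis using assms(1)[of y x] by simp
qed

text \<open>
  As far as the component \<open>a\<close> is concerned, \<open>lam\<close> is the pairing with the vacuum of charge \<open>c\<close>, and \<open>\<kappa>\<close> is
  the vacuum of charge \<open>0\<close>. Operators of the other components can be absorbed into both.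
\<close>

locale charged_functional =
  fixes a :: 3 and lam :: "fock \<Rightarrow> complex" and \<kappa> :: fock and c :: int
  assumes lam: "module_hom scale (*) lam"
    and lam_P: "c \<le> p \<Longrightarrow> lam (P a p w) = 0"
    and lam_M: "- c \<le> p \<Longrightarrow> lam (M a p w) = 0"
    and kappa_P: "p < 0 \<Longrightarrow> P a p \<kappa> = 0"
    and kappa_M: "p < 0 \<Longrightarrow> M a p \<kappa> = 0"
begin

lemma lam_minus: "lam (- w) = - lam w" and lam_diff: "lam (u - w) = lam u - lam w"
  and lam_scale: "lam (scale z w) = z * lam w" and lam_zero: "lam 0 = 0"
  using lam by (simp_all add: module_hom.neg module_hom.diff module_hom.scale module_hom.zero)

text \<open>
  The vacuum of charge \<open>c\<close> loses its outermost factor. This is the step of the induction that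
  determines the leading coefficient.
\<close>

lemma charged_functional_P: "charged_functional a (\<lambda>w. lam (P a (c - 1) w)) \<kappa> (c - 1)"
proof (rule charged_functional.intro)
  show "lam (P a (c - 1) (P a p w)) = 0" if "c - 1 \<le> p" for p w
  proof (cases "p = c - 1")
    case True
    have "lam (P a p (P a p w)) = - lam (P a p (P a p w))"
      using P_P[of a p a p w] lam_minus by metis
    then show ?thesis using True by simp
  next
    case False
    then show ?thesis using that by (simp add: P_P[of _ _ _ p] lam_minus lam_P)
  qed
  show "lam (P a (c - 1) (M a p w)) = 0" if "- (c - 1) \<le> p" for p w
    using that by (simp add: P_M lam_minus lam_M)
qed (auto intro!: functionalI simp: fermion_lin kappa_P kappa_M lam_scale module_hom.add[OF lam])

definition corr :: "res_var list \<Rightarrow> res_var list \<Rightarrow> res_mono \<Rightarrow> complex" where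
  "corr us vs e = lam (Ps a us e (Ms a vs e \<kappa>))"

definition corr' :: "res_var list \<Rightarrow> res_var list \<Rightarrow> res_mono \<Rightarrow> complex" where
  "corr' us vs e = lam (Ms a vs e (Ps a us e \<kappa>))"

lemma corr_exchange:
  assumes "distinct (us @ vs)"
  shows "cross_mults us vs (corr us vs) e =
    (- 1) ^ (length us * length vs) * cross_mults us vs (corr' us vs) e"
proof -
  have "cross_mults us vs (corr us vs) = (\<lambda>e. lam (cross_mults us vs
      (\<lambda>e. Ps a us e (Ms a vs e \<kappa>)) e))"
    unfolding corr_def[abs_def] by (rule diff_mults_hom) (simp_all add: lam_zero lam_diff)
  moreover have "cross_mults us vs (corr' us vs) = (\<lambda>e. lam (cross_mults us vs
      (\<lambda>e. Ms a vs e (Ps a us e \<kappa>)) e))"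
    unfolding corr'_def[abs_def] by (rule diff_mults_hom) (simp_all add: lam_zero lam_diff)
  ultimately show ?thesis by (simp add: diff_mults_exchange[OF assms] lam_scale)
qed

text \<open>
  By anticommutation any operator of the leftmost group can act on the functional first, and any
  operator of the rightmost group on the vector.
\<close>

lemma foldr_P_zero: "p \<in> set ps \<Longrightarrow> c \<le> p \<Longrightarrow> lam (foldr (P a) ps w) = 0"
proof -
  assume "p \<in> set ps" "c \<le> p"
  then obtain as bs where "ps = as @ p # bs" by (metis split_list)
  then show ?thesis using \<open>c \<le> p\<close>
    by (simp add: foldr_anticommute[of "P a" "P a p", OF lin_P P_P lin_P] lam_scale lam_P)
qed

lemma foldr_M_zero: "p \<in> set ps \<Longrightarrow> - c \<le> p \<Longrightarrow> lam (foldr (M a) ps w) = 0"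
proof -
  assume "p \<in> set ps" "- c \<le> p"
  then obtain as bs where "ps = as @ p # bs" by (metis split_list)
  then show ?thesis using \<open>- c \<le> p\<close>
    by (simp add: foldr_anticommute[of "M a" "M a p", OF lin_M M_M lin_M] lam_scale lam_M)
qed

lemma foldr_anticommute_inner:
  assumes "\<And>x y v. f x (f y v) = - f y (f x v)" "\<And>x. lin (f x)" "p \<in> set ps" "f p v = 0"
  shows "foldr f ps v = 0"
proof -
  obtain as bs where "ps = as @ p # bs" using assms(3) by (metis split_list)
  moreover have "f p (foldr f bs v) = 0"
  proof -
    have "scale ((- 1) ^ length bs) (f p (foldr f bs v)) = foldr f bs (f p v)"
      by (rule foldr_anticommute[symmetric, OF assms(2) assms(1) assms(2)])
    also have "\<dots> = 0" using lin_zero[OF lin_foldr[OF assms(2)]] assms(4) by simp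
    finally show ?thesis by simp
  qed
  ultimately show ?thesis using lin_zero[OF lin_foldr[OF assms(2)]] by simp
qed

lemma foldr_P_kappa: "p \<in> set ps \<Longrightarrow> p < 0 \<Longrightarrow> foldr (P a) ps \<kappa> = 0"
  by (rule foldr_anticommute_inner[OF P_P lin_P]) (auto simp: kappa_P)

lemma foldr_M_kappa: "p \<in> set ps \<Longrightarrow> p < 0 \<Longrightarrow> foldr (M a) ps \<kappa> = 0"
  by (rule foldr_anticommute_inner[OF M_M lin_M]) (auto simp: kappa_M)

lemma corr_bounds:
  assumes "corr us vs e \<noteq> 0"
  shows "u \<in> set us \<Longrightarrow> lookup e u \<le> c - 1" "v \<in> set vs \<Longrightarrow> 0 \<le> lookup e v"
proof -
  show "lookup e u \<le> c - 1" if "u \<in> set us"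
  proof (rule ccontr)
    assume "\<not> lookup e u \<le> c - 1"
    then have "c \<le> lookup e u" "lookup e u \<in> set (map (lookup e) us)" using that by auto
    then show False using assms foldr_P_zero unfolding corr_def by blast
  qed
  show "0 \<le> lookup e v" if "v \<in> set vs"
  proof (rule ccontr)
    assume "\<not> 0 \<le> lookup e v"
    then have "Ms a vs e \<kappa> = 0"
      using that by (intro foldr_M_kappa[of "lookup e v"]) auto
    then show False using assms by (simp add: corr_def lin_zero[OF lin_foldr[OF lin_P]] lam_zero)
  qed
qed

lemma corr'_bounds:
  assumes "corr' us vs e \<noteq> 0"
  shows "v \<in> set vs \<Longrightarrow> lookup e v \<le> - c - 1" "u \<in> set us \<Longrightarrow> 0 \<le> lookup e u"
proof -
  show "lookup e v \<le> - c - 1" if "v \<in> set vs"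
  proof (rule ccontr)
    assume "\<not> lookup e v \<le> - c - 1"
    then have "- c \<le> lookup e v" "lookup e v \<in> set (map (lookup e) vs)" using that by auto
    then show False using assms foldr_M_zero unfolding corr'_def by blast
  qed
  show "0 \<le> lookup e u" if "u \<in> set us"
  proof (rule ccontr)
    assume "\<not> 0 \<le> lookup e u"
    then have "Ps a us e \<kappa> = 0"
      using that by (intro foldr_P_kappa[of "lookup e u"]) auto
    then show False using assms by (simp add: corr'_def lin_zero[OF lin_foldr[OF lin_M]] lam_zero)
  qed
qed


text \<open>
  The functional bounds the exponents of the operators next to it from above, the vector those of the
  operators next to it from below. With the two orders of the operators both bounds hold for the
  exponents of every variable.
\<close>

lemma alternating_left:
  assumes d: "distinct (us @ vs)" and c: "int (length us) - int (length vs) = c"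
  shows "alternating_in us (cross_mults us vs (corr us vs))"
  unfolding alternating_in_def
proof (intro conjI ballI impI allI)
  fix u v e assume uv: "u \<in> set us" "v \<in> set us" "u \<noteq> v"
  have vs: "map (transpose u v) vs = vs" by (rule map_transpose_id) (use uv d in auto)
  have "(\<lambda>e. corr us vs (swap_mono u v e)) = corr (map (transpose u v) us) (map (transpose u v) vs)"
  proof (rule ext)
    fix e
    have "map (lookup (swap_mono u v e)) ws = map (lookup e) (map (transpose u v) ws)" for ws
      by simp
    then show "corr us vs (swap_mono u v e) = corr (map (transpose u v) us) (map (transpose u v) vs) e"
      by (simp only: corr_def)
  qed
  then have "cross_mults us vs (corr us vs) (swap_mono u v e) =
      diff_mults (List.product (map (transpose u v) us) vs) (corr (map (transpose u v) us) vs) e"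
    using product_map[of "transpose u v" us vs] vs by (simp add: diff_mults_swap)
  also have "\<dots> = - cross_mults us vs (corr us vs) e"
  proof (rule alternating_transpose[where S = "set us" and
        \<phi> = "\<lambda>us. cross_mults us vs (corr us vs) e"])
    fix as bs x y
    have "corr (as @ y # x # bs) vs = (\<lambda>e. - corr (as @ x # y # bs) vs e)"
    proof
      fix e
      show "corr (as @ y # x # bs) vs e = - corr (as @ x # y # bs) vs e"
        using foldr_exchange[of "P a", OF P_P lin_P, of "map (lookup e) as" "lookup e y" "lookup e x" "map (lookup e) bs"
            "Ms a vs e \<kappa>"]
        by (simp only: corr_def map_append list.map lam_minus)
    qed
    moreover have "diff_mults (List.product (as @ y # x # bs) vs) f =
        diff_mults (List.product (as @ x # y # bs) vs) f" for f :: "res_mono \<Rightarrow> complex"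
      by (rule diff_mults_mset) (simp add: product_append_left)
    ultimately show "diff_mults (List.product (as @ y # x # bs) vs) (corr (as @ y # x # bs) vs) e =
        - diff_mults (List.product (as @ x # y # bs) vs) (corr (as @ x # y # bs) vs) e"
      by (simp only: diff_mults_minus)
  qed (use uv d in auto)
  finally show "cross_mults us vs (corr us vs) (swap_mono u v e) =
      - cross_mults us vs (corr us vs) e" .
next
  fix e u assume e: "cross_mults us vs (corr us vs) e \<noteq> 0" and u: "u \<in> set us"
  have "occurrences u (List.product us vs) = length vs"
    using u d by (intro occurrences_product_left) auto
  moreover have "lookup e u \<le> c - 1 + int (occurrences u (List.product us vs))"
    by (rule diff_mults_upper[OF _ e]) (use corr_bounds(1) u in blast)
  ultimately show "lookup e u < int (length us)" using c by simp
  have e': "cross_mults us vs (corr' us vs) e \<noteq> 0"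
    using e by (simp add: corr_exchange[OF d])
  show "0 \<le> lookup e u"
    by (rule diff_mults_lower[OF _ e']) (use corr'_bounds(2) u in blast)
qed

lemma alternating_right:
  assumes d: "distinct (us @ vs)" and c: "int (length us) - int (length vs) = c"
  shows "alternating_in vs (cross_mults us vs (corr us vs))"
  unfolding alternating_in_def
proof (intro conjI ballI impI allI)
  fix u v e assume uv: "u \<in> set vs" "v \<in> set vs" "u \<noteq> v"
  have us: "map (transpose u v) us = us" by (rule map_transpose_id) (use uv d in auto)
  have "(\<lambda>e. corr us vs (swap_mono u v e)) = corr (map (transpose u v) us) (map (transpose u v) vs)"
  proof (rule ext)
    fix e
    have "map (lookup (swap_mono u v e)) ws = map (lookup e) (map (transpose u v) ws)" for ws
      by simp
    then show "corr us vs (swap_mono u v e) = corr (map (transpose u v) us) (map (transpose u v) vs) e"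
      by (simp only: corr_def)
  qed
  then have "cross_mults us vs (corr us vs) (swap_mono u v e) =
      diff_mults (List.product us (map (transpose u v) vs)) (corr us (map (transpose u v) vs)) e"
    using product_map[of "transpose u v" us vs] us by (simp add: diff_mults_swap)
  also have "\<dots> = - cross_mults us vs (corr us vs) e"
  proof (rule alternating_transpose[where S = "set vs" and
        \<phi> = "\<lambda>vs. cross_mults us vs (corr us vs) e"])
    fix as bs x y
    have "corr us (as @ y # x # bs) = (\<lambda>e. - corr us (as @ x # y # bs) e)"
    proof
      fix e
      show "corr us (as @ y # x # bs) e = - corr us (as @ x # y # bs) e"
        using foldr_exchange[of "M a", OF M_M lin_M, of "map (lookup e) as" "lookup e y" "lookup e x" "map (lookup e) bs" \<kappa>]
        by (simp only: corr_def map_append list.map lam_minus lin_minus[OF lin_foldr[OF lin_P]])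
    qed
    moreover have "diff_mults (List.product us (as @ y # x # bs)) f =
        diff_mults (List.product us (as @ x # y # bs)) f" for f :: "res_mono \<Rightarrow> complex"
    proof (rule diff_mults_mset)
      have "mset (List.product us (y # x # bs)) = mset (List.product us (x # y # bs))"
        using product_append_right[of us "[y, x]" bs] product_append_right[of us "[x, y]" bs]
          product_append_right[of us "[y]" "[x]"] product_append_right[of us "[x]" "[y]"] by simp
      then show "mset (List.product us (as @ y # x # bs)) = mset (List.product us (as @ x # y # bs))"
        by (simp add: product_append_right)
    qed
    ultimately show "diff_mults (List.product us (as @ y # x # bs)) (corr us (as @ y # x # bs)) e =
        - diff_mults (List.product us (as @ x # y # bs)) (corr us (as @ x # y # bs)) e"
      by (simp only: diff_mults_minus)
  qed (use uv d in auto)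
  finally show "cross_mults us vs (corr us vs) (swap_mono u v e) =
      - cross_mults us vs (corr us vs) e" .
next
  fix e v assume e: "cross_mults us vs (corr us vs) e \<noteq> 0" and v: "v \<in> set vs"
  show "0 \<le> lookup e v"
    by (rule diff_mults_lower[OF _ e]) (use corr_bounds(2) v in blast)
  have e': "cross_mults us vs (corr' us vs) e \<noteq> 0"
    using e by (simp add: corr_exchange[OF d])
  have "occurrences v (List.product us vs) = length us"
    using v d by (intro occurrences_product_right) auto
  moreover have "lookup e v \<le> - c - 1 + int (occurrences v (List.product us vs))"
    by (rule diff_mults_upper[OF _ e']) (use corr'_bounds(1) v in blast)
  ultimately show "lookup e v < int (length vs)" using c by simp
qed

end

text \<open>
  The highest power of the first variable takes \<open>u\<close> from each factor \<open>u - v\<close> and the exponent \<open>c - 1\<close>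
  from the correlator. The operator with this exponent goes into the functional, whose charge drops
  by one, and the remaining variables follow by induction.
\<close>

lemma corr_top:
  assumes "charged_functional a lam \<kappa> c"
    and "distinct (us @ vs)" "int (length us) - int (length vs) = c"
  shows "cross_mults us vs (charged_functional.corr a lam \<kappa> us vs)
      (top_mono us + top_mono vs) =
    lam (foldr (P a) (desc c (length us)) (foldr (M a) (desc (int (length vs)) (length vs)) \<kappa>))"
  using assms
proof (induction us arbitrary: lam c)
  case Nil
  interpret charged_functional a lam \<kappa> c by fact
  show ?case using Nil.prems(2) by (simp add: corr_def map_top_mono)
next
  case (Cons u us)
  interpret charged_functional a lam \<kappa> c by fact
  let ?lam' = "\<lambda>w. lam (P a (c - 1) w)"
  interpret L: charged_functional a ?lam' \<kappa> "c - 1" by (rule charged_functional_P)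
  let ?f = "cross_mults us vs (corr (u # us) vs)"
  let ?t = "top_mono us + top_mono vs"
  have u: "u \<notin> set us" "u \<notin> set vs" using Cons.prems(2) by auto
  have "occurrences u (List.product us vs) = 0"
    using u by (intro occurrences_notin) auto
  then have low: "lookup e u \<le> c - 1" if "?f e \<noteq> 0" for e
    using diff_mults_upper[of "corr (u # us) vs" u "c - 1" "List.product us vs" e] that corr_bounds(1)
    by auto
  have deg: "lookup (top_mono (u # us) + top_mono vs) u = c - 1 + int (length vs)"
    using u Cons.prems(3) by (simp add: lookup_add lookup_top_mono_notin)
  have "diff_mults (List.product (u # us) vs) (corr (u # us) vs) (top_mono (u # us) + top_mono vs) =
      diff_mults (map (Pair u) vs) ?f (top_mono (u # us) + top_mono vs)" by simp
  also have "\<dots> = ?f (top_mono (u # us) + top_mono vs - single u (int (length vs)))"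
    by (rule diff_mults_top[OF low u(2) deg])
  also have "top_mono (u # us) + top_mono vs - single u (int (length vs)) = single u (c - 1) + ?t"
    using Cons.prems(3)
    by (intro poly_mapping_eqI) (auto simp: lookup_add lookup_minus lookup_single when_def)
  also have "?f (single u (c - 1) + ?t) =
      cross_mults us vs (\<lambda>r. corr (u # us) vs (single u (c - 1) + r)) ?t"
    by (rule diff_mults_shift)
  also have "\<dots> = cross_mults us vs (L.corr us vs) ?t"
  proof (rule diff_mults_cong_keys[where V = "set us \<union> set vs"])
    fix e :: res_mono assume "keys e \<subseteq> set us \<union> set vs"
    then have "lookup e u = 0" using u by (auto simp: in_keys_iff)
    moreover have "map (lookup (single u (c - 1) + e)) ws = map (lookup e) ws" if "u \<notin> set ws" for ws
      using that by (auto simp: lookup_add lookup_single when_def)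
    note this[OF u(1)] this[OF u(2)]
    ultimately show "corr (u # us) vs (single u (c - 1) + e) = L.corr us vs e"
      by (simp add: corr_def L.corr_def lookup_add del: map_eq_conv)
  next
    show "keys ?t \<subseteq> set us \<union> set vs"
      using keys_add[of "top_mono us" "top_mono vs"] keys_top_mono[of us] keys_top_mono[of vs] by auto
  qed auto
  also have "\<dots> = ?lam' (foldr (P a) (desc (c - 1) (length us))
      (foldr (M a) (desc (int (length vs)) (length vs)) \<kappa>))"
    by (rule Cons.IH) (use Cons.prems L.charged_functional_axioms in auto)
  finally show ?case by simp
qed

lemma alternating_in_diff:
  assumes "alternating_in us f" "alternating_in us g"
  shows "alternating_in us (\<lambda>e. f e - z * g e)"
proof -
  have nz: "f e \<noteq> 0 \<or> g e \<noteq> 0" if "f e - z * g e \<noteq> 0" for e using that by auto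
  show ?thesis
    unfolding alternating_in_def
  proof (intro conjI ballI impI allI)
    fix u v e assume "u \<in> set us" "v \<in> set us" "u \<noteq> v"
    then have "f (swap_mono u v e) = - f e" "g (swap_mono u v e) = - g e"
      using assms by (simp_all add: alternating_in_def)
    then show "f (swap_mono u v e) - z * g (swap_mono u v e) = - (f e - z * g e)" by simp
  next
    fix e u assume "f e - z * g e \<noteq> 0" "u \<in> set us"
    then show "0 \<le> lookup e u" "lookup e u < int (length us)"
      using nz[of e] assms by (auto simp: alternating_in_def)
  qed
qed

text \<open>
  Both sides are alternating in \<open>us\<close> and in \<open>vs\<close>, with the same bounds on the exponents, and they have
  the same leading coefficient.
\<close>

theorem (in charged_functional) one_component_correlator:
  assumes d: "distinct (us @ vs)" and c: "int (length us) - int (length vs) = c"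
    and e: "keys e \<subseteq> set us \<union> set vs"
  shows "cross_mults us vs (corr us vs) e =
    lam (foldr (P a) (desc c (length us)) (foldr (M a) (desc (int (length vs)) (length vs)) \<kappa>)) *
    vandermonde us vs e"
proof -
  let ?s = "lam (foldr (P a) (desc c (length us)) (foldr (M a) (desc (int (length vs)) (length vs)) \<kappa>))"
  let ?f = "\<lambda>e. cross_mults us vs (corr us vs) e - ?s * vandermonde us vs e"
  have "?f e = 0"
  proof (rule alternating_zero[OF _ _ d _ e])
    show "alternating_in us ?f"
      by (rule alternating_in_diff[OF alternating_left[OF d c] alternating_vandermonde[OF d]])
    have "alternating_in vs (vandermonde us vs)"
      unfolding vandermonde_commute[of us vs] by (rule alternating_vandermonde) (use d in auto)
    then show "alternating_in vs ?f"
      by (rule alternating_in_diff[OF alternating_right[OF d c]])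
    show "?f (top_mono us + top_mono vs) = 0"
      by (simp add: corr_top[OF charged_functional_axioms d c] vandermonde_top[OF d])
  qed
  then show ?thesis by simp
qed


section \<open>A ring of formal Laurent series\<close>

text \<open>
  The direction of expansion: exponents of the \<open>x\<close> are bounded above, those of the \<open>y\<close> and \<open>z\<close> below.
  Then \<open>1 / (x - z)\<close>, expanded in positive powers of \<open>z\<close>, is admissible.
\<close>

definition orient :: "res_var \<Rightarrow> int" where
  "orient v = (case v of x_var i \<Rightarrow> - 1 | _ \<Rightarrow> 1)"

lemma orient_simps [simp]:
  "orient (x_var i) = - 1" "orient (y_var i) = 1" "orient (z_var i) = 1"
  by (simp_all add: orient_def)

lemma orient_cases: "orient v = 1 \<or> orient v = - 1"
  by (cases v) auto

definition bounded_mono :: "res_var set \<Rightarrow> int \<Rightarrow> res_mono \<Rightarrow> bool" where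
  "bounded_mono V N e \<longleftrightarrow> keys e \<subseteq> V \<and> (\<forall>v. N \<le> orient v * lookup e v)"

definition tame :: "(res_mono \<Rightarrow> complex) \<Rightarrow> bool" where
  "tame f \<longleftrightarrow> (\<exists>V N. finite V \<and> (\<forall>e. f e \<noteq> 0 \<longrightarrow> bounded_mono V N e))"

lemma tameI: "finite V \<Longrightarrow> (\<And>e. f e \<noteq> 0 \<Longrightarrow> bounded_mono V N e) \<Longrightarrow> tame f"
  by (auto simp: tame_def)

lemma bounded_mono_mono: "bounded_mono V N e \<Longrightarrow> V \<subseteq> W \<Longrightarrow> K \<le> N \<Longrightarrow> bounded_mono W K e"
  by (auto simp: bounded_mono_def intro: order_trans)

lemma bounded_mono_add:
  "bounded_mono V N a \<Longrightarrow> bounded_mono W K b \<Longrightarrow> bounded_mono (V \<union> W) (N + K) (a + b)"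
  using keys_add[of a b]
  by (auto simp: bounded_mono_def lookup_add distrib_left add_mono)

lemma finite_bounded_interval:
  assumes "finite V"
  shows "finite {e. bounded_mono V N e \<and> (\<forall>v. orient v * lookup e v \<le> h v)}"
    (is "finite ?A")
proof -
  let ?B = "\<Union>v\<in>V. {- \<bar>N\<bar> - \<bar>h v\<bar>..\<bar>N\<bar> + \<bar>h v\<bar>}"
  have "lookup ` ?A \<subseteq> {f. \<forall>v. (v \<in> V \<longrightarrow> f v \<in> ?B) \<and> (v \<notin> V \<longrightarrow> f v = 0)}"
  proof (clarify, intro conjI impI)
    fix e v assume *: "bounded_mono V N e" "\<forall>v. orient v * lookup e v \<le> h v"
    { assume "v \<in> V"
      moreover have "lookup e v \<in> {- \<bar>N\<bar> - \<bar>h v\<bar>..\<bar>N\<bar> + \<bar>h v\<bar>}"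
        using orient_cases[of v] *(2)[rule_format, of v] *(1)[unfolded bounded_mono_def, THEN conjunct2, rule_format, of v]
        by auto
      ultimately show "lookup e v \<in> ?B" by blast }
    { assume "v \<notin> V"
      then show "lookup e v = 0" using *(1) by (auto simp: bounded_mono_def in_keys_iff) }
  qed
  moreover have "finite {f. \<forall>v. (v \<in> V \<longrightarrow> f v \<in> ?B) \<and> (v \<notin> V \<longrightarrow> f v = 0)}"
    using assms by (intro finite_set_of_finite_funs) auto
  ultimately have "finite (lookup ` ?A)" by (rule finite_subset)
  then show ?thesis by (rule finite_imageD) (auto intro!: inj_onI poly_mapping_eqI)
qed

text \<open>
  One-sided bounds for the summands of a given exponent vector imply bounds from the other side. This
  makes products well-defined and associative.
\<close>

lemma finite_bounded_triples:
  assumes "finite U" "finite V" "finite W"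
  shows "finite {(a, b, c). a + b + c = e \<and> bounded_mono U N a \<and> bounded_mono V K b \<and> bounded_mono W L c}"
    (is "finite ?A")
proof -
  let ?H = "\<lambda>v. orient v * lookup e v - N - K - L"
  let ?B = "\<lambda>U N. {a. bounded_mono U N a \<and> (\<forall>v. orient v * lookup a v \<le> ?H v + N)}"
  have "(a, b, c) \<in> ?B U N \<times> ?B V K \<times> ?B W L" if "(a, b, c) \<in> ?A" for a b c
  proof -
    have *: "bounded_mono U N a" "bounded_mono V K b" "bounded_mono W L c" "e = a + b + c"
      using that by auto
    have "orient v * lookup a v \<le> ?H v + N" "orient v * lookup b v \<le> ?H v + K"
      "orient v * lookup c v \<le> ?H v + L" for v
    proof -
      have "N \<le> orient v * lookup a v" "K \<le> orient v * lookup b v" "L \<le> orient v * lookup c v"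
        using * by (auto simp: bounded_mono_def)
      moreover have "orient v * lookup e v =
          orient v * lookup a v + orient v * lookup b v + orient v * lookup c v"
        by (simp add: *(4) lookup_add distrib_left)
      ultimately show "orient v * lookup a v \<le> ?H v + N" "orient v * lookup b v \<le> ?H v + K"
          "orient v * lookup c v \<le> ?H v + L"
        by linarith+
    qed
    then show ?thesis using * by simp
  qed
  then have "?A \<subseteq> ?B U N \<times> ?B V K \<times> ?B W L" by auto
  then show ?thesis
    by (rule finite_subset) (intro finite_cartesian_product finite_bounded_interval assms)
qed

definition triples ::
    "(res_mono \<Rightarrow> complex) \<Rightarrow> (res_mono \<Rightarrow> complex) \<Rightarrow> (res_mono \<Rightarrow> complex) \<Rightarrow> res_mono \<Rightarrow>
      (res_mono \<times> res_mono \<times> res_mono) set" where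
  "triples f g h e = {(a, b, c). a + b + c = e \<and> f a \<noteq> 0 \<and> g b \<noteq> 0 \<and> h c \<noteq> 0}"

lemma finite_triples:
  assumes "tame f" "tame g" "tame h"
  shows "finite (triples f g h e)"
proof -
  obtain U N V K W L where 1: "finite U" "finite V" "finite W"
    and 2: "\<And>e. f e \<noteq> 0 \<Longrightarrow> bounded_mono U N e" "\<And>e. g e \<noteq> 0 \<Longrightarrow> bounded_mono V K e"
      "\<And>e. h e \<noteq> 0 \<Longrightarrow> bounded_mono W L e"
    using assms unfolding tame_def by metis
  show ?thesis
    by (rule finite_subset[OF _ finite_bounded_triples[OF 1, of e N K L]])
      (use 2 in \<open>auto simp: triples_def\<close>)
qed

lemma tame_one: "tame one_series"
  by (rule tameI[of "{}" _ 0]) (auto simp: one_series_def bounded_mono_def split: if_splits)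

lemma finite_pairs:
  assumes "tame f" "tame g"
  shows "finite {(a, b). a + b = e \<and> f a \<noteq> 0 \<and> g b \<noteq> 0}"
proof (rule finite_subset)
  show "{(a, b). a + b = e \<and> f a \<noteq> 0 \<and> g b \<noteq> 0} \<subseteq> (\<lambda>(a, b, c). (a, b)) ` triples f g one_series e"
    by (force simp: triples_def one_series_def image_iff)
qed (use finite_triples[OF assms tame_one] in auto)

lemma series_times_superset:
  assumes "finite S" "S \<subseteq> {(a, b). a + b = e}" "\<And>a b. a + b = e \<Longrightarrow> f a \<noteq> 0 \<Longrightarrow> g b \<noteq> 0 \<Longrightarrow> (a, b) \<in> S"
  shows "(f \<star> g) e = (\<Sum>(a, b)\<in>S. f a * g b)"
  unfolding series_times_def using assms by (intro sum.mono_neutral_left) auto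

lemma series_times_commute: "f \<star> g = g \<star> f"
  unfolding series_times_def
  by (intro ext sum.reindex_bij_witness[of _ prod.swap prod.swap]) (auto simp: add.commute mult.commute)

lemma series_times_nonzero:
  assumes "(f \<star> g) e \<noteq> 0"
  obtains a b where "a + b = e" "f a \<noteq> 0" "g b \<noteq> 0"
proof -
  have "\<exists>x\<in>{(a, b). a + b = e \<and> f a \<noteq> 0 \<and> g b \<noteq> 0}. (case x of (a, b) \<Rightarrow> f a * g b) \<noteq> 0"
    using assms sum.neutral unfolding series_times_def by meson
  then show ?thesis using that by auto
qed

text \<open>
  The terms of the inner product may cancel, and then its coefficient does not occur in the
  definition of the outer one. Summing over the pairs that arise from triples avoids this distinction.
\<close>

lemma series_times_triple:
  assumes "finite {(a, b, c). a + b + c = e \<and> f a \<noteq> 0 \<and> g b \<noteq> 0 \<and> h c \<noteq> 0}"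
  shows "((f \<star> g) \<star> h) e =
    (\<Sum>(a, b, c)\<in>{(a, b, c). a + b + c = e \<and> f a \<noteq> 0 \<and> g b \<noteq> 0 \<and> h c \<noteq> 0}. f a * g b * h c)"
proof -
  let ?T = "{(a, b, c). a + b + c = e \<and> f a \<noteq> 0 \<and> g b \<noteq> 0 \<and> h c \<noteq> 0}"
  let ?S = "(\<lambda>(a, b, c). (a + b, c)) ` ?T"
  let ?R = "\<lambda>s. {(a, b). a + b = s \<and> f a \<noteq> 0 \<and> g b \<noteq> 0}"
  have fin: "finite (?R s)" if "(s, c) \<in> ?S" for s c
    by (rule finite_subset[OF _ finite_imageI[OF assms, of "\<lambda>(a, b, c). (a, b)"]])
      (use that in \<open>force simp: image_iff\<close>)
  have "((f \<star> g) \<star> h) e = (\<Sum>(s, c)\<in>?S. (f \<star> g) s * h c)"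
  proof (rule series_times_superset)
    show "finite ?S" by (intro finite_imageI assms)
    show "?S \<subseteq> {(a, b). a + b = e}" by auto
    fix s c assume "s + c = e" "(f \<star> g) s \<noteq> 0" "h c \<noteq> 0"
    then show "(s, c) \<in> ?S" by (elim series_times_nonzero) force
  qed
  also have "\<dots> = (\<Sum>p\<in>?S. \<Sum>q\<in>?R (fst p). f (fst q) * g (snd q) * h (snd p))"
    by (intro sum.cong) (auto simp: series_times_def sum_distrib_right case_prod_unfold)
  also have "\<dots> = (\<Sum>(p, q)\<in>(SIGMA p:?S. ?R (fst p)). f (fst q) * g (snd q) * h (snd p))"
  proof (rule sum.Sigma)
    show "\<forall>p\<in>?S. finite (?R (fst p))"
    proof
      fix p assume "p \<in> ?S"
      then show "finite (?R (fst p))" using fin[of "fst p" "snd p"] by simp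
    qed
  qed (intro finite_imageI assms)
  also have "\<dots> = (\<Sum>(a, b, c)\<in>?T. f a * g b * h c)"
    by (rule sum.reindex_bij_witness[of _ "\<lambda>(a, b, c). ((a + b, c), (a, b))" "\<lambda>(p, q). (fst q, snd q, snd p)"])
      (force simp: image_iff)+
  finally show ?thesis .
qed

lemma series_times_assoc:
  assumes "tame f" "tame g" "tame h"
  shows "(f \<star> g) \<star> h = f \<star> (g \<star> h)"
proof
  fix e
  note fin = finite_triples[OF assms, of e, unfolded triples_def]
    finite_triples[OF assms(2,3,1), of e, unfolded triples_def]
  have "(f \<star> (g \<star> h)) e = ((g \<star> h) \<star> f) e" by (simp add: series_times_commute)
  also have "\<dots> = ((f \<star> g) \<star> h) e"
    unfolding series_times_triple[OF fin(1)] series_times_triple[OF fin(2)]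
    by (rule sum.reindex_bij_witness[of _ "\<lambda>(a, b, c). (b, c, a)" "\<lambda>(b, c, a). (a, b, c)"])
      (auto simp: ac_simps)
  finally show "((f \<star> g) \<star> h) e = (f \<star> (g \<star> h)) e" ..
qed

lemma tame_times: "tame f \<Longrightarrow> tame g \<Longrightarrow> tame (f \<star> g)"
proof -
  assume "tame f" "tame g"
  then obtain V N W K where "finite V" "finite W"
    "\<And>e. f e \<noteq> 0 \<Longrightarrow> bounded_mono V N e" "\<And>e. g e \<noteq> 0 \<Longrightarrow> bounded_mono W K e"
    unfolding tame_def by metis
  then show ?thesis
    by (intro tameI[of "V \<union> W" _ "N + K"]) (auto elim!: series_times_nonzero intro: bounded_mono_add)
qed

lemma tame_add: "tame f \<Longrightarrow> tame g \<Longrightarrow> tame (\<lambda>e. f e + g e)"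
proof -
  assume "tame f" "tame g"
  then obtain V N W K where *: "finite V" "finite W"
    "\<And>e. f e \<noteq> 0 \<Longrightarrow> bounded_mono V N e" "\<And>e. g e \<noteq> 0 \<Longrightarrow> bounded_mono W K e"
    unfolding tame_def by metis
  show ?thesis
  proof (rule tameI[of "V \<union> W" _ "min N K"])
    fix e assume "f e + g e \<noteq> 0"
    then have "f e \<noteq> 0 \<or> g e \<noteq> 0" by auto
    then show "bounded_mono (V \<union> W) (min N K) e"
      using *(3,4)[of e] by (auto intro: bounded_mono_mono)
  qed (use * in auto)
qed

lemma tame_uminus: "tame f \<Longrightarrow> tame (\<lambda>e. - f e)"
  by (simp add: tame_def)

lemma series_times_add_left:
  assumes "tame f" "tame g" "tame h"
  shows "((\<lambda>e. f e + g e) \<star> h) e = (f \<star> h) e + (g \<star> h) e"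
proof -
  let ?S = "{(a, b). a + b = e \<and> f a \<noteq> 0 \<and> h b \<noteq> 0} \<union> {(a, b). a + b = e \<and> g a \<noteq> 0 \<and> h b \<noteq> 0}"
  have "finite ?S" using finite_pairs assms by blast
  then have "(k \<star> h) e = (\<Sum>(a, b)\<in>?S. k a * h b)" if "\<And>a. k a \<noteq> 0 \<Longrightarrow> f a \<noteq> 0 \<or> g a \<noteq> 0" for k
    by (rule series_times_superset) (use that in auto)
  note eq = this
  have "((\<lambda>e. f e + g e) \<star> h) e = (\<Sum>(a, b)\<in>?S. (f a + g a) * h b)"
    by (rule eq) auto
  also have "\<dots> = (\<Sum>(a, b)\<in>?S. f a * h b) + (\<Sum>(a, b)\<in>?S. g a * h b)"
    by (simp add: sum.distrib[symmetric] case_prod_unfold distrib_right)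
  also have "\<dots> = (f \<star> h) e + (g \<star> h) e"
    by (subst (1 2) eq) auto
  finally show ?thesis .
qed

lemma one_series_times: "one_series \<star> f = f"
proof
  fix e
  have "(one_series \<star> f) e = (\<Sum>(a, b)\<in>{(0, e)}. one_series a * f b)"
    by (rule series_times_superset) (auto simp: one_series_def split: if_splits)
  then show "(one_series \<star> f) e = f e" by (simp add: one_series_def)
qed

text \<open>On these series the partial product of formal series is total, and they form a ring.\<close>

typedef tame_series = "{f. tame f}"
  morphisms coef Abs_tame
  by (rule exI[of _ one_series]) (simp add: tame_one)

setup_lifting type_definition_tame_series

instantiation tame_series :: comm_ring_1
begin

lift_definition zero_tame_series :: tame_series is "\<lambda>_. 0" by (rule tameI[of "{}"]) auto
lift_definition one_tame_series :: tame_series is one_series by (rule tame_one)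
lift_definition plus_tame_series :: "tame_series \<Rightarrow> tame_series \<Rightarrow> tame_series"
  is "\<lambda>f g e. f e + g e" by (rule tame_add)
lift_definition uminus_tame_series :: "tame_series \<Rightarrow> tame_series"
  is "\<lambda>f e. - f e" by (rule tame_uminus)
lift_definition minus_tame_series :: "tame_series \<Rightarrow> tame_series \<Rightarrow> tame_series"
  is "\<lambda>f g e. f e + - g e" by (intro tame_add tame_uminus)
lift_definition times_tame_series :: "tame_series \<Rightarrow> tame_series \<Rightarrow> tame_series"
  is "(\<star>)" by (rule tame_times)

instance
proof
  fix a b c :: tame_series
  show "a * b * c = a * (b * c)" by transfer (rule series_times_assoc)
  show "a * b = b * a" by transfer (rule series_times_commute)
  show "1 * a = a" by transfer (rule one_series_times)
  show "(a + b) * c = a * c + b * c" by transfer (rule ext, rule series_times_add_left)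
  show "a + b + c = a + (b + c)" by transfer (simp add: add.assoc)
  show "a + b = b + a" by transfer (simp add: add.commute)
  show "0 + a = a" by transfer simp
  show "- a + a = 0" by transfer simp
  show "a - b = a + - b" by transfer simp
  show "(0 :: tame_series) \<noteq> 1"
  proof transfer
    show "(\<lambda>_. 0) \<noteq> one_series" by (rule notI, drule fun_cong[of _ _ 0]) (simp add: one_series_def)
  qed
qed

end


lemma coef_simps [simp]:
  "coef 0 e = 0" "coef (f + g) e = coef f e + coef g e" "coef (- f) e = - coef f e"
  "coef (f - g) e = coef f e - coef g e"
  by (transfer, simp)+

lemma coef_one: "coef 1 = one_series" and coef_times: "coef (f * g) = coef f \<star> coef g"
  by (transfer, simp)+

lemma coef_eqI: "coef f = coef g \<Longrightarrow> f = g"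
  by (simp add: coef_inject)

lemma tame_coef: "tame (coef f)"
  using coef[of f] by simp

lift_definition Var :: "res_var \<Rightarrow> tame_series" is "\<lambda>u e. if e = single u 1 then 1 else 0"
  subgoal for u
    by (rule tameI[of "{u}" _ "- 1"])
      (use orient_cases[of u] in \<open>auto simp: bounded_mono_def lookup_single when_def split: if_splits\<close>)
  done

lift_definition const :: "complex \<Rightarrow> tame_series" is "\<lambda>c e. c * one_series e"
  subgoal for c
    by (rule tameI[of "{}" _ 0]) (auto simp: one_series_def bounded_mono_def split: if_splits)
  done

lemma coef_Var_times: "coef (Var u * f) e = coef f (e - single u 1)"
proof -
  have "coef (Var u * f) e = (\<Sum>(a, b)\<in>{(single u 1, e - single u 1)}. coef (Var u) a * coef f b)"
    unfolding coef_times
    by (rule series_times_superset) (auto simp: Var.rep_eq split: if_splits)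
  then show ?thesis by (simp add: Var.rep_eq)
qed

lemma coef_const_times: "coef (const c * f) e = c * coef f e"
proof -
  have "coef (const c * f) e = (\<Sum>(a, b)\<in>{(0, e)}. coef (const c) a * coef f b)"
    unfolding coef_times
    by (rule series_times_superset) (auto simp: const.rep_eq one_series_def split: if_splits)
  then show ?thesis by (simp add: const.rep_eq one_series_def)
qed

lemma coef_diff_times: "coef ((Var u - Var v) * f) = diff_mult u v (coef f)"
  by (rule ext) (simp add: left_diff_distrib coef_Var_times diff_mult_def)

lemma coef_diff: "coef (Var u - Var v) = diff_series u v"
  by (rule ext) (simp add: Var.rep_eq diff_series_def)

definition diff_prod :: "(res_var \<times> res_var) list \<Rightarrow> tame_series" where
  "diff_prod ps = (\<Prod>(u, v)\<leftarrow>ps. Var u - Var v)"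

lemma coef_diff_prod_times: "coef (diff_prod ps * f) = diff_mults ps (coef f)"
proof (induction ps)
  case (Cons p ps)
  obtain u v where "p = (u, v)" by fastforce
  then show ?case
    using Cons by (simp add: diff_prod_def mult.assoc coef_diff_times)
qed (simp add: diff_prod_def)

lemma coef_diff_prod: "coef (diff_prod ps) = diff_mults ps one_series"
  using coef_diff_prod_times[of ps 1] by (simp add: coef_one)

lemma diff_prod_simps [simp]:
  "diff_prod [] = 1" "diff_prod ((u, v) # ps) = (Var u - Var v) * diff_prod ps"
  "diff_prod (ps @ qs) = diff_prod ps * diff_prod qs"
  by (simp_all add: diff_prod_def)

lemma diff_prod_mset: "mset ps = mset qs \<Longrightarrow> diff_prod ps = diff_prod qs"
  by (rule coef_eqI) (simp only: coef_diff_prod, rule diff_mults_mset)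

lemma coef_vandermonde: "coef (diff_prod (pairs us) * diff_prod (pairs vs)) = vandermonde us vs"
  unfolding diff_prod_simps(3)[symmetric] coef_diff_prod vandermonde_def ..


subsection \<open>The inverse of a difference\<close>

lemma tame_inv_diff: "tame (inv_diff_series (x_var i) (z_var j))"
proof (rule tameI[of "{x_var i, z_var j}" _ 0])
  fix e assume "inv_diff_series (x_var i) (z_var j) e \<noteq> 0"
  then obtain n where e: "e = single (x_var i) (- int n - 1) + single (z_var j) (int n)"
    by (auto simp: inv_diff_series_def split: if_splits)
  have "keys e \<subseteq> keys (single (x_var i) (- int n - 1)) \<union> keys (single (z_var j) (int n))"
    unfolding e by (rule keys_add)
  also have "\<dots> \<subseteq> {x_var i, z_var j}" by auto
  finally show "bounded_mono {x_var i, z_var j} 0 e"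
    by (auto simp: bounded_mono_def e lookup_add lookup_single when_def)
qed simp

lift_definition inv_diff :: "nat \<Rightarrow> nat \<Rightarrow> tame_series" is "\<lambda>i j. inv_diff_series (x_var i) (z_var j)"
  subgoal for i j
    by (rule tame_inv_diff)
  done

text \<open>The two geometric series differ only in the term of exponent \<open>0\<close>.\<close>

lemma diff_times_inv_diff: "(Var (x_var i) - Var (z_var j)) * inv_diff i j = 1"
proof (rule coef_eqI, rule ext)
  fix e :: res_mono
  let ?x = "x_var i" and ?z = "z_var j"
  let ?m = "\<lambda>n. single ?x (- int n) + single ?z (int n)"
  have x: "coef (inv_diff i j) (e - single ?x 1) = (if \<exists>n. e = ?m n then 1 else 0)"
  proof -
    have "e - single ?x 1 = single ?x (- int n - 1) + single ?z (int n) \<longleftrightarrow> e = ?m n" for n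
      by (simp add: single_diff diff_eq_eq)
    then show ?thesis by (simp add: inv_diff.rep_eq inv_diff_series_def)
  qed
  have z: "coef (inv_diff i j) (e - single ?z 1) = (if \<exists>n. e = ?m (Suc n) then 1 else 0)"
  proof -
    have suc: "single ?z (int (Suc n)) = single ?z (int n) + single ?z 1"
        "- int (Suc n) = - int n - 1" for n
      by (simp_all add: add.commute flip: single_add)
    have "e - single ?z 1 = single ?x (- int n - 1) + single ?z (int n) \<longleftrightarrow> e = ?m (Suc n)" for n
      by (simp only: suc diff_eq_eq add.assoc)
    then show ?thesis by (simp add: inv_diff.rep_eq inv_diff_series_def)
  qed
  have inj: "?m n = ?m k \<longleftrightarrow> n = k" for n k
  proof
    assume "?m n = ?m k"
    then have "lookup (?m n) ?z = lookup (?m k) ?z" by simp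
    then show "n = k" by (simp add: lookup_add lookup_single)
  qed simp
  have "(\<exists>n. e = ?m n) \<longleftrightarrow> e = ?m 0 \<or> (\<exists>n. e = ?m (Suc n))"
    by (metis not0_implies_Suc)
  moreover have "e = ?m 0 \<Longrightarrow> \<not> (\<exists>n. e = ?m (Suc n))" using inj by blast
  ultimately have "coef ((Var ?x - Var ?z) * inv_diff i j) e = (if e = ?m 0 then 1 else 0)"
    unfolding coef_diff_times diff_mult_def x z by auto
  then show "coef ((Var ?x - Var ?z) * inv_diff i j) e = coef 1 e"
    by (simp add: coef_one one_series_def)
qed


subsection \<open>Products over finite index sets\<close>

text \<open>This reduces products over index sets to products of two series.\<close>

lemma series_prod_insert:
  fixes f :: "'a \<Rightarrow> 'b :: comm_monoid_add \<Rightarrow> complex"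
  assumes "finite I" "i \<notin> I"
    and fin: "finite {\<phi> \<in> Pi\<^sub>E (insert i I) (\<lambda>i. {a. f i a \<noteq> 0}). (\<Sum>i\<in>insert i I. \<phi> i) = e}"
  shows "series_prod (insert i I) f e = (f i \<star> series_prod I f) e"
proof -
  let ?F = "\<lambda>e. {\<phi> \<in> Pi\<^sub>E I (\<lambda>i. {a. f i a \<noteq> 0}). (\<Sum>i\<in>I. \<phi> i) = e}"
  let ?G = "{\<phi> \<in> Pi\<^sub>E (insert i I) (\<lambda>i. {a. f i a \<noteq> 0}). (\<Sum>i\<in>insert i I. \<phi> i) = e}"
  let ?P = "{(a, \<phi>). f i a \<noteq> 0 \<and> \<phi> \<in> Pi\<^sub>E I (\<lambda>i. {a. f i a \<noteq> 0}) \<and> a + (\<Sum>i\<in>I. \<phi> i) = e}"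
  let ?S = "(\<lambda>(a, \<phi>). (a, \<Sum>i\<in>I. \<phi> i)) ` ?P"
  have sum_upd: "(\<Sum>j\<in>I. (\<phi>(i := a)) j) = (\<Sum>j\<in>I. \<phi> j)" for \<phi> :: "'a \<Rightarrow> 'b" and a
    using assms(2) by (intro sum.cong) auto
  have restr: "(\<Sum>j\<in>I. restrict \<phi> I j) = (\<Sum>j\<in>I. \<phi> j)" for \<phi> :: "'a \<Rightarrow> 'b"
    by (intro sum.cong) auto
  have P_eq: "?P = (\<lambda>\<phi>. (\<phi> i, restrict \<phi> I)) ` ?G"
  proof (intro set_eqI iffI)
    fix p assume "p \<in> ?P"
    then obtain a \<phi> where p: "p = (a, \<phi>)" "f i a \<noteq> 0" "\<phi> \<in> Pi\<^sub>E I (\<lambda>i. {a. f i a \<noteq> 0})"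
      "a + (\<Sum>i\<in>I. \<phi> i) = e" by auto
    have "\<phi>(i := a) \<in> Pi\<^sub>E (insert i I) (\<lambda>i. {a. f i a \<noteq> 0})"
      using p by (auto simp: PiE_iff extensional_def)
    moreover have "(\<Sum>j\<in>insert i I. (\<phi>(i := a)) j) = e"
      using p(4) assms(1,2) sum_upd[of \<phi> a] by (simp add: fun_upd_same del: fun_upd_apply)
    ultimately have "\<phi>(i := a) \<in> ?G" by simp
    moreover have "restrict (\<phi>(i := a)) I = \<phi>"
      using p(3) assms(2) by (auto simp: PiE_iff extensional_def restrict_def)
    ultimately show "p \<in> (\<lambda>\<phi>. (\<phi> i, restrict \<phi> I)) ` ?G"
      using p(1) by (intro image_eqI[of _ _ "\<phi>(i := a)"]) auto
  next
    fix p assume "p \<in> (\<lambda>\<phi>. (\<phi> i, restrict \<phi> I)) ` ?G"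
    then show "p \<in> ?P" using assms restr by (auto simp: PiE_iff)
  qed
  have finP: "finite ?P" unfolding P_eq using fin by (rule finite_imageI)
  have finF: "finite (?F s)" if "(a, s) \<in> ?S" for a s
  proof (rule finite_subset[OF _ finite_imageI[OF finP, of snd]])
    show "?F s \<subseteq> snd ` ?P" using that by (force simp: image_iff)
  qed
  have "(f i \<star> series_prod I f) e = (\<Sum>(a, s)\<in>?S. f i a * series_prod I f s)"
  proof (rule series_times_superset)
    show "finite ?S" by (intro finite_imageI finP)
    show "?S \<subseteq> {(a, s). a + s = e}" by auto
    fix a s assume *: "a + s = e" "f i a \<noteq> 0" "series_prod I f s \<noteq> 0"
    then have "?F s \<noteq> {}" unfolding series_prod_def by (metis sum.empty)
    then show "(a, s) \<in> ?S" using * by force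
  qed
  also have "\<dots> = (\<Sum>p\<in>?S. \<Sum>\<phi>\<in>?F (snd p). f i (fst p) * (\<Prod>i\<in>I. f i (\<phi> i)))"
    by (intro sum.cong) (auto simp: series_prod_def sum_distrib_left)
  also have "\<dots> = (\<Sum>(p, \<phi>)\<in>(SIGMA p:?S. ?F (snd p)). f i (fst p) * (\<Prod>i\<in>I. f i (\<phi> i)))"
  proof (rule sum.Sigma[OF finite_imageI[OF finP]], rule ballI)
    fix p assume "p \<in> ?S"
    then show "finite (?F (snd p))" using finF[of "fst p" "snd p"] by simp
  qed
  also have "\<dots> = (\<Sum>(a, \<phi>)\<in>?P. f i a * (\<Prod>i\<in>I. f i (\<phi> i)))"
    by (rule sum.reindex_bij_witness[of _ "\<lambda>(a, \<phi>). ((a, \<Sum>i\<in>I. \<phi> i), \<phi>)" "\<lambda>(p, \<phi>). (fst p, \<phi>)"])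
      (force simp: image_iff)+
  also have "\<dots> = (\<Sum>\<phi>\<in>?G. f i (\<phi> i) * (\<Prod>j\<in>I. f j (restrict \<phi> I j)))"
  proof -
    have "inj_on (\<lambda>\<phi>. (\<phi> i, restrict \<phi> I)) ?G"
    proof (rule inj_onI)
      fix \<phi> \<psi> assume *: "\<phi> \<in> ?G" "\<psi> \<in> ?G" "(\<phi> i, restrict \<phi> I) = (\<psi> i, restrict \<psi> I)"
      then have "\<phi> j = \<psi> j" if "j \<in> insert i I" for j
        using that by (auto dest: fun_cong[of _ _ j] simp: restrict_def split: if_splits)
      then show "\<phi> = \<psi>" using * by (intro PiE_ext[of \<phi> "insert i I" _ \<psi>]) auto
    qed
    then show ?thesis unfolding P_eq by (simp add: sum.reindex)
  qed
  also have "\<dots> = series_prod (insert i I) f e"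
    unfolding series_prod_def using assms by (intro sum.cong prod.cong) (auto intro!: prod.cong)
  finally show ?thesis ..
qed

lemma finite_prod_support:
  assumes "finite I" "\<And>i. i \<in> I \<Longrightarrow> tame (f i)"
  shows "finite {\<phi> \<in> Pi\<^sub>E I (\<lambda>i. {a. f i a \<noteq> 0}). (\<Sum>i\<in>I. \<phi> i) = e}" (is "finite ?G")
proof -
  from assms(2) have "\<exists>V N. finite V \<and> (\<forall>e. f i e \<noteq> 0 \<longrightarrow> bounded_mono V N e)" if "i \<in> I" for i
    using that by (auto simp: tame_def)
  then obtain V N where VN: "\<And>i. i \<in> I \<Longrightarrow> finite (V i)"
      "\<And>i e. i \<in> I \<Longrightarrow> f i e \<noteq> 0 \<Longrightarrow> bounded_mono (V i) (N i) e"
    by metis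
  let ?h = "\<lambda>i v. orient v * lookup e v - (\<Sum>j\<in>I - {i}. N j)"
  let ?B = "\<lambda>i. {a. bounded_mono (V i) (N i) a \<and> (\<forall>v. orient v * lookup a v \<le> ?h i v)}"
  have "?G \<subseteq> Pi\<^sub>E I ?B"
  proof
    fix \<phi> assume G: "\<phi> \<in> ?G"
    have "\<phi> i \<in> ?B i" if i: "i \<in> I" for i
    proof -
      have b: "bounded_mono (V j) (N j) (\<phi> j)" if "j \<in> I" for j
        using G that by (intro VN(2)) (auto simp: PiE_iff)
      have "orient v * lookup (\<phi> i) v \<le> ?h i v" for v
      proof -
        have "orient v * lookup e v = (\<Sum>j\<in>I. orient v * lookup (\<phi> j) v)"
          using G by (auto simp: lookup_sum sum_distrib_left)
        also have "\<dots> = orient v * lookup (\<phi> i) v + (\<Sum>j\<in>I - {i}. orient v * lookup (\<phi> j) v)"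
          using assms(1) i by (rule sum.remove)
        finally have "orient v * lookup e v =
          orient v * lookup (\<phi> i) v + (\<Sum>j\<in>I - {i}. orient v * lookup (\<phi> j) v)" .
        moreover have "(\<Sum>j\<in>I - {i}. N j) \<le> (\<Sum>j\<in>I - {i}. orient v * lookup (\<phi> j) v)"
          using b by (intro sum_mono) (auto simp: bounded_mono_def)
        ultimately show ?thesis by linarith
      qed
      then show ?thesis using b[OF i] by simp
    qed
    then show "\<phi> \<in> Pi\<^sub>E I ?B" using G by (auto simp: PiE_iff)
  qed
  then show ?thesis
    by (rule finite_subset) (intro finite_PiE assms(1) finite_bounded_interval VN(1))
qed

lemma series_prod_empty: "series_prod {} f = (\<lambda>e. if e = 0 then 1 else 0)"
proof
  fix e
  have "{\<phi> \<in> Pi\<^sub>E {} (\<lambda>i. {a. f i a \<noteq> 0}). (\<Sum>i\<in>{}. \<phi> i) = e} = (if e = 0 then {\<lambda>_. undefined} else {})"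
    by auto
  then show "series_prod {} f e = (if e = 0 then 1 else 0)" by (simp add: series_prod_def)
qed

lemma series_prod_coef:
  assumes "finite I"
  shows "series_prod I (\<lambda>i. coef (g i)) = coef (\<Prod>i\<in>I. g i)"
  using assms
proof (induction I)
  case empty
  show ?case by (auto simp: series_prod_empty coef_one one_series_def)
next
  case (insert i I)
  have "series_prod (insert i I) (\<lambda>i. coef (g i)) e =
      (coef (g i) \<star> series_prod I (\<lambda>i. coef (g i))) e" for e
    by (rule series_prod_insert[OF insert(1,2)]) (rule finite_prod_support, use insert(1) tame_coef in auto)
  then show ?case using insert by (auto simp: coef_times)
qed


lemma coef_triple:
  "coef (f * g * h) e = (\<Sum>(a, b, c)\<in>{(a, b, c). a + b + c = e \<and> coef f a \<noteq> 0 \<and> coef g b \<noteq> 0 \<and> coef h c \<noteq> 0}.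
    coef f a * coef g b * coef h c)"
  unfolding coef_times
  by (rule series_times_triple) (rule finite_triples[OF tame_coef tame_coef tame_coef, unfolded triples_def])

definition supported :: "res_var set \<Rightarrow> tame_series \<Rightarrow> bool" where
  "supported V f \<longleftrightarrow> (\<forall>e. coef f e \<noteq> 0 \<longrightarrow> keys e \<subseteq> V)"

lemma supported_times: "supported V f \<Longrightarrow> supported V g \<Longrightarrow> supported V (f * g)"
  unfolding supported_def coef_times
proof (intro allI impI)
  fix e assume *: "\<forall>e. coef f e \<noteq> 0 \<longrightarrow> keys e \<subseteq> V" "\<forall>e. coef g e \<noteq> 0 \<longrightarrow> keys e \<subseteq> V"
    and "(coef f \<star> coef g) e \<noteq> 0"
  then obtain a b where "a + b = e" "coef f a \<noteq> 0" "coef g b \<noteq> 0" by (elim series_times_nonzero)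
  then show "keys e \<subseteq> V" using * keys_add[of a b] by blast
qed

lemma supported_one: "supported V 1"
  by (auto simp: supported_def coef_one one_series_def split: if_splits)

lemma supported_prod: "(\<And>i. i \<in> I \<Longrightarrow> supported V (f i)) \<Longrightarrow> supported V (\<Prod>i\<in>I. f i)"
  by (induction I rule: infinite_finite_induct) (auto intro: supported_one supported_times)

lemma supported_inv_diff: "x_var i \<in> V \<Longrightarrow> z_var j \<in> V \<Longrightarrow> supported V (inv_diff i j)"
  unfolding supported_def
proof (intro allI impI)
  fix e assume *: "x_var i \<in> V" "z_var j \<in> V" and "coef (inv_diff i j) e \<noteq> 0"
  then obtain n where e: "e = single (x_var i) (- int n - 1) + single (z_var j) (int n)"
    by (auto simp: inv_diff.rep_eq inv_diff_series_def split: if_splits)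
  have "keys e \<subseteq> keys (single (x_var i) (- int n - 1)) \<union> keys (single (z_var j) (int n))"
    unfolding e by (rule keys_add)
  also have "\<dots> \<subseteq> V" using * by auto
  finally show "keys e \<subseteq> V" .
qed

lemma supported_pairs: "set us \<subseteq> V \<Longrightarrow> supported V (diff_prod (pairs us))"
  using vandermonde_keys[of us "[]"] coef_vandermonde[of us "[]"]
  by (fastforce simp: supported_def)


subsection \<open>The rational function as an element of the ring\<close>

abbreviation xvars :: "nat \<Rightarrow> res_var list" where "xvars n \<equiv> map x_var [1..<Suc n]"
abbreviation yvars :: "nat \<Rightarrow> res_var list" where "yvars n \<equiv> map y_var [1..<Suc n]"
abbreviation zvars :: "nat \<Rightarrow> res_var list" where "zvars n \<equiv> map z_var [1..<Suc n]"

definition inv_cross :: "nat \<Rightarrow> nat \<Rightarrow> tame_series" where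
  "inv_cross nc ne = (\<Prod>(i, j)\<in>{1..nc} \<times> {1..ne}. inv_diff i j)"

lemma distinct_pairs: "distinct us \<Longrightarrow> distinct (pairs us)"
  using set_pairs by (induction us) (fastforce simp: distinct_map inj_on_def)+

lemma set_pairs_upt: "set (pairs [m..<n]) = {(i, j). m \<le> i \<and> i < j \<and> j < n}"
proof (induction "n - m" arbitrary: m)
  case (Suc k)
  then have "[m..<n] = m # [Suc m..<n]" by (intro upt_conv_Cons) simp
  then show ?case using Suc(1)[of "Suc m"] Suc(2) by auto
qed auto

lemma diff_prod_map_pairs:
  "diff_prod (pairs (map v [1..<Suc n])) =
    (\<Prod>(i, j)\<in>{(i, j). 1 \<le> i \<and> i < j \<and> j \<le> n}. Var (v i) - Var (v j))"
proof -
  have "set (pairs [1..<Suc n]) = {(i, j). 1 \<le> i \<and> i < j \<and> j \<le> n}"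
    unfolding set_pairs_upt by auto
  then show ?thesis
    using prod.distinct_set_conv_list[OF distinct_pairs[of "[1..<Suc n]"],
        of "\<lambda>(i, j). Var (v i) - Var (v j)"]
    by (simp add: diff_prod_def pairs_map case_prod_unfold comp_def map_prod_def del: upt_Suc)
qed

lemma diff_prod_product:
  "diff_prod (List.product (map u [1..<Suc m]) (map v [1..<Suc n])) =
    (\<Prod>(i, j)\<in>{1..m} \<times> {1..n}. Var (u i) - Var (v j))"
proof -
  have "List.product (map u as) (map v bs) = map (map_prod u v) (List.product as bs)" for as bs
    by (induction as) auto
  moreover have "distinct (List.product [1..<Suc m] [1..<Suc n])"
    by (rule distinct_product) auto
  moreover have "set (List.product [1..<Suc m] [1..<Suc n]) = {1..m} \<times> {1..n}"
    by (simp add: atLeastLessThanSuc_atLeastAtMost del: upt_Suc)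
  ultimately show ?thesis
    using prod.distinct_set_conv_list[of "List.product [1..<Suc m] [1..<Suc n]"
        "\<lambda>(i, j). Var (u i) - Var (v j)"]
    by (simp add: diff_prod_def case_prod_unfold comp_def map_prod_def del: upt_Suc)
qed

lemma diff_prod_pairs_append:
  "diff_prod (pairs (as @ bs)) = diff_prod (pairs as) * diff_prod (List.product as bs) * diff_prod (pairs bs)"
  unfolding diff_prod_simps(3)[symmetric] by (rule diff_prod_mset) (simp add: pairs_append)

lemma discriminant_eq:
  "discriminant v n = coef (diff_prod (pairs (map v [1..<Suc n])) * diff_prod (pairs (map v [1..<Suc n])))"
proof -
  have fin: "finite {(i, j). 1 \<le> i \<and> i < j \<and> j \<le> n}"
    by (rule finite_subset[of _ "{1..n} \<times> {1..n}"]) auto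
  have "discriminant v n = series_prod {(i, j). 1 \<le> i \<and> i < j \<and> j \<le> n}
     (\<lambda>p. coef ((\<lambda>(i, j). (Var (v i) - Var (v j)) * (Var (v i) - Var (v j))) p))"
    unfolding discriminant_def
    by (simp add: case_prod_unfold coef_times coef_diff)
  also have "\<dots> = coef (\<Prod>(i, j)\<in>{(i, j). 1 \<le> i \<and> i < j \<and> j \<le> n}.
      (Var (v i) - Var (v j)) * (Var (v i) - Var (v j)))"
    by (rule series_prod_coef[OF fin])
  finally show ?thesis
    unfolding diff_prod_map_pairs prod.distrib[symmetric] by (simp add: case_prod_unfold)
qed

text \<open>
  The rational function regrouped by components: \<open>\<psi>\<^sub>2\<^sup>+\<close> occurs at the \<open>y\<close> and \<open>z\<close>, \<open>\<psi>\<^sub>1\<^sup>+\<close> at the \<open>x\<close> and \<open>\<psi>\<^sub>1\<^sup>-\<close> at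
  the \<open>z\<close>, and \<open>\<psi>\<^sub>0\<^sup>-\<close> at the \<open>x\<close> and \<open>y\<close>. Each square of a difference comes from two components.
\<close>

lemma p_series_eq:
  "p_series nc nd ne =
    coef (diff_prod (pairs (yvars nd @ zvars ne)) *
      (diff_prod (pairs (xvars nc)) * diff_prod (pairs (zvars ne)) * inv_cross nc ne) *
      diff_prod (pairs (xvars nc @ yvars nd)))"
proof -
  have cross: "series_prod ({1..m} \<times> {1..n}) (\<lambda>(i, j). diff_series (u i) (v j)) =
      coef (diff_prod (List.product (map u [1..<Suc m]) (map v [1..<Suc n])))" for m n u v
  proof -
    have "series_prod ({1..m} \<times> {1..n}) (\<lambda>(i, j). diff_series (u i) (v j)) =
        series_prod ({1..m} \<times> {1..n}) (\<lambda>p. coef ((\<lambda>(i, j). Var (u i) - Var (v j)) p))"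
      by (simp add: case_prod_unfold coef_diff)
    also have "\<dots> = coef (\<Prod>(i, j)\<in>{1..m} \<times> {1..n}. Var (u i) - Var (v j))"
      by (rule series_prod_coef) simp
    finally show ?thesis unfolding diff_prod_product .
  qed
  have inv: "series_prod ({1..nc} \<times> {1..ne}) (\<lambda>(i, j). inv_diff_series (x_var i) (z_var j)) =
      coef (inv_cross nc ne)"
  proof -
    have "series_prod ({1..nc} \<times> {1..ne}) (\<lambda>(i, j). inv_diff_series (x_var i) (z_var j)) =
        series_prod ({1..nc} \<times> {1..ne}) (\<lambda>p. coef ((\<lambda>(i, j). inv_diff i j) p))"
      by (simp add: case_prod_unfold inv_diff.rep_eq)
    also have "\<dots> = coef (inv_cross nc ne)"
      unfolding inv_cross_def by (rule series_prod_coef) simp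
    finally show ?thesis .
  qed
  show ?thesis
    unfolding p_series_def discriminant_eq cross inv coef_times[symmetric] diff_prod_pairs_append
    by (simp only: mult.assoc mult.commute mult.left_commute)
qed

lemma cross_times_inv_cross:
  "diff_prod (List.product (xvars nc) (zvars ne)) * inv_cross nc ne = 1"
  unfolding diff_prod_product inv_cross_def prod.distrib[symmetric]
  by (rule prod.neutral) (auto simp: diff_times_inv_diff)

lemma supported_inv_cross: "supported (set (xvars nc) \<union> set (zvars ne)) (inv_cross nc ne)"
  unfolding inv_cross_def
  by (intro supported_prod) (auto intro!: supported_inv_diff)


section \<open>Correlators of three components\<close>

declare upt_Suc [simp del]

text \<open>
  A product of operators of other components passes the operators of the component \<open>a\<close> with a sign
  that depends only on the number of its factors.
\<close>

definition crosses :: "3 \<Rightarrow> (fock \<Rightarrow> fock) \<Rightarrow> bool" where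
  "crosses a B \<longleftrightarrow> lin B \<and> (\<exists>s. s * s = 1 \<and>
     (\<forall>p w. B (P a p w) = scale s (P a p (B w)) \<and> B (M a p w) = scale s (M a p (B w))))"

lemma crosses_lin: "crosses a B \<Longrightarrow> lin B"
  by (simp add: crosses_def)

lemma crosses_comp: "crosses a A \<Longrightarrow> crosses a B \<Longrightarrow> crosses a (\<lambda>w. A (B w))"
proof -
  assume AB: "crosses a A" "crosses a B"
  then obtain s t where s: "s * s = 1" and t: "t * t = 1"
    and A: "\<And>p w. A (P a p w) = scale s (P a p (A w))" "\<And>p w. A (M a p w) = scale s (M a p (A w))"
    and B: "\<And>p w. B (P a p w) = scale t (P a p (B w))" "\<And>p w. B (M a p w) = scale t (M a p (B w))"
    unfolding crosses_def by blast
  have "(t * s) * (t * s) = 1" using s t by (metis mult.assoc mult.commute mult_1)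
  then show ?thesis
    unfolding crosses_def
    using lin_comp[of A B] crosses_lin[OF AB(1)] crosses_lin[OF AB(2)]
    by (auto simp: A B lin_scale[OF crosses_lin[OF AB(1)]] intro!: exI[of _ "t * s"])
qed

lemma sign_square: "((- 1) ^ n) * ((- 1) ^ n) = (1 :: complex)"
  by (simp flip: power_mult_distrib)

lemma crosses_foldr:
  assumes "\<And>x. lin (f x)" "\<And>x p v. f x (P a p v) = - P a p (f x v)" "\<And>x p v. f x (M a p v) = - M a p (f x v)"
  shows "crosses a (foldr f xs)"
  unfolding crosses_def
proof (intro conjI exI[of _ "(- 1) ^ length xs"] allI)
  show "lin (foldr f xs)" by (rule lin_foldr) (rule assms(1))
  show "(- 1) ^ length xs * (- 1) ^ length xs = (1 :: complex)" by (rule sign_square)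
  fix p w
  show "foldr f xs (P a p w) = scale ((- 1) ^ length xs) (P a p (foldr f xs w))"
    by (rule foldr_anticommute) (rule assms(1), rule assms(2), rule lin_P)
  show "foldr f xs (M a p w) = scale ((- 1) ^ length xs) (M a p (foldr f xs w))"
    by (rule foldr_anticommute) (rule assms(1), rule assms(3), rule lin_M)
qed

lemma crosses_foldr_P: "a \<noteq> b \<Longrightarrow> crosses a (foldr (P b) ps)"
  and crosses_foldr_M: "a \<noteq> b \<Longrightarrow> crosses a (foldr (M b) ps)"
  by (rule crosses_foldr; simp add: lin_P lin_M P_P[of b] M_M[of b] P_M[of b] M_P[of b])+

lemma crosses_id: "crosses a (\<lambda>w. w)"
  unfolding crosses_def using lin_id by (auto intro!: exI[of _ 1])

text \<open>The vector looks like the vacuum to the component \<open>a\<close>.\<close>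

definition annihilated :: "3 \<Rightarrow> fock \<Rightarrow> bool" where
  "annihilated a \<kappa> \<longleftrightarrow> (\<forall>p<0. P a p \<kappa> = 0 \<and> M a p \<kappa> = 0)"

lemma annihilated_vac: "annihilated a vac"
  by (simp add: annihilated_def psi_plus_field_def psi_minus_field_def psi_plus_def psi_minus_def
      vac_def wedging_wedge_vec contraction_wedge_vec vac_set_def)

lemma annihilated_crosses:
  assumes "crosses a B" "annihilated a \<kappa>"
  shows "annihilated a (B \<kappa>)"
proof -
  obtain s where s: "s * s = 1"
    and B: "\<And>p w. B (P a p w) = scale s (P a p (B w))" "\<And>p w. B (M a p w) = scale s (M a p (B w))"
    using assms(1) unfolding crosses_def by blast
  have "s \<noteq> 0" using s by auto
  moreover have "B 0 = 0" using lin_zero[OF crosses_lin[OF assms(1)]] .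
  ultimately show ?thesis
    unfolding annihilated_def using assms(2) B
    by (metis annihilated_def fock.scale_eq_0_iff)
qed

text \<open>The functional looks like the pairing with the vacuum of charge \<open>c a\<close> to each component \<open>a\<close>.\<close>

definition bra :: "(3 \<Rightarrow> int) \<Rightarrow> (fock \<Rightarrow> complex) \<Rightarrow> bool" where
  "bra c \<beta> \<longleftrightarrow> module_hom scale (*) \<beta> \<and>
     (\<forall>a p w. c a \<le> p \<longrightarrow> \<beta> (P a p w) = 0) \<and> (\<forall>a p w. - c a \<le> p \<longrightarrow> \<beta> (M a p w) = 0)"

lemma charged_functional_crosses:
  assumes \<beta>: "bra c \<beta>" and B: "crosses a B" and \<kappa>: "annihilated a \<kappa>"
  shows "charged_functional a (\<lambda>w. \<beta> (B w)) \<kappa> (c a)"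
proof (rule charged_functional.intro)
  have h: "module_hom scale (*) \<beta>" using \<beta> by (simp add: bra_def)
  note [simp] = module_hom.add[OF h] module_hom.scale[OF h]
  obtain s where
    B': "\<And>p w. B (P a p w) = scale s (P a p (B w))" "\<And>p w. B (M a p w) = scale s (M a p (B w))"
    using B unfolding crosses_def by blast
  show "module_hom scale (*) (\<lambda>w. \<beta> (B w))"
    by (rule functionalI) (simp_all add: lin_add[OF crosses_lin[OF B]] lin_scale[OF crosses_lin[OF B]])
  show "\<beta> (B (P a p w)) = 0" if "c a \<le> p" for p w
    using that \<beta> by (simp add: B' bra_def)
  show "\<beta> (B (M a p w)) = 0" if "- c a \<le> p" for p w
    using that \<beta> by (simp add: B' bra_def)
qed (use \<kappa> in \<open>auto simp: annihilated_def\<close>)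

lift_definition restr :: "res_var set \<Rightarrow> res_mono \<Rightarrow> res_mono" is "\<lambda>U f v. if v \<in> U then f v else 0"
  by (rule finite_subset[rotated], assumption) auto

lemma lookup_restr [simp]: "lookup (restr U e) v = (if v \<in> U then lookup e v else 0)"
  by transfer simp

lemma keys_restr: "keys (restr U e) = keys e \<inter> U"
  by (auto simp: in_keys_iff split: if_splits)

lemma map_restr: "set us \<subseteq> U \<Longrightarrow> map (lookup (restr U e)) us = map (lookup e) us"
  by auto

lemma product_Nil: "List.product us [] = []"
  by (induction us) auto

lemma plus_correlator:
  assumes "charged_functional a lam \<kappa> (int (length us))" "distinct us"
  shows "lam (Ps a us e \<kappa>) =
    lam (foldr (P a) (desc (int (length us)) (length us)) \<kappa>) *
    coef (diff_prod (pairs us)) (restr (set us) e)"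
proof -
  interpret charged_functional a lam \<kappa> "int (length us)" by fact
  have "corr us [] (restr (set us) e) =
      lam (foldr (P a) (desc (int (length us)) (length us)) \<kappa>) * vandermonde us [] (restr (set us) e)"
    using one_component_correlator[of us "[]" "restr (set us) e"] assms(2)
    by (simp add: product_Nil keys_restr)
  then show ?thesis
    unfolding corr_def map_restr[OF order_refl] coef_vandermonde[symmetric] by simp
qed

lemma minus_correlator:
  assumes "charged_functional a lam \<kappa> (- int (length vs))" "distinct vs"
  shows "lam (Ms a vs e \<kappa>) =
    lam (foldr (M a) (desc (int (length vs)) (length vs)) \<kappa>) *
    coef (diff_prod (pairs vs)) (restr (set vs) e)"
proof -
  interpret charged_functional a lam \<kappa> "- int (length vs)" by fact
  have "corr [] vs (restr (set vs) e) =
      lam (foldr (M a) (desc (int (length vs)) (length vs)) \<kappa>) * vandermonde [] vs (restr (set vs) e)"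
    using one_component_correlator[of "[]" vs "restr (set vs) e"] assms(2)
    by (simp add: keys_restr)
  then show ?thesis
    unfolding corr_def map_restr[OF order_refl] coef_vandermonde[symmetric] by simp
qed

text \<open>
  The bounds on its exponents make the correlator an element of the ring, where the factors \<open>x - z\<close> are
  invertible.
\<close>

lemma mixed_correlator:
  assumes "charged_functional a lam \<kappa> (int nc - int ne)" and e: "keys e \<subseteq> set (xvars nc) \<union> set (zvars ne)"
  shows "lam (Ps a (xvars nc) e (Ms a (zvars ne) e \<kappa>)) =
    lam (foldr (P a) (desc (int nc - int ne) nc) (foldr (M a) (desc (int ne) ne) \<kappa>)) *
    coef (diff_prod (pairs (xvars nc)) * diff_prod (pairs (zvars ne)) * inv_cross nc ne) e"
proof -
  let ?V = "set (xvars nc) \<union> set (zvars ne)" and ?us = "xvars nc" and ?vs = "zvars ne" and ?c = "int nc - int ne"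
  let ?ps = "List.product ?us ?vs" and ?VV = "diff_prod (pairs ?us) * diff_prod (pairs ?vs)"
  interpret charged_functional a lam \<kappa> ?c by fact
  let ?s = "lam (foldr (P a) (desc ?c nc) (foldr (M a) (desc (int ne) ne) \<kappa>))"
  define G where "G = Abs_tame (\<lambda>e. if keys e \<subseteq> ?V then corr ?us ?vs e else 0)"
  have d: "distinct (?us @ ?vs)" by (auto simp: distinct_map inj_on_def)
  have "tame (\<lambda>e. if keys e \<subseteq> ?V then corr ?us ?vs e else 0)"
  proof (rule tameI[of ?V _ "- \<bar>?c\<bar>"])
    fix e assume *: "(if keys e \<subseteq> ?V then corr ?us ?vs e else 0) \<noteq> 0"
    then have k: "keys e \<subseteq> ?V" and nz: "corr ?us ?vs e \<noteq> 0" by (auto split: if_splits)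
    have "- \<bar>?c\<bar> \<le> orient v * lookup e v" for v
    proof -
      consider "v \<in> set ?us" | "v \<in> set ?vs" | "lookup e v = 0"
        using k by (metis UnE in_keys_iff subsetD)
      then show ?thesis
      proof cases
        case 1
        then have "orient v = - 1" by auto
        then show ?thesis using corr_bounds(1)[OF nz 1] by simp
      next
        case 2
        then have "orient v = 1" by auto
        then show ?thesis using corr_bounds(2)[OF nz 2] by simp
      qed simp
    qed
    then show "bounded_mono ?V (- \<bar>?c\<bar>) e" using k by (simp add: bounded_mono_def)
  qed simp
  then have G: "coef G = (\<lambda>e. if keys e \<subseteq> ?V then corr ?us ?vs e else 0)"
    by (simp add: G_def Abs_tame_inverse)
  have "diff_prod ?ps * G = const ?s * ?VV"
  proof (rule coef_eqI, rule ext)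
    fix e
    show "coef (diff_prod ?ps * G) e = coef (const ?s * ?VV) e"
    proof (cases "keys e \<subseteq> ?V")
      case True
      have "coef (diff_prod ?ps * G) e = diff_mults ?ps (coef G) e"
        by (simp only: coef_diff_prod_times)
      also have "\<dots> = diff_mults ?ps (corr ?us ?vs) e"
        by (rule diff_mults_cong_keys[OF _ _ True]) (simp only: G if_True, force)
      also have "\<dots> = ?s * vandermonde ?us ?vs e"
        using one_component_correlator[OF d _ True] by (simp only: length_map length_upt) simp
      finally show ?thesis by (simp only: coef_const_times coef_vandermonde)
    next
      case False
      have "diff_mults ?ps (coef G) e = 0"
      proof (rule ccontr)
        assume "diff_mults ?ps (coef G) e \<noteq> 0"
        then have "keys e \<subseteq> ?V"
          by (rule diff_mults_keys[rotated 2]) (simp add: G split: if_splits, force)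
        with False show False ..
      qed
      moreover have "vandermonde ?us ?vs e = 0" using vandermonde_keys False by blast
      ultimately show ?thesis
        unfolding coef_const_times coef_vandermonde unfolding coef_diff_prod_times by simp
    qed
  qed
  \<comment> \<open>division by the factors \<open>x - z\<close>\<close>
  then have "inv_cross nc ne * (diff_prod ?ps * G) = inv_cross nc ne * (const ?s * ?VV)" by simp
  then have "(diff_prod ?ps * inv_cross nc ne) * G = const ?s * (?VV * inv_cross nc ne)"
    by (simp only: mult.assoc mult.commute mult.left_commute)
  then have "G = const ?s * (?VV * inv_cross nc ne)" unfolding cross_times_inv_cross by simp
  then have "coef G e = ?s * coef (?VV * inv_cross nc ne) e" by (simp only: coef_const_times)
  then show ?thesis using e by (simp only: G corr_def if_True)
qed

text \<open>
  One component at a time: its operators are evaluated while those of the other components are part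
  of the functional or of the vector. Once evaluated, they are replaced by the modes with the leading
  exponents. The components 0 and 2 come first, so that the remaining correlator of component 1
  is a function of its own exponents alone.
\<close>

lemma three_component_correlator:
  assumes \<beta>: "bra c \<beta>" and c: "c 0 = - int (nc + nd)" "c 1 = int nc - int ne" "c 2 = int (nd + ne)"
  shows "\<beta> (Ps 2 (yvars nd @ zvars ne) f (Ps 1 (xvars nc) f
      (Ms 1 (zvars ne) g (Ms 0 (xvars nc @ yvars nd) g vac)))) =
    \<beta> (foldr (P 2) (desc (int (nd + ne)) (nd + ne)) (foldr (P 1) (desc (int nc - int ne) nc)
      (foldr (M 1) (desc (int ne) ne) (foldr (M 0) (desc (int (nc + nd)) (nc + nd)) vac)))) *
    (coef (diff_prod (pairs (yvars nd @ zvars ne))) (restr (set (yvars nd @ zvars ne)) f) *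
     coef (diff_prod (pairs (xvars nc)) * diff_prod (pairs (zvars ne)) * inv_cross nc ne)
       (restr (set (xvars nc)) f + restr (set (zvars ne)) g) *
     coef (diff_prod (pairs (xvars nc @ yvars nd))) (restr (set (xvars nc @ yvars nd)) g))"
proof -
  let ?F2 = "map (lookup f) (yvars nd @ zvars ne)" and ?F1 = "map (lookup f) (xvars nc)"
  let ?G1 = "map (lookup g) (zvars ne)" and ?G0 = "map (lookup g) (xvars nc @ yvars nd)"
  let ?D2 = "desc (int (nd + ne)) (nd + ne)" and ?D0 = "desc (int (nc + nd)) (nc + nd)"
  have ne: "(0::3) \<noteq> 1" "(0::3) \<noteq> 2" "(1::3) \<noteq> 2" by simp_all
  have dist: "distinct (xvars nc @ yvars nd)" "distinct (yvars nd @ zvars ne)" by (auto simp: distinct_map inj_on_def)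
  have cr: "crosses 0 (\<lambda>w. foldr (P 2) as (foldr (P 1) bs (foldr (M 1) cs w)))" for as bs cs
    by (rule crosses_comp[OF crosses_foldr_P[OF ne(2)]
          crosses_comp[OF crosses_foldr_P[OF ne(1)] crosses_foldr_M[OF ne(1)]]])
  have cr2: "crosses 2 (\<lambda>w. foldr (P 1) bs (foldr (M 1) cs (foldr (M 0) ds w)))" for bs cs ds
    by (rule crosses_comp[OF crosses_foldr_P[OF ne(3)[symmetric]]
          crosses_comp[OF crosses_foldr_M[OF ne(3)[symmetric]] crosses_foldr_M[OF ne(2)[symmetric]]]])
  have "charged_functional 0 (\<lambda>w. \<beta> (foldr (P 2) ?F2 (foldr (P 1) ?F1 (foldr (M 1) ?G1 w)))) vac (c 0)"
    by (rule charged_functional_crosses[OF \<beta> cr annihilated_vac])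
  then have cf0: "charged_functional 0 (\<lambda>w. \<beta> (foldr (P 2) ?F2 (foldr (P 1) ?F1 (foldr (M 1) ?G1 w)))) vac
      (- int (length (xvars nc @ yvars nd)))"
    by (simp add: c del: upt_Suc)
  have "charged_functional 2 \<beta> (foldr (P 1) ?F1 (foldr (M 1) ?G1 (foldr (M 0) ?D0 vac))) (c 2)"
    by (rule charged_functional_crosses[OF \<beta> crosses_id annihilated_crosses[OF cr2 annihilated_vac]])
  then have cf2: "charged_functional 2 \<beta> (foldr (P 1) ?F1 (foldr (M 1) ?G1 (foldr (M 0) ?D0 vac)))
      (int (length (yvars nd @ zvars ne)))"
    by (simp add: c del: upt_Suc)
  have "charged_functional 1 (\<lambda>w. \<beta> (foldr (P 2) ?D2 w)) (foldr (M 0) ?D0 vac) (c 1)"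
    by (rule charged_functional_crosses[OF \<beta> crosses_foldr_P[OF ne(3)]
          annihilated_crosses[OF crosses_foldr_M[OF ne(1)[symmetric]] annihilated_vac]])
  then have cf1: "charged_functional 1 (\<lambda>w. \<beta> (foldr (P 2) ?D2 w)) (foldr (M 0) ?D0 vac) (int nc - int ne)"
    by (simp only: c)
  let ?e = "restr (set (xvars nc)) f + restr (set (zvars ne)) g"
  have "keys ?e \<subseteq> set (xvars nc) \<union> set (zvars ne)"
    using keys_add[of "restr (set (xvars nc)) f" "restr (set (zvars ne)) g"] by (auto simp: keys_restr)
  note mixed = mixed_correlator[OF cf1 this]
  have m: "map (lookup ?e) (xvars nc) = ?F1" "map (lookup ?e) (zvars ne) = ?G1"
    by (auto simp: lookup_add)
  have len: "int (length (xvars nc @ yvars nd)) = int (nc + nd)" "length (xvars nc @ yvars nd) = nc + nd"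
    "int (length (yvars nd @ zvars ne)) = int (nd + ne)" "length (yvars nd @ zvars ne) = nd + ne"
    by simp_all
  have "\<beta> (foldr (P 2) ?F2 (foldr (P 1) ?F1 (foldr (M 1) ?G1 (foldr (M 0) ?G0 vac)))) =
      \<beta> (foldr (P 2) ?F2 (foldr (P 1) ?F1 (foldr (M 1) ?G1 (foldr (M 0) ?D0 vac)))) *
      coef (diff_prod (pairs (xvars nc @ yvars nd))) (restr (set (xvars nc @ yvars nd)) g)"
    using minus_correlator[OF cf0 dist(1), of g] unfolding len .
  also have "\<beta> (foldr (P 2) ?F2 (foldr (P 1) ?F1 (foldr (M 1) ?G1 (foldr (M 0) ?D0 vac)))) =
      \<beta> (foldr (P 2) ?D2 (foldr (P 1) ?F1 (foldr (M 1) ?G1 (foldr (M 0) ?D0 vac)))) *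
      coef (diff_prod (pairs (yvars nd @ zvars ne))) (restr (set (yvars nd @ zvars ne)) f)"
    using plus_correlator[OF cf2 dist(2), of f] unfolding len .
  also have "\<beta> (foldr (P 2) ?D2 (foldr (P 1) ?F1 (foldr (M 1) ?G1 (foldr (M 0) ?D0 vac)))) =
      \<beta> (foldr (P 2) ?D2 (foldr (P 1) (desc (int nc - int ne) nc)
      (foldr (M 1) (desc (int ne) ne) (foldr (M 0) ?D0 vac)))) *
      coef (diff_prod (pairs (xvars nc)) * diff_prod (pairs (zvars ne)) * inv_cross nc ne) ?e"
    using mixed unfolding m .
  finally show ?thesis by (simp only: mult.assoc mult.commute mult.left_commute)
qed


section \<open>Translated vacua\<close>

abbreviation "Q \<equiv> Q_op"
abbreviation "R a \<equiv> inv (Q_op a)"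

lemma Q_translation: "is_translation_ops Q"
  unfolding Q_op_eq by (rule is_translation_ops_std_Q)

lemma lin_Q: "lin (Q a)" and bij_Q: "bij (Q a)" and Q_vac: "Q a vac = P a 0 vac"
  using Q_translation by (simp_all add: is_translation_ops_def psi_plus_field_def)

lemma Q_R [simp]: "Q a (R a v) = v" and R_Q [simp]: "R a (Q a v) = v"
  using bij_Q[of a] by (simp_all add: bij_is_surj surj_f_inv_f bij_is_inj)

lemma Q_cancel: "Q a u = Q a v \<Longrightarrow> u = v"
  by (metis R_Q)

lemma lin_R: "lin (R a)"
proof (rule linI)
  fix u v c
  show "R a (u + v) = R a u + R a v"
    by (rule Q_cancel[where a = a]) (simp add: lin_add[OF lin_Q])
  show "R a (scale c v) = scale c (R a v)"
    by (rule Q_cancel[where a = a]) (simp add: lin_scale[OF lin_Q])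
qed

lemma Q_P: "Q a (P a p v) = P a (p + 1) (Q a v)"
  and Q_M: "Q a (M a p v) = M a (p - 1) (Q a v)"
  and Q_P_other: "a \<noteq> b \<Longrightarrow> Q a (P b p v) = - P b p (Q a v)"
  and Q_M_other: "a \<noteq> b \<Longrightarrow> Q a (M b p v) = - M b p (Q a v)"
  and Q_Q: "a \<noteq> b \<Longrightarrow> Q a (Q b v) = - Q b (Q a v)"
proof -
  have *: "P a n \<circ> Q a = Q a \<circ> P a (n - 1)" "M a n \<circ> Q a = Q a \<circ> M a (n + 1)"
    "a \<noteq> b \<Longrightarrow> P b n \<circ> Q a = (\<lambda>v. - Q a (P b n v))"
    "a \<noteq> b \<Longrightarrow> M b n \<circ> Q a = (\<lambda>v. - Q a (M b n v))"
    "a \<noteq> b \<Longrightarrow> Q a \<circ> Q b = (\<lambda>v. - Q b (Q a v))" for n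
  proof -
    note T = Q_translation[unfolded is_translation_ops_def, THEN conjunct2, THEN conjunct2]
    show "P a n \<circ> Q a = Q a \<circ> P a (n - 1)" "M a n \<circ> Q a = Q a \<circ> M a (n + 1)"
      using T by simp_all
    note T' = T[THEN conjunct2, THEN conjunct2, rule_format]
    show "P b n \<circ> Q a = (\<lambda>v. - Q a (P b n v))" "M b n \<circ> Q a = (\<lambda>v. - Q a (M b n v))"
        "Q a \<circ> Q b = (\<lambda>v. - Q b (Q a v))" if "a \<noteq> b"
      using T'[of b a n] T'[of a b n] that by simp_all
  qed
  show "Q a (P a p v) = P a (p + 1) (Q a v)" using fun_cong[OF *(1)[of "p + 1"], of v] by simp
  show "Q a (M a p v) = M a (p - 1) (Q a v)" using fun_cong[OF *(2)[of "p - 1"], of v] by simp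
  assume ab: "a \<noteq> b"
  show "Q a (P b p v) = - P b p (Q a v)" using fun_cong[OF *(3)[OF ab, of p], of v] by simp
  show "Q a (M b p v) = - M b p (Q a v)" using fun_cong[OF *(4)[OF ab, of p], of v] by simp
  show "Q a (Q b v) = - Q b (Q a v)" using fun_cong[OF *(5)[OF ab], of v] by simp
qed

lemma R_P: "R a (P a p v) = P a (p - 1) (R a v)"
  and R_M: "R a (M a p v) = M a (p + 1) (R a v)"
  by (rule Q_cancel[where a = a], simp add: Q_P Q_M)+

lemma R_P_other: "a \<noteq> b \<Longrightarrow> R a (P b p v) = - P b p (R a v)"
  and R_M_other: "a \<noteq> b \<Longrightarrow> R a (M b p v) = - M b p (R a v)"
  by (rule Q_cancel[where a = a], simp add: Q_P_other Q_M_other lin_minus[OF lin_Q])+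

lemma R_Q_other: "a \<noteq> b \<Longrightarrow> R a (Q b v) = - Q b (R a v)"
  by (rule Q_cancel[where a = a]) (use Q_Q[of a b "R a v"] in \<open>simp add: lin_minus[OF lin_Q]\<close>)

lemma R_R_other: "a \<noteq> b \<Longrightarrow> R a (R b v) = - R b (R a v)"
  by (rule Q_cancel[where a = a])
    (use R_Q_other[of b a "R a v"] in \<open>simp add: lin_minus[OF lin_Q]\<close>)

lemma R_vac: "R a vac = M a 0 vac"
proof (rule Q_cancel[where a = a])
  have "M a (- 1) vac = 0" using annihilated_vac[of a] by (simp add: annihilated_def)
  then show "Q a (R a vac) = Q a (M a 0 vac)" by (simp add: Q_M Q_vac M_P lin_zero[OF lin_P])
qed


subsection \<open>Powers of anticommuting operators\<close>

lemma lin_funpow: "lin f \<Longrightarrow> lin (f ^^ n)"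
proof (induction n)
  case 0
  show ?case using lin_id by (simp add: id_def)
next
  case (Suc n)
  then show ?case using lin_comp[of f "f ^^ n"] by (simp add: comp_def)
qed

lemma funpow_anticommute1:
  assumes "lin f" "lin g" "\<And>v. f (g v) = - g (f v)"
  shows "(f ^^ n) (g v) = scale ((- 1) ^ n) (g ((f ^^ n) v))"
  by (induction n) (simp_all add: assms(3) lin_scale[OF assms(1)])

lemma funpow_anticommute:
  assumes "lin f" "lin g" "\<And>v. f (g v) = - g (f v)"
  shows "(f ^^ n) ((g ^^ m) v) = scale ((- 1) ^ (n * m)) ((g ^^ m) ((f ^^ n) v))"
proof (induction m)
  case (Suc m)
  then show ?case
    by (simp add: funpow_anticommute1[OF assms] lin_scale[OF assms(2)] power_add mult.commute)
qed simp

text \<open>The number of exchanges that separate \<open>n\<close> alternating pairs.\<close>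

definition tri :: "nat \<Rightarrow> nat" where "tri n = \<Sum>{..<n}"

lemma tri_simps [simp]: "tri 0 = 0" "tri (Suc n) = tri n + n"
  by (simp_all add: tri_def)

lemma tri_add: "tri (m + n) = tri m + tri n + m * n"
  by (induction n) (auto simp: algebra_simps)

lemma tri_eq: "n * (n + 1) div 2 = tri n + n"
proof -
  have "2 * (tri n + n) = n * (n + 1)" by (induction n) auto
  then show ?thesis by simp
qed

lemma funpow_comp_anticommute:
  assumes "lin f" "lin g" "\<And>v. f (g v) = - g (f v)"
  shows "((f \<circ> g) ^^ n) v = scale ((- 1) ^ tri n) ((f ^^ n) ((g ^^ n) v))"
proof (induction n)
  case (Suc n)
  have "g (f v) = - f (g v)" for v using assms(3)[of v] by simp
  from funpow_anticommute1[OF assms, of n "(g ^^ n) v"]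
  have "g ((f ^^ n) ((g ^^ n) v)) = scale ((- 1) ^ n) ((f ^^ n) (g ((g ^^ n) v)))"
    by (simp add: sign_square)
  then show ?case
    using Suc by (simp add: lin_scale[OF assms(1)] lin_scale[OF assms(2)] power_add)
qed simp


subsection \<open>Operators with the lowest exponents translate\<close>

text \<open>
  The property of the vacuum by which translations turn into modes. It is inherited under
  translations of the other components, the signs on both sides being the same.
\<close>

definition translated :: "3 \<Rightarrow> fock \<Rightarrow> bool" where
  "translated a \<kappa> \<longleftrightarrow> Q a \<kappa> = P a 0 \<kappa> \<and> R a \<kappa> = M a 0 \<kappa>"

lemma translated_vac: "translated a vac"
  by (simp add: translated_def Q_vac R_vac)

lemma translated_other:
  assumes "translated a \<kappa>" "a \<noteq> b"
  shows "translated a ((Q b ^^ n) \<kappa>)" "translated a ((R b ^^ n) \<kappa>)"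
proof -
  have ba: "b \<noteq> a" using assms(2) by simp
  have QR: "Q a (R b w) = - R b (Q a w)" for w using R_Q_other[OF ba, of w] by simp
  have "translated a (Q b \<kappa>)" if "translated a \<kappa>" for \<kappa>
    using that unfolding translated_def Q_Q[OF assms(2)] R_Q_other[OF assms(2)]
    by (simp add: Q_P_other[OF ba] Q_M_other[OF ba])
  moreover have "translated a (R b \<kappa>)" if "translated a \<kappa>" for \<kappa>
    using that unfolding translated_def QR R_R_other[OF assms(2)]
    by (simp add: R_P_other[OF ba] R_M_other[OF ba])
  ultimately show "translated a ((Q b ^^ n) \<kappa>)" "translated a ((R b ^^ n) \<kappa>)"
    using assms(1) by (induction n) auto
qed

text \<open>
  Translation raises the exponents of the creation modes by one. Hence the mode of exponent \<open>d\<close> that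
  the first translation creates becomes, under \<open>n\<close> further ones, the mode of exponent \<open>d + n\<close>.
\<close>

lemma foldr_P_desc:
  assumes "Q a \<kappa> = P a d \<kappa>"
  shows "foldr (P a) (desc (d + int n) n) \<kappa> = (Q a ^^ n) \<kappa>"
proof (induction n)
  case (Suc n)
  have Qn: "(Q a ^^ n) (P a d w) = P a (d + int n) ((Q a ^^ n) w)" for n w
    by (induction n) (simp_all add: Q_P add_ac)
  have "foldr (P a) (desc (d + int (Suc n)) (Suc n)) \<kappa> = P a (d + int n) (foldr (P a) (desc (d + int n) n) \<kappa>)"
    by simp
  also have "\<dots> = (Q a ^^ n) (Q a \<kappa>)" by (simp add: Suc Qn assms)
  finally show ?case by (simp add: funpow_swap1)
qed simp

lemma foldr_M_desc:
  assumes "R a \<kappa> = M a 0 \<kappa>"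
  shows "foldr (M a) (desc (int n) n) \<kappa> = (R a ^^ n) \<kappa>"
proof (induction n)
  case (Suc n)
  have Rn: "(R a ^^ n) (M a 0 w) = M a (int n) ((R a ^^ n) w)" for n w
    by (induction n) (simp_all add: R_M add_ac)
  have "foldr (M a) (desc (int (Suc n)) (Suc n)) \<kappa> = M a (int n) (foldr (M a) (desc (int n) n) \<kappa>)"
    by simp
  also have "\<dots> = (R a ^^ n) (R a \<kappa>)" by (simp add: Suc Rn assms)
  finally show ?case by (simp add: funpow_swap1)
qed simp

lemma Q_R_funpow: "(Q a ^^ n) ((R a ^^ n) v) = v"
proof (induction n)
  case (Suc n)
  have "(Q a ^^ Suc n) w = (Q a ^^ n) (Q a w)" for w
    by (simp add: funpow_swap1)
  then show ?case using Suc by (simp del: funpow.simps(2)) simp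
qed simp

text \<open>
  In component 1 the charge \<open>n\<^sub>c - n\<^sub>e\<close> arises from \<open>n\<^sub>e\<close> inverse translations followed by \<open>n\<^sub>c\<close>
  translations; inserting \<open>n\<^sub>d\<close> more of each leaves the vector unchanged and gives the exponents of
  \<open>translated_vacuum\<close>.
\<close>

lemma extremal_vector:
  "foldr (P 2) (desc (int (nd + ne)) (nd + ne)) (foldr (P 1) (desc (int nc - int ne) nc)
      (foldr (M 1) (desc (int ne) ne) (foldr (M 0) (desc (int (nc + nd)) (nc + nd)) vac))) =
    (Q 2 ^^ (nd + ne)) ((Q 1 ^^ (nc + nd)) ((R 1 ^^ (nd + ne)) ((R 0 ^^ (nc + nd)) vac)))"
proof -
  let ?\<kappa>0 = "(R 0 ^^ (nc + nd)) vac"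
  let ?\<kappa>1 = "(R 1 ^^ ne) ?\<kappa>0"
  have ne: "(0::3) \<noteq> 1" "(0::3) \<noteq> 2" "(1::3) \<noteq> 2" by simp_all
  have 0: "foldr (M 0) (desc (int (nc + nd)) (nc + nd)) vac = ?\<kappa>0"
    by (rule foldr_M_desc) (rule R_vac)
  have tr: "translated 1 ?\<kappa>0" using translated_other(2)[OF translated_vac ne(1)[symmetric]] .
  then have 1: "foldr (M 1) (desc (int ne) ne) ?\<kappa>0 = ?\<kappa>1"
    by (intro foldr_M_desc) (simp add: translated_def)
  have "Q 1 ?\<kappa>1 = P 1 (- int ne) ?\<kappa>1"
  proof -
    have "(R 1 ^^ n) (P 1 d w) = P 1 (d - int n) ((R 1 ^^ n) w)" for n d w
      by (induction n) (simp_all add: R_P diff_diff_eq add.commute)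
    from this[of _ 0] have "(R 1 ^^ n) (P 1 0 w) = P 1 (- int n) ((R 1 ^^ n) w)" for n w by simp
    moreover have "(R 1 ^^ n) (Q 1 w) = Q 1 ((R 1 ^^ n) w)" for n w
      by (induction n) simp_all
    ultimately show ?thesis using tr by (metis translated_def)
  qed
  from foldr_P_desc[OF this, of nc]
  have 2: "foldr (P 1) (desc (int nc - int ne) nc) ?\<kappa>1 = (Q 1 ^^ nc) ?\<kappa>1" by simp
  have "translated 2 ((Q 1 ^^ nc) ?\<kappa>1)"
    by (intro translated_other translated_vac ne[symmetric])
  then have 3: "foldr (P 2) (desc (int (nd + ne)) (nd + ne)) ((Q 1 ^^ nc) ?\<kappa>1) =
      (Q 2 ^^ (nd + ne)) ((Q 1 ^^ nc) ?\<kappa>1)"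
    using foldr_P_desc[of 2 _ 0 "nd + ne"] by (simp add: translated_def)
  have "(Q 1 ^^ (nc + nd)) ((R 1 ^^ (nd + ne)) ?\<kappa>0) = (Q 1 ^^ nc) ?\<kappa>1"
    by (simp add: funpow_add Q_R_funpow)
  then show ?thesis unfolding 0 1 2 3 by simp
qed

lemma Q_R_comp:
  assumes "a \<noteq> b"
  shows "((Q a \<circ> R b) ^^ n) v = scale ((- 1) ^ tri n) ((Q a ^^ n) ((R b ^^ n) v))"
proof (rule funpow_comp_anticommute[OF lin_Q lin_R])
  fix v show "Q a (R b v) = - R b (Q a v)" using R_Q_other[of b a v] assms by simp
qed

text \<open>
  The powers of \<open>T\<^sub>1\<close> and \<open>T\<^sub>2\<close> split with signs \<open>tri\<close>, and moving \<open>Q\<^sub>2\<close> and the inverse of \<open>Q\<^sub>1\<close> to their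
  places takes three exchanges of \<open>k\<close> with \<open>l\<close> anticommuting factors.
\<close>

lemma translated_vacuum:
  "(T1 ^^ k) ((T2 ^^ l) vac) = scale ((- 1) ^ (tri k + tri l + k * l))
    ((Q 2 ^^ l) ((Q 1 ^^ k) ((R 1 ^^ l) ((R 0 ^^ k) vac))))"
proof -
  have ne: "(0::3) \<noteq> 1" "(0::3) \<noteq> 2" "(1::3) \<noteq> 2" by simp_all
  have lins: "(Q a ^^ n) (scale c v) = scale c ((Q a ^^ n) v)"
      "(R a ^^ n) (scale c v) = scale c ((R a ^^ n) v)" for a n c v
    by (rule lin_scale, rule lin_funpow, rule lin_Q, rule lin_scale, rule lin_funpow, rule lin_R)
  have "(T2 ^^ l) vac = scale ((- 1) ^ tri l) ((Q 2 ^^ l) ((R 1 ^^ l) vac))"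
    unfolding T2_def by (rule Q_R_comp) simp
  moreover have "(T1 ^^ k) v = scale ((- 1) ^ tri k) ((Q 1 ^^ k) ((R 0 ^^ k) v))" for v
    unfolding T1_def by (rule Q_R_comp) simp
  moreover have "(R 0 ^^ k) ((Q 2 ^^ l) v) = scale ((- 1) ^ (k * l)) ((Q 2 ^^ l) ((R 0 ^^ k) v))" for v
    by (rule funpow_anticommute[OF lin_R lin_Q]) (rule R_Q_other[OF ne(2)])
  moreover have "(Q 1 ^^ k) ((Q 2 ^^ l) v) = scale ((- 1) ^ (k * l)) ((Q 2 ^^ l) ((Q 1 ^^ k) v))" for v
    by (rule funpow_anticommute[OF lin_Q lin_Q]) (rule Q_Q[OF ne(3)])
  moreover have "(R 0 ^^ k) ((R 1 ^^ l) v) = scale ((- 1) ^ (k * l)) ((R 1 ^^ l) ((R 0 ^^ k) v))" for v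
    by (rule funpow_anticommute[OF lin_R lin_R]) (rule R_R_other[OF ne(1)])
  ultimately have "(T1 ^^ k) ((T2 ^^ l) vac) = scale ((- 1) ^ tri k * ((- 1) ^ tri l *
      ((- 1) ^ (k * l) * ((- 1) ^ (k * l) * (- 1) ^ (k * l)))))
    ((Q 2 ^^ l) ((Q 1 ^^ k) ((R 1 ^^ l) ((R 0 ^^ k) vac))))"
    by (simp only: lins fock.scale_scale mult_ac)
  then show ?thesis by (simp only: sign_square power_add mult_1_right mult.assoc)
qed


subsection \<open>Translated vacua as wedges\<close>

lemma finite_charged_vac: "finite (sym_diff {(a, k). - c a \<le> k} vac_set)"
proof (rule finite_subset)
  show "sym_diff {(a, k). - c a \<le> k} vac_set \<subseteq> (SIGMA a:UNIV. {- \<bar>c a\<bar>..\<bar>c a\<bar>})"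
    by (auto simp: vac_set_def)
qed simp

lift_definition charged_vac :: "(3 \<Rightarrow> int) \<Rightarrow> wedge" is "\<lambda>c. {(a, k). - c a \<le> k}"
  by (rule finite_charged_vac)

lemma signed_wedge_Q:
  assumes "signed_wedge v (charged_vac c)"
  shows "signed_wedge (Q a v) (charged_vac (c(a := c a + 1)))"
    "signed_wedge (R a v) (charged_vac (c(a := c a - 1)))"
proof -
  have Q: "signed_wedge (Q a v) (shift_wedge a S)" if "signed_wedge v S" for v S
    using that shift_sign_cases[of a S]
    by (auto simp: signed_wedge_def Q_op_eq std_Q_wedge_vec lin_minus[OF lin_std_Q])
  have shift: "shift_wedge a (charged_vac c) = charged_vac (c(a := c a + 1))" for c
  proof (rule wedge_eqI, rule set_eqI)
    fix n
    show "n \<in> factors (shift_wedge a (charged_vac c)) \<longleftrightarrow> n \<in> factors (charged_vac (c(a := c a + 1)))"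
      by (cases n) (auto simp: mem_shift_image unshift_def charged_vac.rep_eq)
  qed
  show "signed_wedge (Q a v) (charged_vac (c(a := c a + 1)))" using Q[OF assms] shift by simp
  let ?S = "charged_vac (c(a := c a - 1))"
  have "signed_wedge (Q a (wedge_vec ?S)) (charged_vac c)"
    using Q[of "wedge_vec ?S" ?S] shift[of "c(a := c a - 1)"] by (simp add: signed_wedge_def)
  then have "v = Q a (wedge_vec ?S) \<or> v = - Q a (wedge_vec ?S)"
    using assms by (auto simp: signed_wedge_def)
  then show "signed_wedge (R a v) ?S"
    by (auto simp: signed_wedge_def lin_minus[OF lin_R])
qed

lemma signed_wedge_funpow:
  assumes "signed_wedge v (charged_vac c)"
  shows "signed_wedge ((Q a ^^ n) v) (charged_vac (c(a := c a + int n)))"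
    "signed_wedge ((R a ^^ n) v) (charged_vac (c(a := c a - int n)))"
proof -
  show "signed_wedge ((Q a ^^ n) v) (charged_vac (c(a := c a + int n)))"
  proof (induction n)
    case (Suc n)
    have eq: "(c(a := c a + int n))(a := (c(a := c a + int n)) a + 1) = c(a := c a + int (Suc n))"
      by (simp add: fun_eq_iff)
    from signed_wedge_Q(1)[OF Suc, where a = a] show ?case by (simp only: eq funpow.simps comp_apply)
  qed (use assms in simp)
  show "signed_wedge ((R a ^^ n) v) (charged_vac (c(a := c a - int n)))"
  proof (induction n)
    case (Suc n)
    have eq: "(c(a := c a - int n))(a := (c(a := c a - int n)) a - 1) = c(a := c a - int (Suc n))"
      by (simp add: fun_eq_iff)
    from signed_wedge_Q(2)[OF Suc, where a = a] show ?case by (simp only: eq funpow.simps comp_apply)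
  qed (use assms in simp)
qed

definition charges :: "nat \<Rightarrow> nat \<Rightarrow> 3 \<Rightarrow> int" where
  "charges k l = (\<lambda>_. 0)(0 := - int k, 1 := int k - int l, 2 := int l)"

lemma charges_simps [simp]:
  "charges k l 0 = - int k" "charges k l 1 = int k - int l" "charges k l 2 = int l"
  by (simp_all add: charges_def)

lemma signed_wedge_extremal:
  "signed_wedge ((Q 2 ^^ l) ((Q 1 ^^ k) ((R 1 ^^ l) ((R 0 ^^ k) vac)))) (charged_vac (charges k l))"
proof -
  have "charged_vac (\<lambda>_. 0) = vac_wedge"
    by (rule wedge_eqI) (simp add: charged_vac.rep_eq vac_set_def)
  then have "signed_wedge vac (charged_vac (\<lambda>_. 0))" by (simp add: signed_wedge_def vac_def)
  from signed_wedge_funpow(2)[OF this, where a = 0 and n = k]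
  have "signed_wedge ((R 0 ^^ k) vac) (charged_vac ((\<lambda>_. 0)(0 := - int k)))" by simp
  from signed_wedge_funpow(2)[OF this, where a = 1 and n = l]
  have "signed_wedge ((R 1 ^^ l) ((R 0 ^^ k) vac)) (charged_vac ((\<lambda>_. 0)(0 := - int k, 1 := - int l)))"
    by simp
  from signed_wedge_funpow(1)[OF this, where a = 1 and n = k]
  have "signed_wedge ((Q 1 ^^ k) ((R 1 ^^ l) ((R 0 ^^ k) vac)))
      (charged_vac ((\<lambda>_. 0)(0 := - int k, 1 := int k - int l)))"
    by simp
  from signed_wedge_funpow(1)[OF this, where a = 2 and n = l] show ?thesis
    by (simp add: charges_def)
qed

lemma std_form_signed_wedge:
  assumes "signed_wedge v S"
  shows "std_form v w = lookup v S * lookup w S" "lookup v S * lookup v S = 1"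
proof -
  have "std_form (wedge_vec S) w = lookup w S"
    by (simp add: std_form_def wedge_vec_def)
  then show "std_form v w = lookup v S * lookup w S" "lookup v S * lookup v S = 1"
    using assms by (auto simp: signed_wedge_def) (auto simp: wedge_vec_def)
qed

definition tau_bra :: "nat \<Rightarrow> nat \<Rightarrow> fock \<Rightarrow> complex" where
  "tau_bra k l w = fock_form ((T1 ^^ k) ((T2 ^^ l) vac)) w"

lemma signed_wedge_tau: "signed_wedge ((T1 ^^ k) ((T2 ^^ l) vac)) (charged_vac (charges k l))"
proof -
  have "(- 1) ^ n = (1 :: complex) \<or> (- 1) ^ n = (- 1 :: complex)" for n
    using neg_one_even_power neg_one_odd_power by blast
  then show ?thesis
    using signed_wedge_extremal[of l k] unfolding translated_vacuum signed_wedge_def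
    by (metis fock.scale_minus_left fock.scale_one minus_minus)
qed

lemma bra_tau: "bra (charges k l) (tau_bra k l)"
  unfolding bra_def
proof (intro conjI allI impI)
  show "module_hom scale (*) (tau_bra k l)"
    unfolding tau_bra_def[abs_def] fock_form_eq by (rule std_form_right)
  note form = std_form_signed_wedge(1)[OF signed_wedge_tau[of k l]]
  fix a p w
  show "tau_bra k l (P a p w) = 0" if "charges k l a \<le> p"
    using that unfolding tau_bra_def fock_form_eq form
    by (simp add: psi_plus_field_def psi_plus_def lookup_wedging charged_vac.rep_eq)
  show "tau_bra k l (M a p w) = 0" if "- charges k l a \<le> p"
    using that unfolding tau_bra_def fock_form_eq form
    by (simp add: psi_minus_field_def psi_minus_def lookup_contraction charged_vac.rep_eq)
qed

lemma tau_bra_extremal: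
  "tau_bra k l ((Q 2 ^^ l) ((Q 1 ^^ k) ((R 1 ^^ l) ((R 0 ^^ k) vac)))) = (- 1) ^ (tri k + tri l + k * l)"
proof -
  let ?T = "(T1 ^^ k) ((T2 ^^ l) vac)" and ?X = "(Q 2 ^^ l) ((Q 1 ^^ k) ((R 1 ^^ l) ((R 0 ^^ k) vac)))"
  let ?s = "(- 1) ^ (tri k + tri l + k * l) :: complex"
  have "?X = scale ?s ?T" unfolding translated_vacuum by (simp add: sign_square)
  then have "tau_bra k l ?X = ?s * std_form ?T ?T"
    unfolding tau_bra_def fock_form_eq using std_form_right by (simp add: module_hom.scale)
  then show ?thesis using std_form_signed_wedge[OF signed_wedge_tau[of k l]] by simp
qed


section \<open>Correlators of the bilinear fields\<close>

subsection \<open>Charge\<close>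

definition charge :: "3 \<Rightarrow> wedge \<Rightarrow> int" where
  "charge a S = int (card {k. k < 0 \<and> (a, k) \<in> factors S}) - int (card {k. 0 \<le> k \<and> (a, k) \<notin> factors S})"

lemma finite_charge_sets:
  "finite {k. k < 0 \<and> (a, k) \<in> factors S}" "finite {k. 0 \<le> k \<and> (a, k) \<notin> factors S}"
proof -
  have "{k. k < 0 \<and> (a, k) \<in> factors S} \<subseteq> snd ` (factors S - vac_set)"
    by (force simp: vac_set_def)
  then show "finite {k. k < 0 \<and> (a, k) \<in> factors S}"
    by (rule finite_subset) (intro finite_imageI finite_factors_diff)
  have "{k. 0 \<le> k \<and> (a, k) \<notin> factors S} \<subseteq> snd ` (vac_set - factors S)"
    by (force simp: vac_set_def)
  then show "finite {k. 0 \<le> k \<and> (a, k) \<notin> factors S}"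
    by (rule finite_subset) (intro finite_imageI finite_factors_diff)
qed

lemma charge_add_factor:
  assumes "(b, k) \<notin> factors S"
  shows "charge a (add_factor (b, k) S) = charge a S + (if a = b then 1 else 0)"
proof (cases "a = b")
  case True
  let ?A = "{j. j < 0 \<and> (a, j) \<in> factors S}" and ?B = "{j. 0 \<le> j \<and> (a, j) \<notin> factors S}"
  note fin = finite_charge_sets[of a S]
  show ?thesis
  proof (cases "k < 0")
    case neg: True
    have "{j. j < 0 \<and> (a, j) \<in> factors (add_factor (b, k) S)} = insert k ?A"
      "{j. 0 \<le> j \<and> (a, j) \<notin> factors (add_factor (b, k) S)} = ?B"
      using neg True by auto
    moreover have "k \<notin> ?A" using assms True by simp
    ultimately show ?thesis using fin True by (simp add: charge_def)
  next
    case False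
    have "{j. j < 0 \<and> (a, j) \<in> factors (add_factor (b, k) S)} = ?A"
      "?B = insert k {j. 0 \<le> j \<and> (a, j) \<notin> factors (add_factor (b, k) S)}"
      using False True assms by auto
    moreover have "finite {j. 0 \<le> j \<and> (a, j) \<notin> factors (add_factor (b, k) S)}"
      by (rule finite_charge_sets)
    moreover have "k \<notin> {j. 0 \<le> j \<and> (a, j) \<notin> factors (add_factor (b, k) S)}" using True by simp
    ultimately show ?thesis using True by (simp add: charge_def)
  qed
qed (simp add: charge_def)

lemma charge_charged_vac: "charge a (charged_vac c) = c a"
proof -
  have "{k. k < 0 \<and> (a, k) \<in> factors (charged_vac c)} = {- c a..<0}"
    "{k. 0 \<le> k \<and> (a, k) \<notin> factors (charged_vac c)} = {0..<- c a}"
    by (auto simp: charged_vac.rep_eq)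
  then show ?thesis by (simp add: charge_def)
qed

definition has_charge :: "(3 \<Rightarrow> int) \<Rightarrow> fock \<Rightarrow> bool" where
  "has_charge c v \<longleftrightarrow> (\<forall>S. lookup v S \<noteq> 0 \<longrightarrow> (\<forall>a. charge a S = c a))"

lemma has_charge_P:
  assumes "has_charge c v"
  shows "has_charge (c(b := c b + 1)) (P b p v)"
  unfolding has_charge_def
proof (intro allI impI)
  fix S a
  let ?n = "(b, - p - 1)"
  assume "lookup (P b p v) S \<noteq> 0"
  then have n: "?n \<in> factors S" "lookup v (remove_factor ?n S) \<noteq> 0"
    by (auto simp: psi_plus_field_def psi_plus_def lookup_wedging split: if_splits)
  have "charge a (add_factor ?n (remove_factor ?n S)) = charge a (remove_factor ?n S) + (if a = b then 1 else 0)"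
    by (rule charge_add_factor) simp
  moreover have "charge a (remove_factor ?n S) = c a" using assms n(2) by (simp add: has_charge_def)
  ultimately show "charge a S = (c(b := c b + 1)) a" by (simp only: add_remove[OF n(1)]) simp
qed

lemma has_charge_M:
  assumes "has_charge c v"
  shows "has_charge (c(b := c b - 1)) (M b p v)"
  unfolding has_charge_def
proof (intro allI impI)
  fix S a
  assume "lookup (M b p v) S \<noteq> 0"
  then have n: "(b, p) \<notin> factors S" "lookup v (add_factor (b, p) S) \<noteq> 0"
    by (auto simp: psi_minus_field_def psi_minus_def lookup_contraction split: if_splits)
  have "charge a (add_factor (b, p) S) = charge a S + (if a = b then 1 else 0)"
    by (rule charge_add_factor[OF n(1)])
  moreover have "charge a (add_factor (b, p) S) = c a" using assms n(2) by (simp add: has_charge_def)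
  ultimately show "charge a S = (c(b := c b - 1)) a" by (cases "a = b") simp_all
qed

lemma has_charge_sum: "(\<And>i. i \<in> I \<Longrightarrow> has_charge c (f i)) \<Longrightarrow> has_charge c (\<Sum>i\<in>I. f i)"
  unfolding has_charge_def lookup_sum
proof (intro allI impI)
  fix S a
  assume "\<And>i. i \<in> I \<Longrightarrow> \<forall>S. lookup (f i) S \<noteq> 0 \<longrightarrow> (\<forall>a. charge a S = c a)"
    and "(\<Sum>i\<in>I. lookup (f i) S) \<noteq> 0"
  then show "charge a S = c a" using sum.not_neutral_contains_not_neutral by blast
qed

lemma has_charge_E_field:
  assumes "has_charge c v" "a \<noteq> b"
  shows "has_charge (c(a := c a + 1, b := c b - 1)) (E_field a b n v)"
  unfolding E_field_def
proof (rule has_charge_sum)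
  fix p
  have "has_charge ((c(b := c b - 1))(a := (c(b := c b - 1)) a + 1)) (P a p (M b (n - p) v))"
    by (intro has_charge_P has_charge_M assms)
  moreover have "(c(b := c b - 1))(a := (c(b := c b - 1)) a + 1) = c(a := c a + 1, b := c b - 1)"
    using assms(2) by (auto simp: fun_eq_iff)
  ultimately show "has_charge (c(a := c a + 1, b := c b - 1)) (P a p (M b (n - p) v))" by simp
qed

lemma has_charge_foldr_E_field:
  assumes "has_charge c v" "a \<noteq> b"
  shows "has_charge (c(a := c a + int (length ns), b := c b - int (length ns))) (foldr (E_field a b) ns v)"
proof (induction ns)
  case (Cons n ns)
  let ?c = "c(a := c a + int (length ns), b := c b - int (length ns))"
  have "?c(a := ?c a + 1, b := ?c b - 1) =
      c(a := c a + int (length (n # ns)), b := c b - int (length (n # ns)))"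
    using assms(2) by (auto simp: fun_eq_iff)
  then show ?case using has_charge_E_field[OF Cons assms(2), of n] by (simp only: foldr.simps comp_apply)
qed (use assms in simp)


subsection \<open>Bilinear fields as finite sums\<close>

lemma annihilated_below: "\<exists>N. \<forall>p<N. P a p v = 0 \<and> M a p v = 0"
proof (induction v rule: fock_induct)
  case (add u v)
  then obtain K L where "\<forall>p<K. P a p u = 0 \<and> M a p u = 0" "\<forall>p<L. P a p v = 0 \<and> M a p v = 0" by blast
  then show ?case by (intro exI[of _ "min K L"]) (simp add: fermion_lin)
next
  case (scale c v)
  then show ?case by (auto simp: fermion_lin)
next
  case (wedge S)
  let ?A = "{k. k < 0 \<and> (a, k) \<in> factors S}" and ?B = "{k. 0 \<le> k \<and> (a, k) \<notin> factors S}"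
  let ?C = "insert 0 (?A \<union> (\<lambda>k. - k - 1) ` ?B)"
  have fin: "finite ?C" using finite_charge_sets[of a S] by simp
  have "P a p (wedge_vec S) = 0 \<and> M a p (wedge_vec S) = 0" if "p < Min ?C" for p
  proof -
    have less: "p < x" if "x \<in> ?C" for x
      using Min_le[OF fin that] \<open>p < Min ?C\<close> by (rule order.strict_trans2[rotated])
    have p: "p < 0" using less[of 0] by simp
    then have "(a, p) \<notin> factors S" using less[of p] by auto
    moreover have "(a, - p - 1) \<in> factors S"
    proof (rule ccontr)
      assume "(a, - p - 1) \<notin> factors S"
      then have "- p - 1 \<in> ?B" using p by simp
      then have "- (- p - 1) - 1 \<in> ?C" by blast
      from less[OF this] show False by simp
    qed
    ultimately show ?thesis
      by (simp add: psi_plus_field_def psi_plus_def psi_minus_field_def psi_minus_def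
          wedging_wedge_vec contraction_wedge_vec)
  qed
  then show ?case by blast
qed

lemma finite_E_field_support:
  assumes "a \<noteq> b"
  shows "finite {p. P a p (M b (n - p) v) \<noteq> 0}"
proof -
  obtain K L where K: "\<And>p. p < K \<Longrightarrow> P a p v = 0" and L: "\<And>p. p < L \<Longrightarrow> M b p v = 0"
    using annihilated_below by metis
  have "{p. P a p (M b (n - p) v) \<noteq> 0} \<subseteq> {K..n - L}"
  proof
    fix p assume p: "p \<in> {p. P a p (M b (n - p) v) \<noteq> 0}"
    have "K \<le> p"
    proof (rule ccontr)
      assume "\<not> K \<le> p"
      then show False using p K[of p] assms by (simp add: P_M lin_zero[OF lin_M])
    qed
    moreover have "p \<le> n - L"
    proof (rule ccontr)
      assume "\<not> p \<le> n - L"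
      then show False using p L[of "n - p"] by (simp add: lin_zero[OF lin_P])
    qed
    ultimately show "p \<in> {K..n - L}" by simp
  qed
  then show ?thesis by (rule finite_subset) simp
qed

lemma E_field_superset:
  assumes "finite A" "{p. P a p (M b (n - p) v) \<noteq> 0} \<subseteq> A"
  shows "E_field a b n v = (\<Sum>p\<in>A. P a p (M b (n - p) v))"
  unfolding E_field_def using assms by (intro sum.mono_neutral_left) auto

lemma lin_E_field:
  assumes "a \<noteq> b"
  shows "lin (E_field a b n)"
proof (rule linI)
  fix u v c
  let ?S = "\<lambda>v. {p. P a p (M b (n - p) v) \<noteq> 0}"
  have fin: "finite (?S u \<union> ?S v)" using finite_E_field_support[OF assms] by simp
  have "?S (u + v) \<subseteq> ?S u \<union> ?S v" by (auto simp: fermion_lin)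
  then show "E_field a b n (u + v) = E_field a b n u + E_field a b n v"
    using fin by (simp add: E_field_superset[of "?S u \<union> ?S v"] fermion_lin sum.distrib)
  have "?S (scale c v) \<subseteq> ?S v" by (auto simp: fermion_lin)
  then show "E_field a b n (scale c v) = scale c (E_field a b n v)"
    using finite_E_field_support[OF assms]
    by (simp add: E_field_superset[of "?S v"] fermion_lin fock.scale_sum_right)
qed

type_synonym word = "(3 \<times> 3 \<times> res_var) list"

abbreviation word_vars :: "word \<Rightarrow> res_var set" where
  "word_vars ws \<equiv> (\<lambda>(a, b, v). v) ` set ws"

definition E_word :: "word \<Rightarrow> res_mono \<Rightarrow> fock" where
  "E_word ws e = foldr (\<lambda>(a, b, v). E_field a b (lookup e v)) ws vac"

definition PM_word :: "word \<Rightarrow> res_mono \<Rightarrow> res_mono \<Rightarrow> fock" where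
  "PM_word ws f g = foldr (\<lambda>(a, b, v) w. P a (lookup f v) (M b (lookup g v) w)) ws vac"

text \<open>
  The coefficient of \<open>e\<close> in a product of bilinear fields is a sum over all distributions of the
  exponents: \<open>f\<close> are those of the \<open>\<psi>\<^sup>+\<close>, and \<open>e - f\<close> are those of the \<open>\<psi>\<^sup>-\<close>. These are the finitely many
  that contribute.
\<close>

definition splits :: "word \<Rightarrow> res_mono \<Rightarrow> res_mono set" where
  "splits ws e = {f. keys f \<subseteq> word_vars ws \<and> PM_word ws f (e - f) \<noteq> 0}"

lemma PM_word_cong:
  assumes "\<And>v. v \<in> word_vars ws \<Longrightarrow> lookup f v = lookup f' v \<and> lookup g v = lookup g' v"
  shows "PM_word ws f g = PM_word ws f' g'"
  unfolding PM_word_def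
proof (rule foldr_cong[OF refl refl])
  fix x w assume "x \<in> set ws"
  moreover obtain a b v where x: "x = (a, b, v)" by (metis prod_cases3)
  ultimately have "v \<in> word_vars ws" by force
  from assms[OF this] show "(case x of (a, b, v) \<Rightarrow> \<lambda>w. P a (lookup f v) (M b (lookup g v) w)) w =
      (case x of (a, b, v) \<Rightarrow> \<lambda>w. P a (lookup f' v) (M b (lookup g' v) w)) w"
    by (simp add: x)
qed

lemma E_word_splits:
  assumes "distinct (map (\<lambda>(a, b, v). v) ws)" "\<And>a b v. (a, b, v) \<in> set ws \<Longrightarrow> a \<noteq> b"
  shows "finite (splits ws e) \<and> E_word ws e = (\<Sum>f\<in>splits ws e. PM_word ws f (e - f))"
  using assms
proof (induction ws)
  case Nil
  have "splits [] e = {0} \<or> splits [] e = {}" by (auto simp: splits_def)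
  moreover have "(vac :: fock) \<noteq> 0"
    by (metis lookup_single_eq lookup_zero vac_def wedge_vec_def zero_neq_one)
  then have "0 \<in> splits [] e" by (simp add: splits_def PM_word_def)
  ultimately have "splits [] e = {0}" by auto
  then show ?case by (simp add: E_word_def PM_word_def)
next
  case (Cons w ws)
  obtain a b v where w: "w = (a, b, v)" by (metis prod_cases3)
  have ab: "a \<noteq> b" and v: "v \<notin> word_vars ws" using Cons.prems by (auto simp: w)
  have IH: "finite (splits ws e)" "E_word ws e = (\<Sum>f\<in>splits ws e. PM_word ws f (e - f))"
    using Cons by auto
  let ?n = "lookup e v" and ?u = "\<lambda>f. PM_word ws f (e - f)"
  define A where "A f = {p. P a p (M b (?n - p) (?u f)) \<noteq> 0}" for f
  define S where "S = Sigma (splits ws e) A"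
  have finA: "finite (A f)" for f unfolding A_def by (rule finite_E_field_support[OF ab])
  have finS: "finite S" unfolding S_def using IH(1) finA by simp
  have word: "PM_word (w # ws) f (e - f) = P a (lookup f v) (M b (?n - lookup f v) (PM_word ws f (e - f)))" for f
    by (simp add: PM_word_def w lookup_minus)
  have upd: "?u (f + single v p) = ?u f" for f p
    by (rule PM_word_cong) (use v in \<open>auto simp: lookup_add lookup_minus lookup_single when_def image_iff\<close>)
  have key: "lookup f v = 0" if "f \<in> splits ws e" for f
    using that v by (auto simp: splits_def in_keys_iff)
  have S_eq: "splits (w # ws) e = (\<lambda>(f, p). f + single v p) ` S"
  proof (intro set_eqI iffI)
    fix f assume f: "f \<in> splits (w # ws) e"
    let ?p = "lookup f v"
    let ?f = "f - single v ?p"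
    have u: "?u ?f = ?u f" using upd[of ?f ?p] by simp
    have nz: "P a ?p (M b (?n - ?p) (?u f)) \<noteq> 0" using f by (simp add: splits_def word)
    then have "?u f \<noteq> 0" by (auto simp: fermion_lin)
    moreover have "keys ?f \<subseteq> word_vars ws"
    proof
      fix x assume x: "x \<in> keys ?f"
      then have "x \<noteq> v" by (auto simp: in_keys_iff lookup_minus lookup_single)
      then have "x \<in> keys f" using x by (simp add: in_keys_iff lookup_minus lookup_single)
      then show "x \<in> word_vars ws" using f \<open>x \<noteq> v\<close> by (auto simp: splits_def w)
    qed
    ultimately have "?f \<in> splits ws e" by (simp add: splits_def u)
    then have "(?f, ?p) \<in> S" using nz by (simp add: S_def A_def u)
    then show "f \<in> (\<lambda>(f, p). f + single v p) ` S" by (intro image_eqI[of _ _ "(?f, ?p)"]) simp_all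
  next
    fix f' assume "f' \<in> (\<lambda>(f, p). f + single v p) ` S"
    then obtain f p where f': "f' = f + single v p" "f \<in> splits ws e" "p \<in> A f" by (auto simp: S_def)
    have "lookup f' v = p" by (simp add: f'(1) lookup_add key[OF f'(2)])
    then have "PM_word (w # ws) f' (e - f') \<noteq> 0"
      using f'(3) upd[of f p] by (simp add: word A_def f'(1))
    moreover have "keys f' \<subseteq> word_vars (w # ws)"
      using f'(2) keys_add[of f "single v p"] by (auto simp: f'(1) splits_def w split: if_splits)
    ultimately show "f' \<in> splits (w # ws) e" by (simp add: splits_def)
  qed
  have inj: "inj_on (\<lambda>(f, p). f + single v p) S"
  proof (rule inj_onI)
    fix x y assume xy: "x \<in> S" "y \<in> S" "(\<lambda>(f, p). f + single v p) x = (\<lambda>(f, p). f + single v p) y"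
    obtain f p g q where x: "x = (f, p)" and y: "y = (g, q)" by fastforce
    have "f \<in> splits ws e" "g \<in> splits ws e" using xy(1,2) by (auto simp: x y S_def)
    then have "p = q" using arg_cong[OF xy(3), of "\<lambda>h. lookup h v"]
      by (simp add: x y lookup_add key)
    then show "x = y" using xy(3) by (simp add: x y)
  qed
  have "E_word (w # ws) e = E_field a b ?n (\<Sum>f\<in>splits ws e. ?u f)"
    using IH(2) by (simp add: E_word_def w)
  also have "\<dots> = (\<Sum>f\<in>splits ws e. E_field a b ?n (?u f))"
    by (rule module_hom.sum[OF lin_E_field[OF ab]])
  also have "\<dots> = (\<Sum>f\<in>splits ws e. \<Sum>p\<in>A f. P a p (M b (?n - p) (?u f)))"
    by (simp add: E_field_def A_def)
  also have "\<dots> = (\<Sum>(f, p)\<in>S. P a p (M b (?n - p) (?u f)))"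
    unfolding S_def using IH(1) finA by (intro sum.Sigma) auto
  also have "\<dots> = (\<Sum>(f, p)\<in>S. PM_word (w # ws) (f + single v p) (e - (f + single v p)))"
  proof (rule sum.cong[OF refl])
    fix x assume "x \<in> S"
    then obtain f p where x: "x = (f, p)" "f \<in> splits ws e" by (auto simp: S_def)
    have "lookup (f + single v p) v = p" by (simp add: lookup_add key[OF x(2)])
    then show "(case x of (f, p) \<Rightarrow> P a p (M b (?n - p) (?u f))) =
        (case x of (f, p) \<Rightarrow> PM_word (w # ws) (f + single v p) (e - (f + single v p)))"
      by (simp only: x(1) prod.case word upd)
  qed
  also have "\<dots> = (\<Sum>f\<in>splits (w # ws) e. PM_word (w # ws) f (e - f))"
    unfolding S_eq sum.reindex[OF inj] by (simp add: case_prod_unfold)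
  finally show ?case using finS S_eq by simp
qed


subsection \<open>Collecting the components\<close>

lemma foldr_foldr_anticommute:
  assumes "\<And>x. lin (F x)" "\<And>y. lin (G y)" "\<And>x y v. F x (G y v) = - G y (F x v)"
  shows "foldr F as (foldr G bs w) = scale ((- 1) ^ (length as * length bs)) (foldr G bs (foldr F as w))"
proof (induction bs)
  case (Cons b bs)
  have "foldr F as (foldr G (b # bs) w) = foldr F as (G b (foldr G bs w))" by simp
  also have "\<dots> = scale ((- 1) ^ length as) (G b (foldr F as (foldr G bs w)))"
    by (rule foldr_anticommute) (rule assms(1), rule assms(3), rule assms(2))
  finally show ?case by (simp add: Cons lin_scale[OF assms(2)] power_add)
qed simp

lemma foldr_PM:
  assumes "a \<noteq> b"
  shows "foldr (\<lambda>v w. P a (f v) (M b (g v) w)) vs w =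
    scale ((- 1) ^ tri (length vs)) (foldr (P a) (map f vs) (foldr (M b) (map g vs) w))"
proof (induction vs)
  case (Cons v vs)
  have "foldr (P a) (map f vs) (M b (g v) u) =
      scale ((- 1) ^ length vs) (M b (g v) (foldr (P a) (map f vs) u))" for u
    using foldr_anticommute[of "P a" "M b (g v)" "map f vs" u] assms by (simp add: lin_P lin_M P_M)
  then have "M b (g v) (foldr (P a) (map f vs) u) =
      scale ((- 1) ^ length vs) (foldr (P a) (map f vs) (M b (g v) u))" for u
    by (simp add: sign_square)
  then show ?case by (simp add: Cons fermion_lin power_add)
qed simp

definition word :: "nat \<Rightarrow> nat \<Rightarrow> nat \<Rightarrow> word" where
  "word nc nd ne = map (\<lambda>v. (1, 0, v)) (xvars nc) @ map (\<lambda>v. (2, 0, v)) (yvars nd) @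
    map (\<lambda>v. (2, 1, v)) (zvars ne)"

text \<open>
  Separating the \<open>n\<close> pairs of one kind gives \<open>tri n\<close>. Of the exchanges between different kinds, those
  of the pairs of \<open>E\<^sub>2\<^sub>0\<close> with the others occur an even number of times, and an odd number remains for
  the pairs of \<open>E\<^sub>1\<^sub>0\<close> and \<open>E\<^sub>2\<^sub>1\<close>.
\<close>

lemma PM_word_reorder:
  "PM_word (word nc nd ne) f g = scale ((- 1) ^ (tri nc + tri nd + tri ne + nc * ne))
    (Ps 2 (yvars nd @ zvars ne) f (Ps 1 (xvars nc) f
      (Ms 1 (zvars ne) g (Ms 0 (xvars nc @ yvars nd) g vac))))"
proof -
  let ?P1 = "Ps 1 (xvars nc) f" and ?M0x = "Ms 0 (xvars nc) g"
  let ?P2y = "Ps 2 (yvars nd) f" and ?M0y = "Ms 0 (yvars nd) g"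
  let ?P2z = "Ps 2 (zvars ne) f" and ?M1 = "Ms 1 (zvars ne) g"
  let ?s = "\<lambda>n. (- 1) ^ n :: complex"
  have ne: "(1::3) \<noteq> 0" "(2::3) \<noteq> 0" "(2::3) \<noteq> 1" by simp_all
  have scale: "foldr (P a) ps (scale c w) = scale c (foldr (P a) ps w)"
    "foldr (M a) ps (scale c w) = scale c (foldr (M a) ps w)" for a ps c w
    by (rule lin_scale, rule lin_foldr, rule lin_P, rule lin_scale, rule lin_foldr, rule lin_M)
  have PP: "foldr (P a) ps (foldr (P b) qs w) = scale (?s (length ps * length qs)) (foldr (P b) qs (foldr (P a) ps w))"
    for a b ps qs w by (rule foldr_foldr_anticommute) (rule lin_P, rule lin_P, rule P_P)
  have MM: "foldr (M a) ps (foldr (M b) qs w) = scale (?s (length ps * length qs)) (foldr (M b) qs (foldr (M a) ps w))"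
    for a b ps qs w by (rule foldr_foldr_anticommute) (rule lin_M, rule lin_M, rule M_M)
  have MP: "foldr (M a) ps (foldr (P b) qs w) = scale (?s (length ps * length qs)) (foldr (P b) qs (foldr (M a) ps w))"
    if "a \<noteq> b" for a b ps qs w
    by (rule foldr_foldr_anticommute) (rule lin_M, rule lin_P, simp add: M_P that that[symmetric])
  have "PM_word (word nc nd ne) f g = foldr (\<lambda>v w. P 1 (lookup f v) (M 0 (lookup g v) w)) (xvars nc)
      (foldr (\<lambda>v w. P 2 (lookup f v) (M 0 (lookup g v) w)) (yvars nd)
      (foldr (\<lambda>v w. P 2 (lookup f v) (M 1 (lookup g v) w)) (zvars ne) vac))"
    by (simp add: PM_word_def word_def foldr_map comp_def case_prod_unfold)
  also have "\<dots> = scale (?s (tri nc + tri nd + tri ne)) (?P1 (?M0x (?P2y (?M0y (?P2z (?M1 vac))))))"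
    by (simp only: foldr_PM[OF ne(1)] foldr_PM[OF ne(2)] foldr_PM[OF ne(3)] scale fock.scale_scale
        power_add length_map length_upt diff_Suc_1 mult.assoc)
  also have "?M0y (?P2z (?M1 vac)) = scale (?s (nd * ne) * ?s (nd * ne)) (?P2z (?M1 (?M0y vac)))"
    by (simp add: MP MM[of 0 _ 1] scale)
  also have "?M0x (?P2y (scale (?s (nd * ne) * ?s (nd * ne)) (?P2z (?M1 (?M0y vac))))) =
      scale (?s (nc * nd) * (?s (nc * ne) * ?s (nc * ne))) (?P2y (?P2z (?M1 (?M0x (?M0y vac)))))"
    by (simp add: MP MM[of 0 _ 1] scale sign_square mult_ac)
  also have "?P1 (scale (?s (nc * nd) * (?s (nc * ne) * ?s (nc * ne))) (?P2y (?P2z (?M1 (?M0x (?M0y vac)))))) =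
      scale (?s (nc * ne)) (?P2y (?P2z (?P1 (?M1 (?M0x (?M0y vac))))))"
    by (simp add: PP[of 1 _ 2] scale sign_square mult_ac)
  finally show ?thesis by (simp add: power_add mult_ac)
qed

text \<open>The sign of the reordering times that of the translated vacuum.\<close>

lemma sign_eq:
  "(- 1) ^ (tri nc + tri nd + tri ne + nc * ne) *
    (- 1) ^ (tri (nc + nd) + tri (nd + ne) + (nc + nd) * (nd + ne)) =
    ((- 1) ^ (nd * (nd + 1) div 2) :: complex)"
  unfolding tri_eq tri_add power_add[symmetric] minus_one_power_iff
  by (simp only: even_add even_mult_iff) auto

lemma set_vars [simp]:
  "x_var i \<in> set (yvars n) \<longleftrightarrow> False" "x_var i \<in> set (zvars n) \<longleftrightarrow> False"
  "y_var i \<in> set (xvars n) \<longleftrightarrow> False" "y_var i \<in> set (zvars n) \<longleftrightarrow> False"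
  "z_var i \<in> set (xvars n) \<longleftrightarrow> False" "z_var i \<in> set (yvars n) \<longleftrightarrow> False"
  by auto

text \<open>
  Expanding the bilinear fields distributes each exponent over the two components involved, and so
  does the product of the three one-component series: a distribution \<open>f\<close> of \<open>e\<close> corresponds to the
  exponents of the three factors.
\<close>

theorem E_word_correlator:
  assumes e: "keys e \<subseteq> set (xvars nc) \<union> set (yvars nd) \<union> set (zvars ne)"
  shows "tau_bra (nc + nd) (nd + ne) (E_word (word nc nd ne) e) =
    (- 1) ^ (nd * (nd + 1) div 2) * p_series nc nd ne e"
proof -
  let ?X = "set (xvars nc)" and ?Y = "set (yvars nd)" and ?Z = "set (zvars ne)"
  let ?V2 = "diff_prod (pairs (yvars nd @ zvars ne))" and ?V0 = "diff_prod (pairs (xvars nc @ yvars nd))"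
  let ?V1 = "diff_prod (pairs (xvars nc)) * diff_prod (pairs (zvars ne)) * inv_cross nc ne"
  let ?c2 = "\<lambda>f. restr (?Y \<union> ?Z) f" and ?c1 = "\<lambda>f. restr ?X f + restr ?Z (e - f)"
  let ?c0 = "\<lambda>f. restr (?X \<union> ?Y) (e - f)"
  let ?t = "\<lambda>f. coef ?V2 (?c2 f) * coef ?V1 (?c1 f) * coef ?V0 (?c0 f)"
  let ?\<beta> = "tau_bra (nc + nd) (nd + ne)" and ?w = "word nc nd ne"
  let ?s = "(- 1) ^ (nd * (nd + 1) div 2) :: complex"
  have disj: "?X \<inter> ?Y = {}" "?X \<inter> ?Z = {}" "?Y \<inter> ?Z = {}" by auto
  have hom: "module_hom scale (*) ?\<beta>" using bra_tau by (simp add: bra_def)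
  have vars: "word_vars ?w = ?X \<union> ?Y \<union> ?Z" by (simp add: word_def image_Un image_image Un_assoc)
  have PM: "?\<beta> (PM_word ?w f g) = ?s * (coef ?V2 (restr (?Y \<union> ?Z) f) *
      coef ?V1 (restr ?X f + restr ?Z g) * coef ?V0 (restr (?X \<union> ?Y) g))" for f g
  proof -
    have c: "charges (nc + nd) (nd + ne) 0 = - int (nc + nd)"
      "charges (nc + nd) (nd + ne) 1 = int nc - int ne" "charges (nc + nd) (nd + ne) 2 = int (nd + ne)"
      by simp_all
    show ?thesis
      unfolding PM_word_reorder module_hom.scale[OF hom] three_component_correlator[OF bra_tau c]
        extremal_vector tau_bra_extremal set_append
      by (simp only: mult.assoc[symmetric] sign_eq)
  qed
  have words: "finite (splits ?w e)" "E_word ?w e = (\<Sum>f\<in>splits ?w e. PM_word ?w f (e - f))"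
  proof -
    have "distinct (map (\<lambda>(a, b, v). v) ?w)"
      by (auto simp: word_def comp_def distinct_map inj_on_def)
    moreover have "a \<noteq> b" if "(a, b, v) \<in> set ?w" for a b v using that by (auto simp: word_def)
    ultimately show "finite (splits ?w e)" "E_word ?w e = (\<Sum>f\<in>splits ?w e. PM_word ?w f (e - f))"
      using E_word_splits by blast+
  qed
  let ?S = "{f. keys f \<subseteq> ?X \<union> ?Y \<union> ?Z \<and> coef ?V2 (?c2 f) \<noteq> 0 \<and> coef ?V1 (?c1 f) \<noteq> 0 \<and> coef ?V0 (?c0 f) \<noteq> 0}"
  let ?T = "{(a, b, c). a + b + c = e \<and> coef ?V2 a \<noteq> 0 \<and> coef ?V1 b \<noteq> 0 \<and> coef ?V0 c \<noteq> 0}"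
  \<comment> \<open>a product of modes may be nonzero and still pair to zero, so that \<open>splits\<close> can be larger\<close>
  have sub: "?S \<subseteq> splits ?w e"
  proof
    fix f assume f: "f \<in> ?S"
    then have "?\<beta> (PM_word ?w f (e - f)) \<noteq> 0" unfolding PM by simp
    then have "PM_word ?w f (e - f) \<noteq> 0" using module_hom.zero[OF hom] by metis
    then show "f \<in> splits ?w e" using f by (simp add: splits_def vars)
  qed
  have supp: "supported (?Y \<union> ?Z) ?V2" "supported (?X \<union> ?Z) ?V1" "supported (?X \<union> ?Y) ?V0"
    by (rule supported_pairs, simp, intro supported_times supported_pairs supported_inv_cross, simp, simp,
        rule supported_pairs, simp)
  have off: "lookup g v = 0" if "keys g \<subseteq> U" "v \<notin> U" for g :: res_mono and U v
    using that by (auto simp: in_keys_iff)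
  have "?\<beta> (E_word ?w e) = (\<Sum>f\<in>splits ?w e. ?s * ?t f)"
    unfolding words(2) module_hom.sum[OF hom] PM ..
  also have "\<dots> = (\<Sum>f\<in>?S. ?s * ?t f)"
    by (rule sum.mono_neutral_right[OF words(1) sub]) (auto simp: splits_def vars)
  also have "\<dots> = ?s * (\<Sum>f\<in>?S. ?t f)" by (rule sum_distrib_left[symmetric])
  also have "(\<Sum>f\<in>?S. ?t f) = (\<Sum>(a, b, c)\<in>?T. coef ?V2 a * coef ?V1 b * coef ?V0 c)"
  proof (rule sum.reindex_bij_witness[of _ "\<lambda>(a, b, c). a + restr ?X b" "\<lambda>f. (?c2 f, ?c1 f, ?c0 f)"])
    fix f assume f: "f \<in> ?S"
    then have kf: "keys f \<subseteq> ?X \<union> ?Y \<union> ?Z" by simp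
    show "(case (?c2 f, ?c1 f, ?c0 f) of (a, b, c) \<Rightarrow> a + restr ?X b) = f"
    proof (rule poly_mapping_eqI)
      fix v
      show "lookup (case (?c2 f, ?c1 f, ?c0 f) of (a, b, c) \<Rightarrow> a + restr ?X b) v = lookup f v"
        using disj off[OF kf, of v] by (auto simp: lookup_add)
    qed
    have "?c2 f + ?c1 f + ?c0 f = e"
    proof (rule poly_mapping_eqI)
      fix v
      show "lookup (?c2 f + ?c1 f + ?c0 f) v = lookup e v"
        using disj off[OF kf, of v] off[OF e, of v] by (auto simp: lookup_add lookup_minus)
    qed
    then show "(?c2 f, ?c1 f, ?c0 f) \<in> ?T" using f by simp
  next
    fix p assume "p \<in> ?T"
    then obtain a b c where p: "p = (a, b, c)" "a + b + c = e"
      and nz: "coef ?V2 a \<noteq> 0" "coef ?V1 b \<noteq> 0" "coef ?V0 c \<noteq> 0" by auto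
    have k: "keys a \<subseteq> ?Y \<union> ?Z" "keys b \<subseteq> ?X \<union> ?Z" "keys c \<subseteq> ?X \<union> ?Y"
      using supp nz by (auto simp: supported_def)
    let ?f = "a + restr ?X b"
    note e_eq = p(2)[symmetric]
    have a: "?c2 ?f = a"
    proof (rule poly_mapping_eqI)
      fix v show "lookup (?c2 ?f) v = lookup a v"
        using disj off[OF k(1), of v] by (auto simp: lookup_add)
    qed
    have b: "?c1 ?f = b"
    proof (rule poly_mapping_eqI)
      fix v show "lookup (?c1 ?f) v = lookup b v"
        using disj off[OF k(1), of v] off[OF k(2), of v] off[OF k(3), of v]
        by (auto simp: lookup_add lookup_minus e_eq)
    qed
    have c: "?c0 ?f = c"
    proof (rule poly_mapping_eqI)
      fix v show "lookup (?c0 ?f) v = lookup c v"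
        using disj off[OF k(1), of v] off[OF k(2), of v] off[OF k(3), of v]
        by (auto simp: lookup_add lookup_minus e_eq)
    qed
    show "(?c2 (case p of (a, b, c) \<Rightarrow> a + restr ?X b), ?c1 (case p of (a, b, c) \<Rightarrow> a + restr ?X b),
        ?c0 (case p of (a, b, c) \<Rightarrow> a + restr ?X b)) = p"
      by (simp only: p(1) prod.case a b c)
    have "keys ?f \<subseteq> ?X \<union> ?Y \<union> ?Z"
      using keys_add[of a "restr ?X b"] k(1) by (auto simp: keys_restr)
    then show "(case p of (a, b, c) \<Rightarrow> a + restr ?X b) \<in> ?S"
      using nz by (simp only: p(1) prod.case a b c mem_Collect_eq) simp
  qed simp
  also have "\<dots> = p_series nc nd ne e" unfolding p_series_eq coef_triple ..
  finally show ?thesis .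
qed

lemma E_word_other_charge:
  assumes "k \<noteq> nc + nd \<or> l \<noteq> nd + ne"
  shows "tau_bra k l (E_word (word nc nd ne) e) = 0"
proof -
  have ne: "(0::3) \<noteq> 1" "(0::3) \<noteq> 2" "(1::3) \<noteq> 2" by simp_all
  have "has_charge (\<lambda>_. 0) vac"
  proof -
    have "charged_vac (\<lambda>_. 0) = vac_wedge"
      by (rule wedge_eqI) (simp add: charged_vac.rep_eq vac_set_def)
    then have "charge a vac_wedge = 0" for a using charge_charged_vac[of a "\<lambda>_. 0"] by simp
    then show ?thesis by (auto simp: has_charge_def vac_def wedge_vec_def lookup_single when_def)
  qed
  note has_charge_foldr_E_field[OF has_charge_foldr_E_field[OF has_charge_foldr_E_field[OF this
    ne(3)[symmetric], of "map (lookup e) (zvars ne)"] ne(2)[symmetric], of "map (lookup e) (yvars nd)"]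
    ne(1)[symmetric], of "map (lookup e) (xvars nc)"]
  moreover have "E_word (word nc nd ne) e = foldr (E_field 1 0) (map (lookup e) (xvars nc))
      (foldr (E_field 2 0) (map (lookup e) (yvars nd)) (foldr (E_field 2 1) (map (lookup e) (zvars ne)) vac))"
    by (simp add: E_word_def word_def foldr_map comp_def case_prod_unfold)
  ultimately obtain c where c: "has_charge c (E_word (word nc nd ne) e)"
      "c 0 = - int (nc + nd)" "c 2 = int (nd + ne)"
    by (simp add: fun_upd_def)
  let ?T = "(T1 ^^ k) ((T2 ^^ l) vac)"
  have "lookup (E_word (word nc nd ne) e) (charged_vac (charges k l)) = 0"
  proof (rule ccontr)
    assume "lookup (E_word (word nc nd ne) e) (charged_vac (charges k l)) \<noteq> 0"
    then have "charge a (charged_vac (charges k l)) = c a" for a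
      using c(1) unfolding has_charge_def by blast
    then have "charges k l a = c a" for a unfolding charge_charged_vac .
    from this[of 0] this[of 2] show False using assms c(2,3) by simp
  qed
  then show ?thesis
    unfolding tau_bra_def fock_form_eq std_form_signed_wedge(1)[OF signed_wedge_tau] by simp
qed


section \<open>Expansion in the formal variables\<close>

context
  fixes \<alpha> \<beta> :: int
begin

definition coeff_of :: "res_var \<Rightarrow> int \<Rightarrow> coeff_var" where
  "coeff_of v n = (case v of x_var i \<Rightarrow> c_var (\<alpha> - \<beta> - n - 1)
     | y_var i \<Rightarrow> d_var (\<alpha> - n - 1) | z_var i \<Rightarrow> e_var (\<beta> - n - 1))"

definition sign_of :: "res_var \<Rightarrow> complex" where
  "sign_of v = (- 1) powi (case v of x_var i \<Rightarrow> \<alpha> - \<beta> | y_var i \<Rightarrow> \<alpha> | z_var i \<Rightarrow> \<beta>)"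

text \<open>
  The kind of a residue variable determines the series and the field that are evaluated at it.
\<close>

definition series_of :: "res_var \<Rightarrow> int \<Rightarrow> coeff_series" where
  "series_of v = (case v of x_var i \<Rightarrow> twist (\<alpha> - \<beta>) C_series
     | y_var i \<Rightarrow> twist \<alpha> D_series | z_var i \<Rightarrow> twist \<beta> E_series)"

definition field_of :: "res_var \<Rightarrow> int \<Rightarrow> fock \<Rightarrow> fock" where
  "field_of v = (case v of x_var i \<Rightarrow> E_field 1 0 | y_var i \<Rightarrow> E_field 2 0 | z_var i \<Rightarrow> E_field 2 1)"

lemma series_of_eq:
  "series_of v n m = (if m = single (coeff_of v n) 1 then sign_of v else 0)"
  by (auto simp: series_of_def coeff_of_def sign_of_def twist_def C_series_def D_series_def
      E_series_def gen_series_def algebra_simps split: res_var.split)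

lemma sign_of_nonzero: "sign_of v \<noteq> 0"
  by (simp add: sign_of_def)

lemma inj_coeff_of: "inj (coeff_of v)"
  by (rule injI) (auto simp: coeff_of_def split: res_var.splits)

lemma lin_field_of: "lin (field_of v n)"
  by (cases v) (simp_all add: field_of_def lin_E_field)

text \<open>
  The coefficient of the monomial \<open>e\<close> in the residue variables \<open>U\<close> of the product of their series is,
  up to sign, a single monomial in the variables \<open>c\<^sub>i, d\<^sub>i, e\<^sub>i\<close>; \<open>exponents\<close> are those \<open>e\<close> that lead to a
  given one. Summing over them expresses both sides of the theorem.
\<close>

definition monomial_of :: "res_var set \<Rightarrow> res_mono \<Rightarrow> coeff_mono" where
  "monomial_of U e = (\<Sum>v\<in>U. single (coeff_of v (lookup e v)) 1)"

definition exponents :: "res_var set \<Rightarrow> coeff_mono \<Rightarrow> res_mono set" where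
  "exponents U m = {e. keys e \<subseteq> U \<and> monomial_of U e = m}"

lemma lookup_sum_nat_pos:
  assumes "finite U" "v \<in> U"
  shows "c \<in> keys (f v) \<Longrightarrow> c \<in> keys (\<Sum>v\<in>U. f v :: 'a \<Rightarrow>\<^sub>0 nat)"
  using assms by (auto simp: in_keys_iff lookup_sum)

lemma finite_exponents:
  assumes "finite U"
  shows "finite (exponents U m)"
proof -
  let ?B = "\<Union>v\<in>U. {n. coeff_of v n \<in> keys m}"
  have "lookup ` exponents U m \<subseteq> {f. \<forall>v. (v \<in> U \<longrightarrow> f v \<in> ?B) \<and> (v \<notin> U \<longrightarrow> f v = 0)}"
  proof (rule image_subsetI, rule CollectI, intro allI conjI impI)
    fix e v assume e: "e \<in> exponents U m"
    { assume v: "v \<in> U"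
      have "coeff_of v (lookup e v) \<in> keys (monomial_of U e)"
        unfolding monomial_of_def by (rule lookup_sum_nat_pos[OF assms v]) simp
      then have "lookup e v \<in> {n. coeff_of v n \<in> keys m}" using e by (simp add: exponents_def)
      then show "lookup e v \<in> ?B" using v by blast }
    { assume "v \<notin> U"
      then show "lookup e v = 0" using e by (auto simp: exponents_def in_keys_iff) }
  qed
  moreover have "finite ?B"
    using assms finite_vimageI[OF finite_keys inj_coeff_of] by (auto simp: vimage_def)
  then have "finite {f. \<forall>v. (v \<in> U \<longrightarrow> f v \<in> ?B) \<and> (v \<notin> U \<longrightarrow> f v = (0::int))}"
    using assms by (intro finite_set_of_finite_funs)
  ultimately have "finite (lookup ` exponents U m)" by (rule finite_subset)
  then show ?thesis by (rule finite_imageD) (auto intro!: inj_onI poly_mapping_eqI)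
qed


subsection \<open>The residues\<close>

text \<open>The product of the series at the variables \<open>U\<close>.\<close>

definition var_dist :: "res_var set \<Rightarrow> dist" where
  "var_dist U = (\<lambda>(e, m). if e \<in> exponents U m then \<Prod>v\<in>U. sign_of v else 0)"

text \<open>
  The exponent of the product determines the exponents of the factors, so that at most one term
  contributes to each coefficient.
\<close>

lemma series_prod_at_var:
  assumes "finite I" "inj_on u I"
  shows "series_prod I (\<lambda>i. at_var (series_of (u i)) (u i)) = var_dist (u ` I)"
proof (rule ext)
  fix em :: "res_mono \<times> coeff_mono"
  obtain e m where em: "em = (e, m)" by fastforce
  let ?f = "\<lambda>i. at_var (series_of (u i)) (u i)"
  let ?c = "\<lambda>i n. single (coeff_of (u i) n) 1 :: coeff_mono"
  let ?\<phi> = "\<lambda>i\<in>I. (single (u i) (lookup e (u i)), ?c i (lookup e (u i)))"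
  let ?G = "{\<phi> \<in> Pi\<^sub>E I (\<lambda>i. {a. ?f i a \<noteq> 0}). (\<Sum>i\<in>I. \<phi> i) = em}"
  have nz: "?f i a \<noteq> 0 \<longleftrightarrow> (\<exists>n. a = (single (u i) n, ?c i n))" for i a
    by (cases a) (auto simp: at_var_def series_of_eq sign_of_nonzero)
  have val: "?f i (single (u i) n, ?c i n) = sign_of (u i)" for i n
    by (simp add: at_var_def series_of_eq)
  have look: "lookup (\<Sum>i\<in>I. single (u i) (t i)) (u j) = t j" if "j \<in> I" for t :: "_ \<Rightarrow> int" and j
  proof -
    have "lookup (\<Sum>i\<in>I. single (u i) (t i)) (u j) = (\<Sum>i\<in>I. if i = j then t i else 0)"
      unfolding lookup_sum using that assms(2)
      by (intro sum.cong) (auto simp: lookup_single when_def inj_on_def)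
    then show ?thesis using that assms(1) by simp
  qed
  have sub: "?G \<subseteq> {?\<phi>}"
  proof
    fix \<phi> assume G: "\<phi> \<in> ?G"
    then have "\<forall>i\<in>I. \<exists>n. \<phi> i = (single (u i) n, ?c i n)" using nz by (auto simp: PiE_iff)
    then obtain t where t: "\<And>i. i \<in> I \<Longrightarrow> \<phi> i = (single (u i) (t i), ?c i (t i))" by metis
    have "e = fst (\<Sum>i\<in>I. \<phi> i)" using G em by simp
    also have "\<dots> = (\<Sum>i\<in>I. single (u i) (t i))" unfolding fst_sum using t by (intro sum.cong) auto
    finally have "lookup e (u i) = t i" if "i \<in> I" for i using look[OF that] by simp
    then have "\<phi> i = ?\<phi> i" for i using t G by (cases "i \<in> I") (auto simp: PiE_iff extensional_def)
    then show "\<phi> \<in> {?\<phi>}" by auto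
  qed
  have \<phi>: "?\<phi> \<in> Pi\<^sub>E I (\<lambda>i. {a. ?f i a \<noteq> 0})" using nz by auto
  have "(\<Sum>i\<in>I. ?\<phi> i) = (\<Sum>i\<in>I. single (u i) (lookup e (u i)), monomial_of (u ` I) e)"
    by (intro prod_eqI) (simp_all add: fst_sum snd_sum monomial_of_def sum.reindex[OF assms(2)])
  moreover have "(\<Sum>i\<in>I. single (u i) (lookup e (u i))) = e \<longleftrightarrow> keys e \<subseteq> u ` I"
  proof
    assume *: "keys e \<subseteq> u ` I"
    show "(\<Sum>i\<in>I. single (u i) (lookup e (u i))) = e"
    proof (rule poly_mapping_eqI)
      fix v
      show "lookup (\<Sum>i\<in>I. single (u i) (lookup e (u i))) v = lookup e v"
      proof (cases "v \<in> u ` I")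
        case True
        then show ?thesis using look by auto
      next
        case False
        then have "lookup (\<Sum>i\<in>I. single (u i) (lookup e (u i))) v = 0"
          unfolding lookup_sum by (intro sum.neutral) (auto simp: lookup_single when_def)
        then show ?thesis using * False by (auto simp: in_keys_iff)
      qed
    qed
  next
    assume *: "(\<Sum>i\<in>I. single (u i) (lookup e (u i))) = e"
    show "keys e \<subseteq> u ` I"
    proof
      fix v assume "v \<in> keys e"
      then have "lookup (\<Sum>i\<in>I. single (u i) (lookup e (u i))) v \<noteq> 0" using * by (simp add: in_keys_iff)
      then obtain i where "i \<in> I" "lookup (single (u i) (lookup e (u i))) v \<noteq> 0"
        unfolding lookup_sum using sum.not_neutral_contains_not_neutral by blast
      then show "v \<in> u ` I" by (auto simp: lookup_single when_def split: if_splits)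
    qed
  qed
  ultimately have in_G: "?\<phi> \<in> ?G \<longleftrightarrow> e \<in> exponents (u ` I) m"
    using \<phi> by (auto simp: em exponents_def)
  show "series_prod I ?f em = var_dist (u ` I) em"
  proof (cases "e \<in> exponents (u ` I) m")
    case True
    then have "?G = {?\<phi>}" using in_G sub by blast
    then have "series_prod I ?f em = (\<Prod>i\<in>I. ?f i (?\<phi> i))" unfolding series_prod_def by simp
    also have "\<dots> = (\<Prod>i\<in>I. sign_of (u i))"
    proof (rule prod.cong[OF refl])
      fix i assume "i \<in> I"
      then have "?\<phi> i = (single (u i) (lookup e (u i)), ?c i (lookup e (u i)))" by simp
      then show "?f i (?\<phi> i) = sign_of (u i)" by (simp only: val)
    qed
    finally show ?thesis using True by (simp add: em var_dist_def prod.reindex[OF assms(2)])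
  next
    case False
    then have "?G = {}" using in_G sub by blast
    then have "series_prod I ?f em = 0" unfolding series_prod_def by (simp only: sum.empty)
    then show ?thesis using False by (simp add: em var_dist_def)
  qed
qed

lemma var_dist_times:
  assumes "finite U" "finite W" "U \<inter> W = {}"
  shows "var_dist U \<star> var_dist W = var_dist (U \<union> W)"
proof (rule ext)
  fix em :: "res_mono \<times> coeff_mono"
  obtain e m where em: "em = (e, m)" by fastforce
  let ?a = "(restr U e, monomial_of U e)" and ?b = "(restr W e, monomial_of W e)"
  let ?S = "{(a, b). a + b = em \<and> var_dist U a \<noteq> 0 \<and> var_dist W b \<noteq> 0}"
  have cong: "monomial_of U f = monomial_of U g" if "\<And>v. v \<in> U \<Longrightarrow> lookup f v = lookup g v" for U f g
    unfolding monomial_of_def using that by (intro sum.cong) auto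
  have nz: "var_dist U (f, l) \<noteq> 0 \<longleftrightarrow> f \<in> exponents U l" if "finite U" for U f l
    using that by (auto simp: var_dist_def sign_of_nonzero)
  have sub: "?S \<subseteq> {(?a, ?b)}"
  proof
    fix x assume x: "x \<in> ?S"
    obtain f l g k where x_eq: "x = ((f, l), (g, k))" by (metis prod.collapse)
    have f: "keys f \<subseteq> U" "monomial_of U f = l" and g: "keys g \<subseteq> W" "monomial_of W g = k"
      and e: "e = f + g"
      using x nz assms by (auto simp: x_eq em exponents_def)
    have f0: "lookup f v = 0" if "v \<notin> U" for v using f(1) that by (auto simp: in_keys_iff)
    have g0: "lookup g v = 0" if "v \<notin> W" for v using g(1) that by (auto simp: in_keys_iff)
    have "restr U e = f"
      by (rule poly_mapping_eqI) (use f0 g0 assms(3) in \<open>auto simp: e lookup_add\<close>)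
    moreover have "restr W e = g"
      by (rule poly_mapping_eqI) (use f0 g0 assms(3) in \<open>auto simp: e lookup_add\<close>)
    moreover have "monomial_of U e = l"
      unfolding f(2)[symmetric] by (rule cong) (use g0 assms(3) in \<open>auto simp: e lookup_add\<close>)
    moreover have "monomial_of W e = k"
      unfolding g(2)[symmetric] by (rule cong) (use f0 assms(3) in \<open>auto simp: e lookup_add\<close>)
    ultimately show "x \<in> {(?a, ?b)}" by (simp add: x_eq)
  qed
  have "restr U e + restr W e = e \<longleftrightarrow> keys e \<subseteq> U \<union> W"
  proof
    assume "restr U e + restr W e = e"
    then show "keys e \<subseteq> U \<union> W" using keys_add[of "restr U e" "restr W e"] by (auto simp: keys_restr)
  next
    assume *: "keys e \<subseteq> U \<union> W"
    show "restr U e + restr W e = e"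
    proof (rule poly_mapping_eqI)
      fix v
      have "lookup e v = 0" if "v \<notin> U" "v \<notin> W" using that * by (auto simp: in_keys_iff)
      then show "lookup (restr U e + restr W e) v = lookup e v"
        using assms(3) by (auto simp: lookup_add)
    qed
  qed
  moreover have "monomial_of U e + monomial_of W e = monomial_of (U \<union> W) e"
    unfolding monomial_of_def using assms by (simp add: sum.union_disjoint)
  moreover have "restr U e \<in> exponents U (monomial_of U e)" for U
    by (auto simp: exponents_def keys_restr intro!: cong)
  ultimately have in_S: "(?a, ?b) \<in> ?S \<longleftrightarrow> e \<in> exponents (U \<union> W) m"
    using nz assms by (auto simp: em exponents_def)
  have val: "var_dist U (restr U e, monomial_of U e) = (\<Prod>v\<in>U. sign_of v)" for U
    by (auto simp: var_dist_def exponents_def keys_restr intro!: cong)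
  show "(var_dist U \<star> var_dist W) em = var_dist (U \<union> W) em"
  proof (cases "e \<in> exponents (U \<union> W) m")
    case True
    then have "?S = {(?a, ?b)}" using in_S sub by blast
    then have "(var_dist U \<star> var_dist W) em = var_dist U ?a * var_dist W ?b"
      unfolding series_times_def by simp
    then show ?thesis using True assms by (simp add: val em prod.union_disjoint) (simp add: var_dist_def prod.union_disjoint)
  next
    case False
    then have "?S = {}" using in_S sub by blast
    then have "(var_dist U \<star> var_dist W) em = 0"
      unfolding series_times_def by (simp only: sum.empty)
    then show ?thesis using False by (simp add: em var_dist_def)
  qed
qed

lemma var_dist_times_const:
  assumes "finite U"
  shows "(var_dist U \<star> const_dist p) (j, m) =
    (\<Sum>e\<in>exponents U m. (\<Prod>v\<in>U. sign_of v) * p (j - e))"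
proof -
  let ?S = "(\<lambda>e. ((e, m), (j - e, 0 :: coeff_mono))) ` exponents U m"
  have "(var_dist U \<star> const_dist p) (j, m) = (\<Sum>(a, b)\<in>?S. var_dist U a * const_dist p b)"
    unfolding series_times_def
  proof (rule sum.mono_neutral_left)
    show "finite ?S" by (intro finite_imageI finite_exponents assms)
    show "{(a, b). a + b = (j, m) \<and> var_dist U a \<noteq> 0 \<and> const_dist p b \<noteq> 0} \<subseteq> ?S"
    proof
      fix x assume x: "x \<in> {(a, b). a + b = (j, m) \<and> var_dist U a \<noteq> 0 \<and> const_dist p b \<noteq> 0}"
      obtain f l g k where x_eq: "x = ((f, l), (g, k))" by (metis prod.collapse)
      have "k = 0" "f + g = j" "l + k = m" "f \<in> exponents U l"
        using x by (auto simp: x_eq const_dist_def var_dist_def split: if_splits)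
      then show "x \<in> ?S" by (auto simp: x_eq)
    qed
    have "((e, m), j - e, 0) \<in> {(a, b). a + b = (j, m) \<and> var_dist U a \<noteq> 0 \<and> const_dist p b \<noteq> 0} \<or>
        var_dist U (e, m) * const_dist p (j - e, 0) = 0" for e
      by auto
    then show "\<forall>x\<in>?S - {(a, b). a + b = (j, m) \<and> var_dist U a \<noteq> 0 \<and> const_dist p b \<noteq> 0}.
        (case x of (a, b) \<Rightarrow> var_dist U a * const_dist p b) = 0"
      by auto
  qed
  also have "\<dots> = (\<Sum>e\<in>exponents U m. var_dist U (e, m) * const_dist p (j - e, 0))"
    by (subst sum.reindex) (auto simp: inj_on_def)
  also have "\<dots> = (\<Sum>e\<in>exponents U m. (\<Prod>v\<in>U. sign_of v) * p (j - e))"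
    by (intro sum.cong) (auto simp: var_dist_def const_dist_def)
  finally show ?thesis .
qed

abbreviation all_vars :: "nat \<Rightarrow> nat \<Rightarrow> nat \<Rightarrow> res_var list" where
  "all_vars nc nd ne \<equiv> xvars nc @ yvars nd @ zvars ne"

lemma c_term_eq:
  "c_term \<alpha> \<beta> nc nd ne m = (- 1) ^ (nd * (nd + 1) div 2) / (fact nc * fact nd * fact ne) *
    (\<Sum>e\<in>exponents (set (all_vars nc nd ne)) m. (\<Prod>v\<in>set (all_vars nc nd ne). sign_of v) *
      p_series nc nd ne ((\<Sum>v\<in>set (all_vars nc nd ne). single v (- 1)) - e))"
proof -
  have set: "set (all_vars nc nd ne) = x_var ` {1..nc} \<union> y_var ` {1..nd} \<union> z_var ` {1..ne}"
    by (auto simp: atLeastLessThanSuc_atLeastAtMost)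
  have "series_prod {1..nc} (\<lambda>i. at_var (twist (\<alpha> - \<beta>) C_series) (x_var i)) = var_dist (x_var ` {1..nc})"
    using series_prod_at_var[of "{1..nc}" x_var] by (simp add: series_of_def inj_on_def)
  moreover have "series_prod {1..nd} (\<lambda>i. at_var (twist \<alpha> D_series) (y_var i)) = var_dist (y_var ` {1..nd})"
    using series_prod_at_var[of "{1..nd}" y_var] by (simp add: series_of_def inj_on_def)
  moreover have "series_prod {1..ne} (\<lambda>i. at_var (twist \<beta> E_series) (z_var i)) = var_dist (z_var ` {1..ne})"
    using series_prod_at_var[of "{1..ne}" z_var] by (simp add: series_of_def inj_on_def)
  moreover have "var_dist (x_var ` {1..nc}) \<star> var_dist (y_var ` {1..nd}) \<star> var_dist (z_var ` {1..ne}) =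
      var_dist (set (all_vars nc nd ne))"
  proof -
    have "x_var ` {1..nc} \<inter> y_var ` {1..nd} = {}"
      "(x_var ` {1..nc} \<union> y_var ` {1..nd}) \<inter> z_var ` {1..ne} = {}" by auto
    then show ?thesis by (simp only: var_dist_times set finite_imageI finite_Un finite_atLeastAtMost simp_thms)
  qed
  ultimately show ?thesis
    unfolding c_term_def Res_def by (simp only: var_dist_times_const set[symmetric] finite_set)
qed


subsection \<open>The exponentials\<close>

definition op_of :: "res_var \<Rightarrow> fock_series \<Rightarrow> fock_series" where
  "op_of v = res_op (series_of v) (field_of v)"

text \<open>The ways to split off from \<open>m\<close> a variable that occurs in the series at \<open>v\<close>.\<close>

definition factorizations :: "res_var \<Rightarrow> coeff_mono \<Rightarrow> (int \<times> coeff_mono) set" where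
  "factorizations v m = {(p, l). single (coeff_of v p) 1 + l = m}"

lemma finite_factorizations: "finite (factorizations v m)"
proof -
  have "factorizations v m \<subseteq> (\<lambda>p. (p, m - single (coeff_of v p) 1)) ` {p. coeff_of v p \<in> keys m}"
    by (auto simp: factorizations_def in_keys_iff lookup_add image_iff)
  moreover have "finite {p. coeff_of v p \<in> keys m}"
    using finite_vimageI[OF finite_keys inj_coeff_of] by (simp add: vimage_def)
  ultimately show ?thesis by (meson finite_imageI finite_subset)
qed

lemma op_of_eq:
  "op_of v F m =
    (\<Sum>(p, l)\<in>factorizations v m. scale (sign_of v) (field_of v (- 1 - p) (F l)))"
  unfolding op_of_def res_op_def
proof (rule sum.reindex_bij_witness[of _ "\<lambda>(p, l). (p, single (coeff_of v p) 1, l)" "\<lambda>(p, m1, l). (p, l)"])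
qed (auto simp: factorizations_def series_of_eq sign_of_nonzero split: if_splits)

text \<open>
  Each residue operator gets a residue variable of its own, and the sum over its exponent is the sum
  over the variable that it splits off from the monomial \<open>m\<close>.
\<close>

lemma foldr_op_of:
  assumes "distinct vs"
  shows "foldr (op_of) vs (const_series vac) m =
    (\<Sum>e\<in>exponents (set vs) m. scale (\<Prod>v\<in>set vs. sign_of v)
      (foldr (\<lambda>v. field_of v (- 1 - lookup e v)) vs vac))"
  using assms
proof (induction vs arbitrary: m)
  case Nil
  have "exponents {} m = (if m = 0 then {0} else {})"
    by (auto simp: exponents_def monomial_of_def)
  then show ?case by (simp add: const_series_def)
next
  case (Cons v vs)
  have v: "v \<notin> set vs" and d: "distinct vs" using Cons.prems by auto
  let ?s = "\<Prod>v\<in>set vs. sign_of v"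
  let ?u = "\<lambda>e. foldr (\<lambda>v. field_of v (- 1 - lookup e v)) vs vac"
  let ?A = "factorizations v m"
  have u: "?u (e + single v p) = ?u e" for e p
    by (rule foldr_cong) (use v in \<open>auto simp: lookup_add lookup_single when_def\<close>)
  have mono: "monomial_of (set (v # vs)) (e + single v p) =
      single (coeff_of v p) 1 + monomial_of (set vs) e" if "lookup e v = 0" for e p
  proof -
    have "monomial_of (set vs) (e + single v p) = monomial_of (set vs) e"
      unfolding monomial_of_def using v by (intro sum.cong) (auto simp: lookup_add lookup_single when_def)
    then show ?thesis using v that by (simp add: monomial_of_def lookup_add)
  qed
  have key: "lookup e v = 0" if "e \<in> exponents (set vs) l" for e l
    using that v by (auto simp: exponents_def in_keys_iff)
  have "foldr (op_of) (v # vs) (const_series vac) m =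
      (\<Sum>(p, l)\<in>?A. scale (sign_of v) (field_of v (- 1 - p)
        (\<Sum>e\<in>exponents (set vs) l. scale ?s (?u e))))"
    by (simp add: op_of_eq Cons.IH[OF d])
  also have "\<dots> = (\<Sum>x\<in>?A. \<Sum>e\<in>exponents (set vs) (snd x).
      scale (sign_of v * ?s) (field_of v (- 1 - fst x) (?u e)))"
    by (intro sum.cong) (auto simp: module_hom.sum[OF lin_field_of] lin_scale[OF lin_field_of] fock.scale_sum_right)
  also have "\<dots> = (\<Sum>(x, e)\<in>(SIGMA x:?A. exponents (set vs) (snd x)).
      scale (sign_of v * ?s) (field_of v (- 1 - fst x) (?u e)))"
    by (intro sum.Sigma finite_factorizations ballI finite_exponents) simp
  also have "\<dots> = (\<Sum>e\<in>exponents (set (v # vs)) m. scale (\<Prod>v\<in>set (v # vs). sign_of v)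
      (foldr (\<lambda>v. field_of v (- 1 - lookup e v)) (v # vs) vac))"
  proof (rule sum.reindex_bij_witness[of _
        "\<lambda>e. ((lookup e v, monomial_of (set vs) (e - single v (lookup e v))), e - single v (lookup e v))"
        "\<lambda>(x, e). e + single v (fst x)"])
    fix y assume y: "y \<in> (SIGMA x:?A. exponents (set vs) (snd x))"
    then obtain p l e where y_eq: "y = ((p, l), e)" by (metis prod.collapse)
    have pl: "single (coeff_of v p) 1 + l = m" and e: "e \<in> exponents (set vs) l"
      using y by (auto simp: y_eq factorizations_def)
    have ke: "keys e \<subseteq> set vs" "monomial_of (set vs) e = l" using e by (auto simp: exponents_def)
    have lv: "lookup (e + single v p) v = p" using key[OF e] by (simp add: lookup_add)
    let ?e = "case y of (x, e) \<Rightarrow> e + single v (fst x)"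
    have e_eq: "?e = e + single v p" by (simp add: y_eq)
    show "((lookup ?e v, monomial_of (set vs) (?e - single v (lookup ?e v))), ?e - single v (lookup ?e v)) = y"
      unfolding e_eq lv by (simp add: y_eq ke(2))
    have "keys (e + single v p) \<subseteq> set (v # vs)"
      using ke(1) keys_add[of e "single v p"] by (auto split: if_splits)
    then show "?e \<in> exponents (set (v # vs)) m"
      unfolding e_eq using mono[OF key[OF e], of p] ke(2) pl by (simp add: exponents_def)
    show "scale (\<Prod>v\<in>set (v # vs). sign_of v)
        (foldr (\<lambda>v. field_of v (- 1 - lookup ?e v)) (v # vs) vac) =
      (case y of (x, e) \<Rightarrow> scale (sign_of v * ?s) (field_of v (- 1 - fst x) (?u e)))"
      unfolding e_eq foldr.simps comp_apply u lv using v by (simp add: y_eq)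
  next
    fix e assume e: "e \<in> exponents (set (v # vs)) m"
    let ?f = "e - single v (lookup e v)"
    have f0: "lookup ?f v = 0" by (simp add: lookup_minus)
    show "(case ((lookup e v, monomial_of (set vs) ?f), ?f) of (x, e) \<Rightarrow> e + single v (fst x)) = e"
      by simp
    have "keys ?f \<subseteq> set vs"
    proof
      fix x assume x: "x \<in> keys ?f"
      then have "x \<noteq> v" using f0 by (auto simp: in_keys_iff)
      then have "x \<in> keys e" using x by (simp add: in_keys_iff lookup_minus lookup_single)
      then show "x \<in> set vs" using e \<open>x \<noteq> v\<close> by (auto simp: exponents_def)
    qed
    moreover have "single (coeff_of v (lookup e v)) 1 + monomial_of (set vs) ?f = m"
      using mono[OF f0, of "lookup e v"] e by (simp add: exponents_def)
    ultimately show "((lookup e v, monomial_of (set vs) ?f), ?f) \<in> (SIGMA x:?A. exponents (set vs) (snd x))"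
      by (simp add: factorizations_def exponents_def)
  qed
  finally show ?case .
qed

definition total_degree :: "coeff_mono \<Rightarrow> nat" where
  "total_degree m = (\<Sum>v\<in>keys m. lookup m v)"

lemma total_degree_add: "total_degree (m + n) = total_degree m + total_degree n"
proof -
  let ?A = "keys m \<union> keys n"
  have "total_degree l = (\<Sum>v\<in>?A. lookup l v)" if "keys l \<subseteq> ?A" for l
    unfolding total_degree_def using that by (intro sum.mono_neutral_left) (auto simp: in_keys_iff)
  then show ?thesis using keys_add[of m n] by (simp add: lookup_add sum.distrib)
qed

lemma total_degree_factorization:
  "(p, l) \<in> factorizations v m \<Longrightarrow> total_degree m = Suc (total_degree l)"
  by (auto simp: factorizations_def total_degree_add) (simp add: total_degree_def)

text \<open>
  Each residue operator raises the total degree by one. Therefore, up to degree \<open>N\<close>, the exponential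
  series may be replaced by their partial sums.
\<close>

definition agree :: "nat \<Rightarrow> fock_series \<Rightarrow> fock_series \<Rightarrow> bool" where
  "agree N F G \<longleftrightarrow> (\<forall>m. total_degree m \<le> N \<longrightarrow> F m = G m)"

lemma agree_op_of: "agree N F G \<Longrightarrow> agree N (op_of v F) (op_of v G)"
  unfolding agree_def op_of_eq
  by (intro allI impI sum.cong) (auto dest!: total_degree_factorization)

lemma agree_funpow: "agree N F G \<Longrightarrow> agree N ((op_of v ^^ n) F) ((op_of v ^^ n) G)"
  by (induction n) (auto intro: agree_op_of)

lemma funpow_op_of_low_degree: "total_degree m < n \<Longrightarrow> (op_of v ^^ n) F m = 0"
proof (induction n arbitrary: m)
  case (Suc n)
  have "(op_of v ^^ n) F l = 0" if "(p, l) \<in> factorizations v m" for p l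
    using Suc total_degree_factorization[OF that] by simp
  then have "op_of v ((op_of v ^^ n) F) m = 0"
    by (subst op_of_eq, intro sum.neutral) (auto simp: lin_zero[OF lin_field_of])
  then show ?case by simp
qed simp

definition partial_exp :: "nat \<Rightarrow> (fock_series \<Rightarrow> fock_series) \<Rightarrow> fock_series \<Rightarrow> fock_series" where
  "partial_exp N A F m = (\<Sum>n\<le>N. scale (1 / fact n) ((A ^^ n) F m))"

lemma agree_exp_op:
  assumes "agree N F G"
  shows "agree N (exp_op (op_of v) F) (partial_exp N (op_of v) G)"
  unfolding agree_def
proof (intro allI impI)
  fix m assume m: "total_degree m \<le> N"
  have "n \<le> N" if "(op_of v ^^ n) F m \<noteq> 0" for n
    using that funpow_op_of_low_degree[of m n] m by (meson le_less_trans not_le)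
  then have "exp_op (op_of v) F m = (\<Sum>n\<le>N. scale (1 / fact n) ((op_of v ^^ n) F m))"
    unfolding exp_op_def by (intro sum.mono_neutral_left) auto
  also have "\<dots> = partial_exp N (op_of v) G m"
    unfolding partial_exp_def
    using agree_funpow[OF assms] m by (intro sum.cong) (auto simp: agree_def)
  finally show "exp_op (op_of v) F m = partial_exp N (op_of v) G m" .
qed

lemma funpow_op_of_sum:
  "(op_of v ^^ n) (\<lambda>m. \<Sum>i\<in>I. scale (c i) (F i m)) =
    (\<lambda>m. \<Sum>i\<in>I. scale (c i) ((op_of v ^^ n) (F i) m))"
proof (induction n)
  case (Suc n)
  have "op_of v (\<lambda>m. \<Sum>i\<in>I. scale (c i) (G i m)) m = (\<Sum>i\<in>I. scale (c i) (op_of v (G i) m))"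
    for G m
  proof -
    have "op_of v (\<lambda>m. \<Sum>i\<in>I. scale (c i) (G i m)) m =
        (\<Sum>x\<in>factorizations v m. \<Sum>i\<in>I. scale (c i) (scale (sign_of v)
          (field_of v (- 1 - fst x) (G i (snd x)))))"
      unfolding op_of_eq
      by (intro sum.cong) (auto simp: module_hom.sum[OF lin_field_of] lin_scale[OF lin_field_of]
          fock.scale_sum_right mult.commute)
    also have "\<dots> = (\<Sum>i\<in>I. scale (c i) (op_of v (G i) m))"
      by (subst sum.swap) (simp add: op_of_eq fock.scale_sum_right case_prod_unfold)
    finally show ?thesis .
  qed
  then show ?case using Suc by simp
qed simp

lemma partial_exp_sum:
  "partial_exp N (op_of v) (\<lambda>m. \<Sum>i\<in>I. scale (c i) (F i m)) m =
    (\<Sum>n\<le>N. \<Sum>i\<in>I. scale (1 / fact n * c i) ((op_of v ^^ n) (F i) m))"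
  unfolding partial_exp_def funpow_op_of_sum by (simp add: fock.scale_sum_right)

lemma op_of_simps:
  "op_of (x_var i) = res_op (twist (\<alpha> - \<beta>) C_series) (E_field 1 0)"
  "op_of (y_var i) = res_op (twist \<alpha> D_series) (E_field 2 0)"
  "op_of (z_var i) = res_op (twist \<beta> E_series) (E_field 2 1)"
  by (simp_all add: op_of_def series_of_def field_of_def)

lemma funpow_op_of_vars:
  "foldr (op_of) (xvars n) F = (op_of (x_var 0) ^^ n) F"
  "foldr (op_of) (yvars n) F = (op_of (y_var 0) ^^ n) F"
  "foldr (op_of) (zvars n) F = (op_of (z_var 0) ^^ n) F"
proof -
  have "foldr (\<lambda>_. f) is F = (f ^^ length is) F" for f :: "'a \<Rightarrow> 'a" and F and "is" :: "nat list"
    by (induction "is") auto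
  note * = this
  show "foldr (op_of) (xvars n) F = (op_of (x_var 0) ^^ n) F"
    "foldr (op_of) (yvars n) F = (op_of (y_var 0) ^^ n) F"
    "foldr (op_of) (zvars n) F = (op_of (z_var 0) ^^ n) F"
    by (simp_all add: foldr_map comp_def op_of_simps *)
qed

lemma g_op_expansion:
  assumes "total_degree m \<le> N"
  shows "g_op \<alpha> \<beta> (const_series vac) m =
    (\<Sum>(nc, nd, ne)\<in>{..N} \<times> {..N} \<times> {..N}. scale (1 / (fact nc * fact nd * fact ne))
      (foldr (op_of) (all_vars nc nd ne) (const_series vac) m))"
proof -
  let ?X = "op_of (x_var 0)" and ?Y = "op_of (y_var 0)" and ?Z = "op_of (z_var 0)"
  let ?e = "partial_exp N" and ?v = "const_series vac"
  have "agree N (exp_op ?X (exp_op ?Y (exp_op ?Z ?v))) (?e ?X (?e ?Y (?e ?Z ?v)))"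
    by (intro agree_exp_op) (simp add: agree_def)
  then have "g_op \<alpha> \<beta> ?v m = ?e ?X (?e ?Y (?e ?Z ?v)) m"
    using assms by (simp add: agree_def g_op_def op_of_simps)
  also have "?e ?Z ?v = (\<lambda>m. \<Sum>ne\<in>{..N}. scale (1 / fact ne) ((?Z ^^ ne) ?v m))"
    by (rule ext) (simp add: partial_exp_def)
  also have "?e ?Y \<dots> = (\<lambda>m. \<Sum>(nd, ne)\<in>{..N} \<times> {..N}. scale (1 / fact nd * (1 / fact ne)) ((?Y ^^ nd) ((?Z ^^ ne) ?v) m))"
    by (rule ext) (simp only: partial_exp_sum sum.cartesian_product)
  also have "\<dots> = (\<lambda>m. \<Sum>q\<in>{..N} \<times> {..N}. scale (1 / fact (fst q) * (1 / fact (snd q)))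
      ((?Y ^^ fst q) ((?Z ^^ snd q) ?v) m))"
    by (simp only: case_prod_unfold)
  also have "?e ?X \<dots> m = (\<Sum>(nc, q)\<in>{..N} \<times> {..N} \<times> {..N}.
      scale (1 / fact nc * (1 / fact (fst q) * (1 / fact (snd q))))
        ((?X ^^ nc) ((?Y ^^ fst q) ((?Z ^^ snd q) ?v)) m))"
    by (simp only: partial_exp_sum sum.cartesian_product)
  also have "\<dots> = (\<Sum>(nc, nd, ne)\<in>{..N} \<times> {..N} \<times> {..N}. scale (1 / (fact nc * fact nd * fact ne))
      (foldr (op_of) (all_vars nc nd ne) ?v m))"
  proof (rule sum.cong[OF refl])
    fix q :: "nat \<times> nat \<times> nat"
    obtain nc nd ne where q: "q = (nc, nd, ne)" by (metis prod_cases3)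
    show "(case q of (nc, q) \<Rightarrow> scale (1 / fact nc * (1 / fact (fst q) * (1 / fact (snd q))))
        ((?X ^^ nc) ((?Y ^^ fst q) ((?Z ^^ snd q) ?v)) m)) =
      (case q of (nc, nd, ne) \<Rightarrow> scale (1 / (fact nc * fact nd * fact ne))
        (foldr (op_of) (all_vars nc nd ne) ?v m))"
      by (simp only: q prod.case fst_conv snd_conv foldr_append comp_apply funpow_op_of_vars)
        (simp add: mult.assoc)
  qed
  finally show ?thesis .
qed


section \<open>The residue formula\<close>

lemma foldr_field_of:
  "foldr (\<lambda>v. field_of v (- 1 - lookup e v)) (all_vars nc nd ne) vac =
    E_word (word nc nd ne) ((\<Sum>v\<in>set (all_vars nc nd ne). single v (- 1)) - e)"
proof -
  let ?j = "(\<Sum>v\<in>set (all_vars nc nd ne). single v (- 1)) - e"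
  have j: "lookup ?j v = - 1 - lookup e v" if "v \<in> set (all_vars nc nd ne)" for v
  proof -
    have "lookup (\<Sum>v\<in>set (all_vars nc nd ne). single v (- 1 :: int)) v =
        (\<Sum>w\<in>set (all_vars nc nd ne). if w = v then - 1 else 0)"
      unfolding lookup_sum by (intro sum.cong) (auto simp: lookup_single when_def)
    also have "\<dots> = - 1" using that by (subst sum.delta) auto
    finally show ?thesis by (simp add: lookup_minus)
  qed
  have "foldr (\<lambda>v. field_of v (- 1 - lookup e v)) (all_vars nc nd ne) vac =
      foldr (\<lambda>v. field_of v (lookup ?j v)) (all_vars nc nd ne) vac"
    by (rule foldr_cong[OF refl refl]) (simp only: j)
  also have "\<dots> = E_word (word nc nd ne) ?j"
    by (simp add: E_word_def word_def foldr_map comp_def field_of_def)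
  finally show ?thesis .
qed

text \<open>
  Both the residues and the correlators are sums over the same set of exponents; taking the residue
  pairs the exponent \<open>e\<close> of the series with \<open>- 1 - e\<close> in the fields and in \<open>p\<close>.
\<close>

lemma tau_bra_term:
  "tau_bra k l (foldr (op_of) (all_vars nc nd ne) (const_series vac) m) / (fact nc * fact nd * fact ne) =
    (if nc + nd = k \<and> nd + ne = l then c_term \<alpha> \<beta> nc nd ne m else 0)"
proof -
  let ?U = "set (all_vars nc nd ne)" and ?j = "\<lambda>e. (\<Sum>v\<in>set (all_vars nc nd ne). single v (- 1)) - e"
  let ?s = "\<Prod>v\<in>set (all_vars nc nd ne). sign_of v"
  have hom: "module_hom scale (*) (tau_bra k l)" using bra_tau by (simp add: bra_def)
  have "distinct (all_vars nc nd ne)" by (auto simp: distinct_map inj_on_def)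
  then have *: "tau_bra k l (foldr (op_of) (all_vars nc nd ne) (const_series vac) m) =
      (\<Sum>e\<in>exponents ?U m. ?s * tau_bra k l (E_word (word nc nd ne) (?j e)))"
    by (simp only: foldr_op_of module_hom.sum[OF hom] module_hom.scale[OF hom] foldr_field_of)
  show ?thesis
  proof (cases "nc + nd = k \<and> nd + ne = l")
    case True
    have "tau_bra k l (E_word (word nc nd ne) (?j e)) =
        (- 1) ^ (nd * (nd + 1) div 2) * p_series nc nd ne (?j e)" if "e \<in> exponents ?U m" for e
    proof -
      have "keys (\<Sum>v\<in>?U. single v (- 1 :: int)) \<subseteq> ?U"
      proof
        fix x assume "x \<in> keys (\<Sum>v\<in>?U. single v (- 1 :: int))"
        then obtain v where "v \<in> ?U" "lookup (single v (- 1 :: int)) x \<noteq> 0"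
          unfolding in_keys_iff lookup_sum using sum.not_neutral_contains_not_neutral by blast
        then show "x \<in> ?U" by (auto simp: lookup_single when_def split: if_splits)
      qed
      moreover have "keys e \<subseteq> ?U" using that by (simp add: exponents_def)
      ultimately have "keys (?j e) \<subseteq> set (xvars nc) \<union> set (yvars nd) \<union> set (zvars ne)"
        using keys_diff[of "\<Sum>v\<in>?U. single v (- 1 :: int)" e] by (simp only: set_append) blast
      from E_word_correlator[OF this] show ?thesis using True by simp
    qed
    then have "tau_bra k l (foldr (op_of) (all_vars nc nd ne) (const_series vac) m) =
        (\<Sum>e\<in>exponents ?U m. (- 1) ^ (nd * (nd + 1) div 2) * (?s * p_series nc nd ne (?j e)))"
      unfolding * by (intro sum.cong) (auto simp: mult_ac)
    then show ?thesis using True by (simp only: c_term_eq sum_distrib_left[symmetric]) simp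
  next
    case False
    then have "tau_bra k l (E_word (word nc nd ne) e) = 0" for e by (intro E_word_other_charge) auto
    then show ?thesis using False unfolding * by (simp only: mult_zero_right sum.neutral_const if_False) simp
  qed
qed

end

theorem theorem3p2:
  fixes \<alpha> \<beta> :: int and k l :: nat
  shows "tau \<alpha> \<beta> k l =
    (\<lambda>m. \<Sum>(nc, nd, ne) \<in> {(nc, nd, ne). nc + nd = k \<and> nd + ne = l}. c_term \<alpha> \<beta> nc nd ne m)"
proof
  fix m
  \<comment> \<open>large enough both for the exponentials in degree \<open>m\<close> and for all indices of the formula\<close>
  let ?N = "total_degree m + k + l"
  let ?B = "{..?N} \<times> {..?N} \<times> {..?N}" and ?S = "{(nc, nd, ne). nc + nd = k \<and> nd + ne = l}"
  have hom: "module_hom scale (*) (tau_bra k l)" using bra_tau by (simp add: bra_def)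
  have "tau \<alpha> \<beta> k l m = tau_bra k l (g_op \<alpha> \<beta> (const_series vac) m)"
    by (simp add: tau_def tau_bra_def)
  also have "\<dots> = (\<Sum>(nc, nd, ne)\<in>?B. if nc + nd = k \<and> nd + ne = l then c_term \<alpha> \<beta> nc nd ne m else 0)"
  proof -
    have "g_op \<alpha> \<beta> (const_series vac) m = (\<Sum>(nc, nd, ne)\<in>?B. scale (1 / (fact nc * fact nd * fact ne))
      (foldr (op_of \<alpha> \<beta>) (all_vars nc nd ne) (const_series vac) m))"
      by (rule g_op_expansion) simp
    then show ?thesis
      unfolding tau_bra_term[symmetric]
      by (simp add: module_hom.sum[OF hom] module_hom.scale[OF hom] case_prod_unfold del: map_append)
  qed
  also have "\<dots> = (\<Sum>(nc, nd, ne)\<in>?S. if nc + nd = k \<and> nd + ne = l then c_term \<alpha> \<beta> nc nd ne m else 0)"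
    by (rule sum.mono_neutral_right) (auto split: if_splits)
  also have "\<dots> = (\<Sum>(nc, nd, ne)\<in>?S. c_term \<alpha> \<beta> nc nd ne m)"
    by (intro sum.cong) auto
  finally show "tau \<alpha> \<beta> k l m = (\<Sum>(nc, nd, ne)\<in>?S. c_term \<alpha> \<beta> nc nd ne m)" .
qed

end
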